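(* Let $K\subset\mathbb{R}^2$ be a compact convex set of area $F$ with boundary of class $C^2$ and support function of class $C^2$. Let $A$ be the area enclosed by the pedal curve of $K$ with respect to the Steiner point of $K$. Then $$\int_{P\notin K}(\omega^2-\sin^2\omega)\,dP\ \ge\ (16-\pi^2)F+\frac{32}{3}(A-F),$$ where $\omega=\omega(P)$ is the visual angle of $K$ from $P$. Equality holds if and only if $\partial K$ is a circle or a curve parallel to an astroid.
   Context: The support function of a compact convex set $K$ is the $2\pi$-periodic function $p(\varphi)=\sup\{x\cos\varphi+y\sin\varphi : (x,y)\in K\}$, with Fourier series $p(\varphi)=a_0+\sum_{n\ge1}(a_n\cos n\varphi+b_n\sin n\varphi)$. The Steiner point of $K$ is $s(K)=\frac1\pi\int_0^{2\pi}p(\varphi)(\cos\varphi,\sin\varphi)\,d\varphi=(a_1,b_1)$. The support function of $K$ relative to the Steiner point as origin is $q(\varphi)=p(\varphi)-a_1\cos\varphi-b_1\sin\varphi$. The pedal curve of $K$ with respect to the Steiner point is the curve given in polar coordinates centred at the Steiner point by $r=q(\varphi)$, and it encloses area $A=\frac12\int_0^{2\pi}q(\varphi)^2\,d\varphi$. For $P\notin K$, the visual angle $\omega(P)\in(0,\pi)$ is the angle between the two tangent lines from $P$ to $\partial K$ (the angle at $P$ under which $K$ is seen). $dP$ denotes Lebesgue (area) measure on $\mathbb{R}^2$, and $\int_{P\notin K}$ is integration over $\mathbb{R}^2\setminus K$. "$\partial K$ is a circle or a curve parallel to an astroid" means that the support function relative to the Steiner point has the form $q(\varphi)=a_0+a_2\cos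 2\varphi+b_2\sin 2\varphi$ (circle when $a_2=b_2=0$). *)

theory Defs
  imports "HOL-Analysis.Analysis"
begin

definition C2_function :: "(real \<Rightarrow> 'a::real_normed_vector) \<Rightarrow> bool" where
  "C2_function f \<longleftrightarrow>
     (\<exists>f'. (\<forall>t. (f has_vector_derivative f' t) (at t)) \<and> f' C1_differentiable_on UNIV)"

text \<open>The boundary is a regular simple closed curve of class \<open>C\<^sup>2\<close>. For compact convex
  sets this excludes the empty set, points and segments, so the interior is nonempty.\<close>

definition C2_boundary :: "(real^2) set \<Rightarrow> bool" where
  "C2_boundary K \<longleftrightarrow>
     (\<exists>\<gamma> :: real \<Rightarrow> real^2.
        C2_function \<gamma> \<and>
        (\<forall>t. vector_derivative \<gamma> (at t) \<noteq> 0) \<and>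
        (\<forall>t. \<gamma> (t + 2 * pi) = \<gamma> t) \<and>
        inj_on \<gamma> {0..<2 * pi} \<and>
        range \<gamma> = frontier K)"

definition unit_dir :: "real \<Rightarrow> real^2" where
  "unit_dir \<phi> = vector [cos \<phi>, sin \<phi>]"

definition support_fun :: "(real^2) set \<Rightarrow> real \<Rightarrow> real" where
  "support_fun K \<phi> = (SUP z\<in>K. z $ 1 * cos \<phi> + z $ 2 * sin \<phi>)"

definition steiner_point :: "(real^2) set \<Rightarrow> real^2" where
  "steiner_point K =
     (1 / pi) *\<^sub>R integral {0..2 * pi} (\<lambda>\<phi>. support_fun K \<phi> *\<^sub>R unit_dir \<phi>)"

definition steiner_support_fun :: "(real^2) set \<Rightarrow> real \<Rightarrow> real" where
  "steiner_support_fun K \<phi> =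
     support_fun K \<phi> - steiner_point K $ 1 * cos \<phi> - steiner_point K $ 2 * sin \<phi>"

definition pedal_curve :: "(real^2) set \<Rightarrow> real \<Rightarrow> real^2" where
  "pedal_curve K \<phi> = steiner_point K + steiner_support_fun K \<phi> *\<^sub>R unit_dir \<phi>"

text \<open>If the Steiner point is interior to \<open>K\<close>, then \<open>steiner_support_fun K\<close> is positive, the
  pedal curve is simple, and this area is
  \<open>1/2 * integral {0..2 * pi} (\<lambda>\<phi>. (steiner_support_fun K \<phi>)\<^sup>2)\<close>.\<close>

definition pedal_area :: "(real^2) set \<Rightarrow> real" where
  "pedal_area K = measure lebesgue (inside (pedal_curve K ` {0..2 * pi}))"

text \<open>Tangent lines of a convex set are its support lines; when the boundary is smooth they are
  exactly the tangent lines of the boundary curve.\<close>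

definition tangent_line :: "(real^2) set \<Rightarrow> (real^2) set \<Rightarrow> bool" where
  "tangent_line K l \<longleftrightarrow>
     (\<exists>n c. n \<noteq> 0 \<and> l = {x. n \<bullet> x = c} \<and> (\<forall>x\<in>K. n \<bullet> x \<le> c) \<and> l \<inter> K \<noteq> {})"

definition vangle :: "real^2 \<Rightarrow> real^2 \<Rightarrow> real" where
  "vangle u v = arccos (u \<bullet> v / (norm u * norm v))"

text \<open>Of the two supplementary angles formed by the tangent lines through \<open>P\<close>, the visual angle is
  the one containing \<open>K\<close>: it lies between the rays from \<open>P\<close> to the points of contact \<open>T1\<close>, \<open>T2\<close>.
  For \<open>K\<close> compact convex with nonempty interior and \<open>P \<notin> K\<close> it is uniquely determined: there are
  exactly two tangent lines through \<open>P\<close>, and all contact points on one of them lie on the same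
  ray from \<open>P\<close>.\<close>

definition visual_angle :: "(real^2) set \<Rightarrow> real^2 \<Rightarrow> real" where
  "visual_angle K P =
     (THE \<omega>. \<exists>l1 l2 T1 T2.
        tangent_line K l1 \<and> tangent_line K l2 \<and> l1 \<noteq> l2 \<and> P \<in> l1 \<and> P \<in> l2 \<and>
        T1 \<in> l1 \<inter> K \<and> T2 \<in> l2 \<inter> K \<and>
        \<omega> = vangle (T1 - P) (T2 - P))"

definition circle_or_parallel_to_astroid :: "(real^2) set \<Rightarrow> bool" where
  "circle_or_parallel_to_astroid K \<longleftrightarrow>
     (\<exists>a0 a2 b2. \<forall>\<phi>. steiner_support_fun K \<phi> = a0 + a2 * cos (2 * \<phi>) + b2 * sin (2 * \<phi>))"

end

theory Submission
  imports Defs "HOL-Real_Asymp.Real_Asymp"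
begin

text \<open>Let \<open>q\<close> be the support function about the Steiner point \<open>s\<close> and \<open>u(\<phi>) = (cos \<phi>, sin \<phi>)\<close>.

A point \<open>P\<close> outside \<open>K\<close> lies on exactly two support lines, with outer normals \<open>u(\<phi>)\<close> and
\<open>u(\<phi> + \<theta>)\<close> for some \<open>0 < \<theta> < \<pi>\<close>, and sees \<open>K\<close> under the angle \<open>\<pi> - \<theta>\<close>. So \<open>(\<theta>, \<phi>)\<close> are global
coordinates of the exterior; the Jacobian is the product of the two tangent lengths divided by
\<open>sin \<theta>\<close>. It is quadratic in \<open>q\<close>, hence its integral over \<open>\<phi>\<close> depends on \<open>q\<close> only through the
autocorrelation \<open>R(\<theta>) = \<integral> q(\<phi>) q(\<phi> + \<theta>) d\<phi>\<close>, and it turns out to be the second derivative of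
\<open>(R(\<theta>) - R(0) cos \<theta>) / sin \<theta>\<close>. The weight \<open>\<omega>\<^sup>2 - sin\<^sup>2 \<omega> = (\<pi> - \<theta>)\<^sup>2 - sin\<^sup>2 \<theta>\<close> has second derivative
\<open>4 sin\<^sup>2 \<theta>\<close>, so integrating by parts twice cancels the denominator and gives (lemmas
\<open>exterior_integral\<close>, \<open>exterior_integral_by_parts\<close>)
\[ \int_{P\notin K} (\omega^2 - \sin^2\omega)\,dP = 4\int_0^\pi R(\theta)\sin\theta\,d\theta - \pi^2 F . \]

Since \<open>F = 1/2 \<integral> (q\<^sup>2 - q'\<^sup>2)\<close> and \<open>A = 1/2 \<integral> q\<^sup>2\<close> (\<open>area_K\<close>, \<open>pedal_area_eq\<close>), the claim becomes
\<open>2 \<integral> q\<^sup>2 \<le> \<integral>\<^sub>0\<^sup>\<pi> R sin + 2/3 \<integral> q'\<^sup>2\<close>, which is \<open>autocorrelation_inequality\<close>. On the \<open>n\<close>-th Fourier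
mode it compares \<open>2/(1 - n\<^sup>2)\<close> for even \<open>n\<close>, and \<open>0\<close> for odd \<open>n\<close>, with \<open>2 - 2 n\<^sup>2 / 3\<close>; the modes
\<open>n = \<plusminus>1\<close>, where it would fail, are absent exactly because \<open>s\<close> is the Steiner point, and there is
equality for \<open>n = 0\<close> and \<open>n = \<plusminus>2\<close> only.

The proof replaces Fourier series by Wirtinger's inequality for \<open>\<pi>\<close>-periodic functions of mean zero.
Let \<open>E\<close> and \<open>Q\<close> be \<open>q(\<phi>) \<plusminus> q(\<phi> + \<pi>)\<close>. Only \<open>E\<close> contributes to \<open>\<integral> R sin\<close>, through the solution
\<open>W\<close> of \<open>W'' + W = 2 E\<close>; expressing everything by \<open>W\<close> the difference of the two sides is a square plus
a Wirtinger deficit of \<open>W'\<close> (\<open>pi_periodic_inequality\<close>). The part of \<open>Q\<close> is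
\<open>3 \<integral> Q\<^sup>2 \<le> \<integral> Q'\<^sup>2\<close>, which is Wirtinger's inequality for the two \<open>\<pi>\<close>-periodic functions
\<open>Q cos\<close> and \<open>Q sin\<close> (\<open>pi_antiperiodic_inequality\<close>).\<close>

section \<open>Periodic functions and integrals with a shifted argument\<close>

lemma continuous_of_deriv:
  fixes f :: "real \<Rightarrow> real"
  assumes "\<And>x. (f has_real_derivative f' x) (at x)"
  shows "continuous_on UNIV f"
  using assms by (auto intro!: continuous_at_imp_continuous_on intro: DERIV_isCont)

lemma continuous_imp_antiderivative:
  fixes f :: "real \<Rightarrow> real"
  assumes "continuous_on UNIV f"
  obtains g where "\<And>x. (g has_real_derivative f x) (at x)"
proof -
  have "\<exists>g. \<forall>x::real. (-\<infinity>) < ereal x \<longrightarrow> ereal x < \<infinity> \<longrightarrow> (g has_vector_derivative f x) (at x)"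
    by (rule einterval_antiderivative)
       (use assms in \<open>auto simp: continuous_on_eq_continuous_at\<close>)
  then show ?thesis
    using that by (auto simp: has_real_derivative_iff_has_vector_derivative)
qed

lemma integral_eq_diff:
  fixes g :: "real \<Rightarrow> real"
  assumes "\<And>x. (g has_real_derivative f x) (at x)" "a \<le> b"
  shows "(f has_integral g b - g a) {a..b}" "integral {a..b} f = g b - g a"
proof -
  show "(f has_integral g b - g a) {a..b}"
    by (rule fundamental_theorem_of_calculus[OF assms(2)])
       (use assms(1) in \<open>auto simp: has_real_derivative_iff_has_vector_derivative[symmetric]
          intro: has_field_derivative_at_within\<close>)
  then show "integral {a..b} f = g b - g a" by blast
qed

lemma periodic_antiderivative:
  fixes f :: "real \<Rightarrow> real"
  assumes "continuous_on UNIV f" "\<And>x. f (x + T) = f x"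
  obtains g c where "\<And>x. (g has_real_derivative f x) (at x)" "\<And>x. g (x + T) = g x + c"
proof -
  obtain g where g: "\<And>x. (g has_real_derivative f x) (at x)"
    using continuous_imp_antiderivative assms(1) by blast
  have "((\<lambda>x. g (x + T) - g x) has_real_derivative 0) (at x)" for x
    using DERIV_diff[OF DERIV_shift[THEN iffD1, OF g[of "x + T"]] g[of x]] assms(2) by simp
  then have "g (x + T) - g x = g (0 + T) - g 0" for x
    using DERIV_isconst_all[of "\<lambda>x. g (x + T) - g x" x 0] by blast
  then have "\<And>x. g (x + T) = g x + (g (0 + T) - g 0)" by (metis add.commute diff_add_cancel)
  then show ?thesis using that g by blast
qed

lemma integral_period_shift:
  fixes f :: "real \<Rightarrow> real"
  assumes "continuous_on UNIV f" "\<And>x. f (x + T) = f x" "0 \<le> T"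
  shows "integral {0..T} (\<lambda>x. f (x + a)) = integral {0..T} f"
proof -
  obtain g c where g: "\<And>x. (g has_real_derivative f x) (at x)" "\<And>x. g (x + T) = g x + c"
    using periodic_antiderivative[of f T] assms(1,2) by metis
  have *: "integral {0..T} (\<lambda>x. f (x + a)) = g (T + a) - g a" for a
    using integral_eq_diff(2)[where g = "\<lambda>x. g (x + a)" and f = "\<lambda>x. f (x + a)", OF _ assms(3)]
      g(1)[THEN DERIV_shift[THEN iffD1]] by simp
  show ?thesis using *[of a] *[of 0] g(2)[of a] g(2)[of 0] by (simp add: add.commute)
qed

lemma integral_two_periods:
  fixes f :: "real \<Rightarrow> real"
  assumes "continuous_on UNIV f" "\<And>x. f (x + T) = f x" "0 \<le> T"
  shows "integral {0..2 * T} f = 2 * integral {a..a + T} f"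
proof -
  obtain g c where g: "\<And>x. (g has_real_derivative f x) (at x)" "\<And>x. g (x + T) = g x + c"
    using periodic_antiderivative[of f T] assms(1,2) by metis
  have "g (2 * T) = g 0 + 2 * c" using g(2)[of 0] g(2)[of T] by simp
  then show ?thesis
    using integral_eq_diff(2)[OF g(1), of 0 "2 * T"] integral_eq_diff(2)[OF g(1), of a "a + T"]
      g(2)[of a] assms(3) by simp
qed

lemma periodic_of_int:
  fixes f :: "real \<Rightarrow> 'a"
  assumes "\<And>x. f (x + T) = f x"
  shows "f (x + of_int n * T) = f x"
proof -
  have nat: "f (x + of_nat m * T) = f x" for m x
  proof (induction m)
    case (Suc m)
    then show ?case using assms[of "x + of_nat m * T"] by (simp add: algebra_simps)
  qed simp
  show ?thesis
    using nat[of x "nat n"] nat[of "x + of_int n * T" "nat (- n)"] by (cases "n \<ge> 0") auto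
qed

lemma shift_into_period:
  fixes x a T :: real
  assumes "T > 0"
  obtains n :: int where "a \<le> x + of_int n * T" "x + of_int n * T < a + T"
proof -
  define n where "n = \<lfloor>(x - a) / T\<rfloor>"
  have "of_int n \<le> (x - a) / T" "(x - a) / T < of_int n + 1" unfolding n_def by linarith+
  then have "of_int n * T \<le> x - a" "x - a < (of_int n + 1) * T"
    using assms by (simp_all add: field_simps)
  then show ?thesis using that[of "- n"] by (simp add: algebra_simps)
qed

lemma periodic_deriv:
  fixes f f' :: "real \<Rightarrow> real"
  assumes "\<And>x. (f has_real_derivative f' x) (at x)" "\<And>x. f (x + T) = f x"
  shows "f' (x + T) = f' x"
proof -
  have "((\<lambda>x. f (x + T)) has_real_derivative f' (x + T)) (at x)"
    using assms(1) DERIV_shift by blast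
  then show ?thesis using assms DERIV_unique by (metis (no_types, lifting) ext)
qed

lemma periodic_attains_sup:
  fixes f :: "real \<Rightarrow> real"
  assumes "continuous_on UNIV f" "\<And>x. f (x + T) = f x" "T > 0"
  obtains a where "0 \<le> a" "a < T" "\<And>x. f x \<le> f a"
proof -
  obtain b where b: "\<And>x. x \<in> {0..T} \<Longrightarrow> f x \<le> f b"
  proof -
    have "\<exists>b\<in>{0..T}. \<forall>x\<in>{0..T}. f x \<le> f b"
      using assms(3) by (intro continuous_attains_sup continuous_on_subset[OF assms(1)]) auto
    then show ?thesis using that by blast
  qed
  obtain m :: int where m: "0 \<le> b + of_int m * T" "b + of_int m * T < 0 + T"
    using shift_into_period[OF assms(3), of 0 b] .
  have "f x \<le> f (b + of_int m * T)" for x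
  proof -
    obtain n :: int where "0 \<le> x + of_int n * T" "x + of_int n * T < 0 + T"
      using shift_into_period[OF assms(3), of 0 x] .
    then have "f (x + of_int n * T) \<le> f b" by (intro b) auto
    then show ?thesis
      using periodic_of_int[of f T x n, OF assms(2)] periodic_of_int[of f T b m, OF assms(2)] by simp
  qed
  then show ?thesis using that m by simp
qed

lemma DERIV_integral_shift:
  fixes f f' k :: "real \<Rightarrow> real"
  assumes "\<And>x. (f has_real_derivative f' x) (at x)" "continuous_on UNIV f'" "continuous_on UNIV k"
  shows "((\<lambda>x. integral {a..b} (\<lambda>t. k t * f (x + t))) has_real_derivative
           integral {a..b} (\<lambda>t. k t * f' (x + t))) (at x)"
proof -
  have cf: "continuous_on UNIV f"
    using continuous_of_deriv assms(1) by blast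
  have "((\<lambda>x. integral (cbox a b) (\<lambda>t. k t * f (x + t))) has_real_derivative
           integral (cbox a b) (\<lambda>t. k t * f' (x + t))) (at x within UNIV)"
  proof (rule leibniz_rule_field_derivative)
    show "((\<lambda>x. k t * f (x + t)) has_real_derivative k t * f' (x + t)) (at x within UNIV)" for x t
      using assms(1)[of "x + t"] DERIV_cmult DERIV_shift by blast
    show "(\<lambda>t. k t * f (x + t)) integrable_on cbox a b" for x
      by (intro integrable_continuous continuous_intros continuous_on_compose2[OF cf]
            continuous_on_subset[OF assms(3)]) auto
    show "continuous_on (UNIV \<times> cbox a b) (\<lambda>(x, t). k t * f' (x + t))"
      unfolding case_prod_unfold
      by (intro continuous_intros continuous_on_compose2[OF assms(2)]
            continuous_on_compose2[OF assms(3)]) auto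
  qed auto
  then show ?thesis by simp
qed

lemma integral_swap_real:
  fixes f :: "real \<Rightarrow> real \<Rightarrow> real"
  assumes "continuous_on UNIV (\<lambda>(x, y). f x y)"
  shows "integral {a..b} (\<lambda>x. integral {c..d} (\<lambda>y. f x y)) =
         integral {c..d} (\<lambda>y. integral {a..b} (\<lambda>x. f x y))"
  using integral_swap_continuous[of a c b d f] continuous_on_subset[OF assms]
  by (metis cbox_interval subset_UNIV)

section \<open>Wirtinger's inequality\<close>

lemma nonneg_integral_0_imp_0:
  fixes f :: "real \<Rightarrow> real"
  assumes "continuous_on {a<..<b} f" "\<And>x. a < x \<Longrightarrow> x < b \<Longrightarrow> 0 \<le> f x"
    "(f has_integral 0) {a..b}" "a < x" "x < b"
  shows "f x = 0"
proof -
  define c where "c = (a + x) / 2"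
  define d where "d = (x + b) / 2"
  have cd: "a < c" "c < x" "x < d" "d < b" using assms(4,5) by (auto simp: c_def d_def)
  have sub: "{c..d} \<subseteq> {a<..<b}" using cd by auto
  have cont: "continuous_on {c..d} f" using assms(1) sub continuous_on_subset by blast
  have i: "f integrable_on {c..d}" using cont integrable_continuous_real by blast
  have i2: "f integrable_on {a..b}" using assms(3) by blast
  have i3: "f integrable_on {a<..<b}"
    using i2 integrable_on_Icc_iff_Ioo by blast
  have "integral {c..d} f \<le> integral {a<..<b} f"
    by (rule integral_subset_le[OF sub i i3]) (use assms(2) in auto)
  also have "integral {a<..<b} f = 0"
    using assms(3) by (metis integral_open_interval_real integral_unique)
  finally have "integral {c..d} f \<le> 0" .
  moreover have "0 \<le> integral {c..d} f"
    by (rule integral_nonneg[OF i]) (use sub assms(2) in auto)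
  ultimately have "(f has_integral 0) {c..d}" using i by (metis antisym integrable_integral)
  then show ?thesis
    using has_integral_0_cbox_imp_0[of c d f x] cont cd assms(2) by (force simp: box_real)
qed

text \<open>This makes the boundary terms vanish when \<open>f\<^sup>2 cot\<close> is used as an antiderivative between two
zeros of \<open>f\<close>: there \<open>f\<^sup>2\<close> vanishes to second order, the sine only to first order.\<close>

lemma sq_div_sin_tendsto_0:
  fixes f :: "real \<Rightarrow> real"
  assumes "(f has_real_derivative f') (at c)" "f c = 0" "k \<noteq> 0" "sin (k * (c - a)) = 0"
  shows "((\<lambda>x. (f x)\<^sup>2 * cos (k * (x - a)) / sin (k * (x - a))) \<longlongrightarrow> 0) (at c)"
proof -
  have cosnz: "cos (k * (c - a)) \<noteq> 0" using assms(4) sin_zero_abs_cos_one by fastforce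
  have 1: "((\<lambda>x. f x / (x - c)) \<longlongrightarrow> f') (at c)"
    using assms(1,2) by (simp add: has_field_derivative_iff)
  have "((\<lambda>x. sin (k * (x - a))) has_real_derivative k * cos (k * (c - a))) (at c)"
    by (auto intro!: derivative_eq_intros)
  then have 2: "((\<lambda>x. sin (k * (x - a)) / (x - c)) \<longlongrightarrow> k * cos (k * (c - a))) (at c)"
    using assms(4) by (simp add: has_field_derivative_iff)
  have 3: "(f \<longlongrightarrow> 0) (at c)" using DERIV_isCont[OF assms(1)] assms(2) by (simp add: isCont_def)
  have 4: "((\<lambda>x. cos (k * (x - a))) \<longlongrightarrow> cos (k * (c - a))) (at c)"
    by (intro tendsto_intros)
  have "((\<lambda>x. f x * (f x / (x - c)) * cos (k * (x - a)) / (sin (k * (x - a)) / (x - c))) \<longlongrightarrow>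
          0 * f' * cos (k * (c - a)) / (k * cos (k * (c - a)))) (at c)"
    by (intro tendsto_intros 1 2 3 4) (use assms(3) cosnz in auto)
  moreover have "\<forall>\<^sub>F x in at c. f x * (f x / (x - c)) * cos (k * (x - a)) / (sin (k * (x - a)) / (x - c))
      = (f x)\<^sup>2 * cos (k * (x - a)) / sin (k * (x - a))"
  proof -
    have "u * (u / d) * C / (S / d) = u\<^sup>2 * C / S" if "d \<noteq> 0" for u d C S :: real
      using that by (cases "S = 0") (auto simp: power2_eq_square field_simps)
    then show ?thesis unfolding eventually_at by (intro exI[of _ 1]) auto
  qed
  ultimately show ?thesis by (simp only: tendsto_cong mult_zero_left div_0)
qed

text \<open>Wirtinger's inequality with zero boundary values. It is the integrated form of
\<open>(k f\<^sup>2 cot)' = f'\<^sup>2 - k\<^sup>2 f\<^sup>2 - (f' - k f cot)\<^sup>2\<close>, with cotangent of \<open>k (x - a)\<close>. Equality forces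
\<open>f' = k f cot\<close> in the interior, hence \<open>f / sin\<close> is constant there.\<close>

lemma wirtinger_dirichlet:
  fixes f f' :: "real \<Rightarrow> real"
  assumes df: "\<And>x. (f has_real_derivative f' x) (at x)" and cf': "continuous_on UNIV f'"
    and k: "k > 0" and b: "b = a + pi / k" and f0: "f a = 0" "f b = 0"
  shows "k\<^sup>2 * integral {a..b} (\<lambda>x. (f x)\<^sup>2) \<le> integral {a..b} (\<lambda>x. (f' x)\<^sup>2)"
    and "k\<^sup>2 * integral {a..b} (\<lambda>x. (f x)\<^sup>2) = integral {a..b} (\<lambda>x. (f' x)\<^sup>2) \<Longrightarrow>
           \<exists>C. \<forall>x\<in>{a..b}. f x = C * sin (k * (x - a))"
proof -
  define s where "s x = sin (k * (x - a))" for x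
  define c where "c x = cos (k * (x - a))" for x
  define H where "H x = k * ((f x)\<^sup>2 * c x / s x)" for x
  define r where "r x = f' x - k * f x * c x / s x" for x
  have ab: "a < b" using k b by simp
  have spos: "s x > 0" if "a < x" "x < b" for x
  proof -
    have "k * (x - a) < k * (pi / k)" using that k b by (intro mult_strict_left_mono) auto
    then show ?thesis unfolding s_def using that k by (intro sin_gt_zero) auto
  qed
  have sa: "s a = 0" "s b = 0" using k b by (auto simp: s_def)
  have cf: "continuous_on UNIV f"
    using continuous_of_deriv df by blast
  have ds: "(s has_real_derivative k * c x) (at x)" for x
    unfolding s_def[abs_def] c_def by (auto intro!: derivative_eq_intros)
  have dc: "(c has_real_derivative - k * s x) (at x)" for x
    unfolding c_def[abs_def] s_def by (auto intro!: derivative_eq_intros)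
  have sc: "(s x)\<^sup>2 + (c x)\<^sup>2 = 1" for x by (simp add: s_def c_def)
  have dH: "(H has_real_derivative (f' x)\<^sup>2 - k\<^sup>2 * (f x)\<^sup>2 - (r x)\<^sup>2) (at x)"
    if "a < x" "x < b" for x
  proof -
    have "s x \<noteq> 0" using spos that by force
    moreover have "c x * c x = 1 - s x * s x" using sc[of x] by (simp add: power2_eq_square)
    ultimately show ?thesis
      unfolding H_def[abs_def]
      by (auto intro!: derivative_eq_intros df ds dc simp: r_def) (simp add: field_simps power2_eq_square)
  qed
  have HT: "(H \<longlongrightarrow> H x) (at x)" if "x = a \<or> x = b" for x
  proof -
    have "((\<lambda>x. (f x)\<^sup>2 * c x / s x) \<longlongrightarrow> 0) (at x)"
      using that sq_div_sin_tendsto_0[OF df, of x k a] k f0 sa by (auto simp: s_def c_def)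
    from tendsto_mult_left[OF this, of k] show ?thesis
      using that sa by (auto simp: H_def[abs_def] ac_simps)
  qed
  have contH: "continuous_on {a..b} H"
  proof (rule continuous_at_imp_continuous_on, rule ballI)
    fix x assume "x \<in> {a..b}"
    then consider "x = a \<or> x = b" | "a < x" "x < b" by force
    then show "isCont H x"
    proof cases
      case 1
      then show ?thesis using HT by (simp add: isCont_def)
    next
      case 2
      then show ?thesis using dH DERIV_isCont by blast
    qed
  qed
  have Hi: "((\<lambda>x. (f' x)\<^sup>2 - k\<^sup>2 * (f x)\<^sup>2 - (r x)\<^sup>2) has_integral H b - H a) {a..b}"
    by (rule fundamental_theorem_of_calculus_interior)
       (use ab contH dH in \<open>auto simp: has_real_derivative_iff_has_vector_derivative\<close>)
  have H0: "H a = 0" "H b = 0" using f0 by (auto simp: H_def)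
  have i1: "((\<lambda>x. (f' x)\<^sup>2) has_integral integral {a..b} (\<lambda>x. (f' x)\<^sup>2)) {a..b}"
    by (intro integrable_integral integrable_continuous_real continuous_intros
        continuous_on_subset[OF cf']) auto
  have i2: "((\<lambda>x. (f x)\<^sup>2) has_integral integral {a..b} (\<lambda>x. (f x)\<^sup>2)) {a..b}"
    by (intro integrable_integral integrable_continuous_real continuous_intros
        continuous_on_subset[OF cf]) auto
  have ri: "((\<lambda>x. (r x)\<^sup>2) has_integral
      integral {a..b} (\<lambda>x. (f' x)\<^sup>2) - k\<^sup>2 * integral {a..b} (\<lambda>x. (f x)\<^sup>2)) {a..b}"
    using has_integral_diff[OF has_integral_diff[OF i1 has_integral_mult_right[OF i2, of "k\<^sup>2"]] Hi]
    by (simp add: H0)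
  show "k\<^sup>2 * integral {a..b} (\<lambda>x. (f x)\<^sup>2) \<le> integral {a..b} (\<lambda>x. (f' x)\<^sup>2)"
    using has_integral_nonneg[OF ri] by simp
  assume eq: "k\<^sup>2 * integral {a..b} (\<lambda>x. (f x)\<^sup>2) = integral {a..b} (\<lambda>x. (f' x)\<^sup>2)"
  have contr: "continuous_on {a<..<b} (\<lambda>x. (r x)\<^sup>2)"
    unfolding r_def s_def c_def
    by (intro continuous_intros continuous_on_subset[OF cf'] continuous_on_subset[OF cf])
       (use spos in \<open>auto simp: s_def\<close>, force)
  have r0: "r x = 0" if "a < x" "x < b" for x
    using nonneg_integral_0_imp_0[OF contr _ _ that] ri eq by simp
  define h where "h x = f x / s x" for x
  have dh: "(h has_real_derivative 0) (at x)" if "a < x" "x < b" for x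
  proof -
    have "s x \<noteq> 0" using spos that by force
    moreover have "f' x = k * f x * c x / s x" using r0[OF that] by (simp add: r_def)
    ultimately show ?thesis
      unfolding h_def[abs_def]
      by (auto intro!: derivative_eq_intros df ds simp: field_simps)
  qed
  define m where "m = (a + b) / 2"
  have hc: "h x = h m" if "a < x" "x < b" for x
  proof -
    have "\<exists>C. \<forall>x\<in>{a<..<b}. h x = C"
      by (rule has_field_derivative_zero_constant)
         (use dh in \<open>auto intro: has_field_derivative_at_within\<close>)
    then show ?thesis using that ab by (auto simp: m_def)
  qed
  show "\<exists>C. \<forall>x\<in>{a..b}. f x = C * sin (k * (x - a))"
  proof (intro exI ballI)
    fix x assume "x \<in> {a..b}"
    then consider "x = a \<or> x = b" | "a < x" "x < b" by force
    then show "f x = h m * sin (k * (x - a))"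
    proof cases
      case 1
      then show ?thesis using f0 sa by (auto simp: s_def)
    next
      case 2
      then show ?thesis using hc[OF 2] spos[OF 2] by (auto simp: h_def s_def field_simps)
    qed
  qed
qed

text \<open>By the intermediate value theorem some \<open>a\<close> satisfies \<open>f a = f (a + \<pi>/2)\<close>. Subtracting this value
gives a function with zeros at \<open>a\<close>, \<open>a + \<pi>/2\<close>, \<open>a + \<pi>\<close>, to which the Dirichlet form applies on both
halves of the period; as \<open>f\<close> has mean zero the subtraction only increases the integral of the square.
In the case of equality there are two sine arcs, and mean zero forces their amplitudes to match.\<close>

lemma wirtinger_periodic:
  fixes f f' :: "real \<Rightarrow> real"
  assumes df: "\<And>x. (f has_real_derivative f' x) (at x)" and cf': "continuous_on UNIV f'"
    and per: "\<And>x. f (x + pi) = f x" and mean: "integral {0..2 * pi} f = 0"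
  shows "4 * integral {0..2 * pi} (\<lambda>x. (f x)\<^sup>2) \<le> integral {0..2 * pi} (\<lambda>x. (f' x)\<^sup>2)" (is ?le)
    and "4 * integral {0..2 * pi} (\<lambda>x. (f x)\<^sup>2) = integral {0..2 * pi} (\<lambda>x. (f' x)\<^sup>2) \<Longrightarrow>
           \<exists>C a. \<forall>x. f x = C * sin (2 * (x - a))" (is "?eq \<Longrightarrow> _")
proof -
  have cf: "continuous_on UNIV f" using continuous_of_deriv df by blast
  note [continuous_intros] = continuous_on_compose2[OF cf _ subset_UNIV]
    continuous_on_compose2[OF cf' _ subset_UNIV]
  obtain a where a: "0 \<le> a" "a \<le> pi / 2" "f (a + pi / 2) = f a"
  proof -
    define g where "g x = f (x + pi / 2) - f x" for x
    have "continuous_on {0..pi/2} g" unfolding g_def by (intro continuous_intros)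
    moreover have "g (pi / 2) = - g 0" unfolding g_def using per[of 0] by simp
    ultimately have "\<exists>x\<ge>0. x \<le> pi / 2 \<and> g x = 0"
      using IVT'[of g 0 0 "pi/2"] IVT2'[of g "pi/2" 0 0] by (cases "g 0 \<le> 0") auto
    then show ?thesis using that by (auto simp: g_def)
  qed
  define A where "A = f a"
  define m where "m = a + pi / 2"
  define F where "F x = f x - A" for x
  have dF: "(F has_real_derivative f' x) (at x)" for x
    unfolding F_def by (auto intro!: derivative_eq_intros df)
  have F0: "F a = 0" "F m = 0" "F (a + pi) = 0"
    using a(3) per[of a] by (auto simp: F_def A_def m_def)
  have cF [continuous_intros]: "continuous_on S F" for S unfolding F_def by (intro continuous_intros)
  have m1: "m = a + pi / 2" and m2: "a + pi = m + pi / 2" by (auto simp: m_def)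
  \<comment> \<open>The factor \<open>k = 2\<close> belongs to intervals of length \<open>\<pi> / 2\<close>.\<close>
  have four: "(2::real)\<^sup>2 = 4" by simp
  note w1 = wirtinger_dirichlet[OF dF cf' _ m1 F0(1,2), unfolded four]
  note w2 = wirtinger_dirichlet[OF dF cf' _ m2 F0(2,3), unfolded four]
  have comb: "integral {0..2 * pi} h = 2 * (integral {a..m} h + integral {m..a + pi} h)"
    if "continuous_on UNIV h" "\<And>x. h (x + pi) = h x" for h :: "real \<Rightarrow> real"
  proof -
    have "integral {a..m} h + integral {m..a + pi} h = integral {a..a + pi} h"
      using a(1) continuous_on_subset[OF that(1) subset_UNIV]
      by (intro Henstock_Kurzweil_Integration.integral_combine integrable_continuous_real)
         (simp_all add: m_def)
    then show ?thesis using integral_two_periods[OF that, of a] by simp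
  qed
  have per': "f' (x + pi) = f' x" for x using periodic_deriv[OF df per] by blast
  have cF2: "integral {0..2 * pi} (\<lambda>x. (F x)\<^sup>2) =
      2 * (integral {a..m} (\<lambda>x. (F x)\<^sup>2) + integral {m..a + pi} (\<lambda>x. (F x)\<^sup>2))"
    by (rule comb) (auto intro!: continuous_intros simp: F_def per)
  have cf2: "integral {0..2 * pi} (\<lambda>x. (f' x)\<^sup>2) =
      2 * (integral {a..m} (\<lambda>x. (f' x)\<^sup>2) + integral {m..a + pi} (\<lambda>x. (f' x)\<^sup>2))"
    by (rule comb) (auto intro!: continuous_intros simp: per')
  have F2: "integral {0..2 * pi} (\<lambda>x. (F x)\<^sup>2) = integral {0..2 * pi} (\<lambda>x. (f x)\<^sup>2) + 2 * pi * A\<^sup>2"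
  proof -
    have i1: "((\<lambda>x. (f x)\<^sup>2) has_integral integral {0..2*pi} (\<lambda>x. (f x)\<^sup>2)) {0..2*pi}"
      by (intro integrable_integral integrable_continuous_real continuous_intros)
    have i2: "(f has_integral 0) {0..2*pi}"
      using integrable_integral[OF integrable_continuous_real[OF continuous_on_subset[OF cf]], of 0 "2 * pi"]
        mean by simp
    have "((\<lambda>x. (f x)\<^sup>2 - (2 * A) * f x + A\<^sup>2) has_integral
        (integral {0..2*pi} (\<lambda>x. (f x)\<^sup>2) - (2 * A) * 0 + (2 * pi) * A\<^sup>2)) {0..2*pi}"
      by (intro has_integral_add has_integral_diff i1 has_integral_mult_right i2)
         (use has_integral_const_real[of "A\<^sup>2" 0 "2*pi"] in simp)
    then show ?thesis
      by (subst integral_unique[symmetric, of _ "integral {0..2*pi} (\<lambda>x. (f x)\<^sup>2) + (2 * pi) * A\<^sup>2"])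
         (auto simp: F_def power2_diff algebra_simps)
  qed
  define X where "X = 2 * pi * A\<^sup>2"
  have A0: "X \<ge> 0" by (simp add: X_def)
  note F2 = F2[folded X_def]
  have arith1: "4 * I + 4 * X \<le> I'"
    if "4 * x1 \<le> y1" "4 * x2 \<le> y2" "IF = 2 * (x1 + x2)" "I' = 2 * (y1 + y2)" "IF = I + X"
    for x1 y1 x2 y2 IF I' I :: real
    using that by simp
  have arith2: "4 * x1 = y1" "4 * x2 = y2"
    if "4 * x1 \<le> y1" "4 * x2 \<le> y2" "IF = 2 * (x1 + x2)" "I' = 2 * (y1 + y2)" "IF = I + X"
       "4 * I = I'" for x1 y1 x2 y2 IF I' I :: real
    using that A0 unfolding distrib_left by linarith+
  note le = arith1[OF w1(1)[OF zero_less_numeral] w2(1)[OF zero_less_numeral] cF2 cf2 F2] arith2[OF w1(1)[OF zero_less_numeral] w2(1)[OF zero_less_numeral] cF2 cf2 F2]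
  show ?le using le(1) A0 by linarith
  assume eq: ?eq
  have "A\<^sup>2 = 0"
  proof -
    have "X = 0" using le(1) A0 eq by linarith
    then show ?thesis by (simp add: X_def)
  qed
  then have "A = 0" by simp
  then have Ff: "F = f" by (auto simp: F_def)
  have e1: "4 * integral {a..m} (\<lambda>x. (F x)\<^sup>2) = integral {a..m} (\<lambda>x. (f' x)\<^sup>2)"
    and e2: "4 * integral {m..a+pi} (\<lambda>x. (F x)\<^sup>2) = integral {m..a+pi} (\<lambda>x. (f' x)\<^sup>2)"
    by (fact le(2)[OF eq], fact le(3)[OF eq])
  obtain C where C: "\<And>x. x \<in> {a..m} \<Longrightarrow> f x = C * sin (2 * (x - a))"
    using w1(2)[OF zero_less_numeral e1] unfolding Ff by blast
  obtain D where D: "\<And>x. x \<in> {m..a+pi} \<Longrightarrow> f x = D * sin (2 * (x - m))"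
    using w2(2)[OF zero_less_numeral e2] unfolding Ff by blast
  have int: "integral {u..u + pi/2} (\<lambda>x. E * sin (2 * (x - u))) = E" for E u
  proof -
    have "integral {u..u + pi/2} (\<lambda>x. E * sin (2 * (x - u)))
        = - E * cos (2 * (u + pi / 2 - u)) / 2 - - E * cos (2 * (u - u)) / 2"
      by (rule integral_eq_diff) (auto intro!: derivative_eq_intros)
    then show ?thesis by simp
  qed
  have "integral {a..m} f = integral {a..m} (\<lambda>x. C * sin (2 * (x - a)))"
    by (rule integral_cong) (rule C)
  moreover have "integral {m..a+pi} f = integral {m..a+pi} (\<lambda>x. D * sin (2 * (x - m)))"
    by (rule integral_cong) (rule D)
  ultimately have DC: "D = - C"
    using comb[OF cf per] mean int[of a C, folded m1] int[of m D, folded m2]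
    unfolding distrib_left by linarith
  have ap: "f x = C * sin (2 * (x - a))" if "a \<le> x" "x \<le> a + pi" for x
  proof (cases "x \<le> m")
    case True
    then show ?thesis using C that by auto
  next
    case False
    have "2 * (x - a) = 2 * (x - m) + pi" by (simp add: m_def)
    then have "sin (2 * (x - a)) = - sin (2 * (x - m))" by (metis sin_periodic_pi)
    then show ?thesis using D[of x] that False DC by simp
  qed
  have "f x = C * sin (2 * (x - a))" for x
  proof -
    obtain n :: int where n: "a \<le> x + of_int n * pi" "x + of_int n * pi < a + pi"
      using shift_into_period[of pi a x] by auto
    have "f x = f (x + of_int n * pi)" using periodic_of_int[of f pi, OF per] by metis
    also have "\<dots> = C * sin (2 * (x + of_int n * pi - a))" using ap n by auto
    also have "\<dots> = C * sin (2 * (x - a))"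
      by (rule periodic_of_int) (use sin_periodic[of "2 * (x - a)" for x] in \<open>simp add: algebra_simps\<close>)
    finally show ?thesis .
  qed
  then show "\<exists>C a. \<forall>x. f x = C * sin (2 * (x - a))" by blast
qed

section \<open>The inequality for the autocorrelation\<close>

abbreviation circ :: "(real \<Rightarrow> real) \<Rightarrow> real" where
  "circ f \<equiv> integral {0..2 * pi} f"

lemma circ_has_integral:
  "continuous_on UNIV f \<Longrightarrow> (f has_integral circ f) {0..2 * pi}"
  by (intro integrable_integral integrable_continuous_real) (rule continuous_on_subset, auto)

lemma circ_add:
  "continuous_on UNIV f \<Longrightarrow> continuous_on UNIV g \<Longrightarrow> circ (\<lambda>x. f x + g x) = circ f + circ g"
  by (intro integral_unique has_integral_add circ_has_integral)

lemma circ_diff: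
  "continuous_on UNIV f \<Longrightarrow> continuous_on UNIV g \<Longrightarrow> circ (\<lambda>x. f x - g x) = circ f - circ g"
  by (intro integral_unique has_integral_diff circ_has_integral)

lemma circ_cmult: "circ (\<lambda>x. c * f x) = c * circ f"
  by simp

lemma circ_lin3:
  assumes "continuous_on UNIV f" "continuous_on UNIV g" "continuous_on UNIV h"
  shows "circ (\<lambda>x. a * f x + b * g x + c * h x) = a * circ f + b * circ g + c * circ h"
  by (intro integral_unique has_integral_add has_integral_mult_right circ_has_integral assms)

lemma circ_shift:
  "continuous_on UNIV f \<Longrightarrow> (\<And>x. f (x + 2 * pi) = f x) \<Longrightarrow> circ (\<lambda>x. f (x + a)) = circ f"
  by (rule integral_period_shift) auto

lemma circ_by_parts:
  assumes "\<And>x. (f has_real_derivative f' x) (at x)" "\<And>x. (g has_real_derivative g' x) (at x)"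
    "continuous_on UNIV f'" "continuous_on UNIV g'"
    "\<And>x. f (x + 2 * pi) = f x" "\<And>x. g (x + 2 * pi) = g x"
  shows "circ (\<lambda>x. f' x * g x) = - circ (\<lambda>x. f x * g' x)"
proof -
  note [continuous_intros] = continuous_on_compose2[OF continuous_of_deriv[OF assms(1)] _ subset_UNIV]
    continuous_on_compose2[OF continuous_of_deriv[OF assms(2)] _ subset_UNIV] assms(3,4)
  have "circ (\<lambda>x. f' x * g x + f x * g' x) = f (2 * pi) * g (2 * pi) - f 0 * g 0"
    by (rule integral_eq_diff(2)) (auto intro!: derivative_eq_intros assms(1,2))
  also have "\<dots> = 0" using assms(5)[of 0] assms(6)[of 0] by simp
  finally show ?thesis
    by (subst (asm) circ_add) (auto intro!: continuous_intros)
qed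

text \<open>\<open>W\<close> is the convolution of the \<open>\<pi>\<close>-periodic function \<open>E\<close> with \<open>\<bar>sin\<bar>\<close>, the fundamental solution of
\<open>y'' + y = 2 \<delta>\<close> on the circle of length \<open>\<pi>\<close>; hence \<open>W'' + W = 2 E\<close>.\<close>

lemma sin_convolution:
  fixes E E' E'' :: "real \<Rightarrow> real"
  assumes dE: "\<And>x. (E has_real_derivative E' x) (at x)"
    and dE': "\<And>x. (E' has_real_derivative E'' x) (at x)"
    and cE'': "continuous_on UNIV E''"
    and per: "\<And>x. E (x + pi) = E x"
  defines "W \<equiv> \<lambda>x. integral {0..pi} (\<lambda>t. sin t * E (x + t))"
    and "v \<equiv> \<lambda>x. integral {0..pi} (\<lambda>t. sin t * E' (x + t))"
  shows "(W has_real_derivative v x) (at x)"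
    and "(v has_real_derivative 2 * E x - W x) (at x)"
    and "W (x + pi) = W x" "v (x + pi) = v x"
proof -
  have cE: "continuous_on UNIV E" and cE': "continuous_on UNIV E'"
    using continuous_of_deriv dE dE' by blast+
  note [continuous_intros] = continuous_on_compose2[OF cE _ subset_UNIV]
    continuous_on_compose2[OF cE' _ subset_UNIV] continuous_on_compose2[OF cE'' _ subset_UNIV]
  have cs: "continuous_on UNIV (sin :: real \<Rightarrow> real)" by (intro continuous_intros)
  show "(W has_real_derivative v x) (at x)"
    unfolding W_def v_def by (rule DERIV_integral_shift[OF dE cE' cs])
  have "(v has_real_derivative integral {0..pi} (\<lambda>t. sin t * E'' (x + t))) (at x)"
    unfolding v_def by (rule DERIV_integral_shift[OF dE' cE'' cs])
  moreover have "integral {0..pi} (\<lambda>t. sin t * E'' (x + t)) = 2 * E x - W x"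
  proof -
    have d1: "((\<lambda>t. E (x + t)) has_real_derivative E' (x + t)) (at t)"
      and d2: "((\<lambda>t. E' (x + t)) has_real_derivative E'' (x + t)) (at t)" for t
      using DERIV_chain2[OF dE DERIV_add[OF DERIV_const[of x] DERIV_ident]]
        DERIV_chain2[OF dE' DERIV_add[OF DERIV_const[of x] DERIV_ident]] by simp_all
    have "((\<lambda>t. sin t * E' (x + t) - cos t * E (x + t)) has_real_derivative
        sin t * E'' (x + t) + sin t * E (x + t)) (at t)" for t
      by (auto intro!: derivative_eq_intros d1 d2)
    from integral_eq_diff(1)[OF this, of 0 pi]
    have "((\<lambda>t. sin t * E'' (x + t) + sin t * E (x + t)) has_integral 2 * E x) {0..pi}"
      using per[of x] by simp
    moreover have "((\<lambda>t. sin t * E (x + t)) has_integral W x) {0..pi}"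
      unfolding W_def
      by (intro integrable_integral integrable_continuous_real continuous_intros)
    ultimately have "((\<lambda>t. sin t * E'' (x + t) + sin t * E (x + t) - sin t * E (x + t))
        has_integral 2 * E x - W x) {0..pi}"
      by (rule has_integral_diff)
    then have "((\<lambda>t. sin t * E'' (x + t)) has_integral 2 * E x - W x) {0..pi}"
      by simp
    then show ?thesis by blast
  qed
  ultimately show "(v has_real_derivative 2 * E x - W x) (at x)" by simp
  have per': "E' (x + pi) = E' x" for x using periodic_deriv[OF dE per] .
  have "x + pi + t = (x + t) + pi" for t by simp
  then show "W (x + pi) = W x" "v (x + pi) = v x" unfolding W_def v_def by (simp_all only: per per')
qed

lemma pi_periodic_imp_2pi: "(\<And>x. f (x + pi) = f x) \<Longrightarrow> f (x + 2 * pi) = f x" for f :: "real \<Rightarrow> real"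
  by (metis add.assoc mult_2)

text \<open>With \<open>v = W'\<close> and \<open>W'' = 2 E - W\<close>, integration by parts expresses all quadratic integrals by those of
\<open>E\<^sup>2\<close>, \<open>E'\<^sup>2\<close>, \<open>E W\<close> and \<open>W\<^sup>2\<close>, and six times the difference of the two sides becomes
\<open>\<integral> (v'' + 4 v)\<^sup>2 + 3 (\<integral> v'\<^sup>2 - 4 \<integral> v\<^sup>2)\<close>, where \<open>v'' + 4 v = 2 E' + 3 v\<close>. On the \<open>n\<close>-th Fourier mode of \<open>W\<close>
this is the factorisation \<open>n\<^sup>2 (n\<^sup>2 - 1) (n\<^sup>2 - 4) = n\<^sup>2 ((n\<^sup>2 - 4)\<^sup>2 + 3 (n\<^sup>2 - 4))\<close>.\<close>

lemma pi_periodic_inequality: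
  fixes E E' E'' :: "real \<Rightarrow> real"
  assumes dE: "\<And>x. (E has_real_derivative E' x) (at x)"
    and dE': "\<And>x. (E' has_real_derivative E'' x) (at x)"
    and cE'': "continuous_on UNIV E''"
    and per: "\<And>x. E (x + pi) = E x"
  defines "W \<equiv> \<lambda>x. integral {0..pi} (\<lambda>t. sin t * E (x + t))"
  shows "2 * circ (\<lambda>x. (E x)\<^sup>2) \<le> circ (\<lambda>x. E x * W x) + 2 / 3 * circ (\<lambda>x. (E' x)\<^sup>2)" (is "?le")
    and "2 * circ (\<lambda>x. (E x)\<^sup>2) = circ (\<lambda>x. E x * W x) + 2 / 3 * circ (\<lambda>x. (E' x)\<^sup>2) \<longleftrightarrow>
           (\<exists>a0 a2 b2. \<forall>x. E x = a0 + a2 * cos (2 * x) + b2 * sin (2 * x))" (is "?eq \<longleftrightarrow> ?trig")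
proof -
  define v where "v \<equiv> \<lambda>x. integral {0..pi} (\<lambda>t. sin t * E' (x + t))"
  have *: "\<And>x. (W has_real_derivative v x) (at x)"
    "\<And>x. (v has_real_derivative 2 * E x - W x) (at x)" "\<And>x. W (x + pi) = W x" "\<And>x. v (x + pi) = v x"
    unfolding W_def v_def by (fact sin_convolution[OF dE dE' cE'' per])+
  define v' where "v' x = 2 * E x - W x" for x
  have dW: "\<And>x. (W has_real_derivative v x) (at x)" by (rule *(1))
  have dv: "\<And>x. (v has_real_derivative v' x) (at x)" using *(2) by (simp add: v'_def)
  have cE: "continuous_on UNIV E" and cE': "continuous_on UNIV E'"
    and cW: "continuous_on UNIV W" and cv: "continuous_on UNIV v"
    using continuous_of_deriv dE dE' dW dv by blast+
  note [continuous_intros] = cE cE' cW cv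
  have cv'[continuous_intros]: "continuous_on UNIV v'" unfolding v'_def[abs_def] by (intro continuous_intros)
  have per2: "E (x + 2 * pi) = E x" "W (x + 2 * pi) = W x" "v (x + 2 * pi) = v x" for x
    using pi_periodic_imp_2pi per *(3,4) by metis+
  define a b c d e g
    where "a = circ (\<lambda>x. (E x)\<^sup>2)" and "b = circ (\<lambda>x. (E' x)\<^sup>2)" and "c = circ (\<lambda>x. E x * W x)"
      and "d = circ (\<lambda>x. (W x)\<^sup>2)" and "e = circ (\<lambda>x. (v x)\<^sup>2)" and "g = circ (\<lambda>x. E' x * v x)"
  have e: "e = d - 2 * c"
  proof -
    have "circ (\<lambda>x. v x * v x) = - circ (\<lambda>x. W x * v' x)"
      by (rule circ_by_parts) (use dW dv cv cv' per2 in auto)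
    also have "circ (\<lambda>x. W x * v' x) = circ (\<lambda>x. 2 * (E x * W x) - (W x)\<^sup>2)"
      by (simp add: v'_def power2_eq_square algebra_simps)
    also have "\<dots> = 2 * c - d"
      unfolding c_def d_def circ_cmult[symmetric] by (intro circ_diff continuous_intros)
    finally show ?thesis by (simp add: e_def power2_eq_square)
  qed
  have g: "g = c - 2 * a"
  proof -
    have "g = - circ (\<lambda>x. E x * v' x)"
      unfolding g_def by (rule circ_by_parts) (use dE dv cE' cv' per2 in auto)
    also have "circ (\<lambda>x. E x * v' x) = circ (\<lambda>x. 2 * (E x)\<^sup>2 - E x * W x)"
      by (simp add: v'_def power2_eq_square algebra_simps)
    also have "\<dots> = 2 * a - c"
      unfolding c_def a_def circ_cmult[symmetric] by (intro circ_diff continuous_intros)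
    finally show ?thesis by simp
  qed
  have v'2: "circ (\<lambda>x. (v' x)\<^sup>2) = 4 * a - 4 * c + d"
  proof -
    have "(v' x)\<^sup>2 = 4 * (E x)\<^sup>2 + (- 4) * (E x * W x) + 1 * (W x)\<^sup>2" for x
      unfolding v'_def by algebra
    then have "circ (\<lambda>x. (v' x)\<^sup>2) = circ (\<lambda>x. 4 * (E x)\<^sup>2 + (- 4) * (E x * W x) + 1 * (W x)\<^sup>2)"
      by (simp only:)
    also have "\<dots> = 4 * a + (- 4) * c + 1 * d"
      unfolding a_def c_def d_def by (rule circ_lin3; intro continuous_intros)
    finally show ?thesis by simp
  qed
  define N where "N = circ (\<lambda>x. (2 * E' x + 3 * v x)\<^sup>2)"
  have N: "N = 4 * b + 12 * g + 9 * e"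
  proof -
    have "(2 * E' x + 3 * v x)\<^sup>2 = 4 * (E' x)\<^sup>2 + 12 * (E' x * v x) + 9 * (v x)\<^sup>2" for x
      by algebra
    then have "N = circ (\<lambda>x. 4 * (E' x)\<^sup>2 + 12 * (E' x * v x) + 9 * (v x)\<^sup>2)"
      by (simp only: N_def)
    also have "\<dots> = 4 * b + 12 * g + 9 * e"
      unfolding b_def g_def e_def by (rule circ_lin3; intro continuous_intros)
    finally show ?thesis .
  qed
  have N0: "N \<ge> 0" unfolding N_def
    by (rule has_integral_nonneg[OF circ_has_integral]) (intro continuous_intros, simp)
  have vmean: "circ v = 0"
    using integral_eq_diff(2)[OF dW, of 0 "2 * pi"] per2(2)[of 0] by simp
  note wirt = wirtinger_periodic[OF dv cv' *(4) vmean, folded e_def, unfolded v'2]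
  have key: "6 * c + 4 * b - 12 * a = N + 12 * a - 12 * c + 3 * d - 12 * e"
    unfolding N e g by (simp add: algebra_simps)
  show ?le unfolding a_def[symmetric] b_def[symmetric] c_def[symmetric]
    using key N0 wirt(1) by linarith
  show "?eq \<longleftrightarrow> ?trig"
  proof
    assume ?eq
    then have "N + 12 * a - 12 * c + 3 * d - 12 * e = 0"
      using key unfolding a_def[symmetric] b_def[symmetric] c_def[symmetric] by linarith
    then have "4 * e = 4 * a - 4 * c + d" using N0 wirt(1) by linarith
    from wirt(2)[OF this] obtain C s where vC: "\<And>x. v x = C * sin (2 * (x - s))" by blast
    have v'C: "v' x = 2 * C * cos (2 * (x - s))" for x
    proof -
      have "((\<lambda>x. C * sin (2 * (x - s))) has_real_derivative 2 * C * cos (2 * (x - s))) (at x)"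
        by (auto intro!: derivative_eq_intros)
      then show ?thesis using dv[of x] vC DERIV_unique by (metis (no_types, lifting) ext)
    qed
    have "((\<lambda>x. W x + C / 2 * cos (2 * (x - s))) has_real_derivative 0) (at x)" for x
      using vC by (auto intro!: derivative_eq_intros dW)
    then have "W x + C / 2 * cos (2 * (x - s)) = W 0 + C / 2 * cos (2 * (0 - s))" for x
      using DERIV_isconst_all[of "\<lambda>x. W x + C / 2 * cos (2 * (x - s))" x 0] by blast
    then obtain k where "\<And>x. W x + C / 2 * cos (2 * (x - s)) = k" by blast
    then have Wk: "W x = k - C / 2 * cos (2 * (x - s))" for x by (simp add: eq_diff_eq)
    have "E x = k / 2 + (3 / 4 * C * cos (2 * s)) * cos (2 * x) + (3 / 4 * C * sin (2 * s)) * sin (2 * x)" for x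
    proof -
      have "E x = (v' x + W x) / 2" by (simp add: v'_def)
      also have "\<dots> = k / 2 + 3 / 4 * C * cos (2 * x - 2 * s)"
        by (simp add: v'C Wk right_diff_distrib)
      finally show ?thesis by (simp add: cos_diff algebra_simps)
    qed
    then show ?trig by blast
  next
    assume ?trig
    then obtain a0 a2 b2 where Et: "\<And>x. E x = a0 + a2 * cos (2 * x) + b2 * sin (2 * x)" by blast
    have E't: "E' x = - 2 * a2 * sin (2 * x) + 2 * b2 * cos (2 * x)" for x
    proof -
      have "((\<lambda>x. a0 + a2 * cos (2 * x) + b2 * sin (2 * x)) has_real_derivative
          - 2 * a2 * sin (2 * x) + 2 * b2 * cos (2 * x)) (at x)"
        by (auto intro!: derivative_eq_intros)
      then show ?thesis using dE[of x] Et DERIV_unique by (metis (no_types, lifting) ext)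
    qed
    have vE: "v x = - 2 / 3 * E' x" for x
    proof -
      define f where "f t = - 2 * a2 * sin (2 * (x + t)) + 2 * b2 * cos (2 * (x + t))" for t
      define f' where "f' t = - 4 * a2 * cos (2 * (x + t)) - 4 * b2 * sin (2 * (x + t))" for t
      have df: "(f has_real_derivative f' t) (at t)" for t
        unfolding f_def[abs_def] f'_def by (auto intro!: derivative_eq_intros)
      have df': "(f' has_real_derivative - 4 * f t) (at t)" for t
        unfolding f'_def[abs_def] f_def by (auto intro!: derivative_eq_intros simp: algebra_simps)
      \<comment> \<open>From \<open>f'' = - 4 f\<close>: the derivative of \<open>cos f - sin f'\<close> is \<open>- sin f - sin f'' = 3 sin f\<close>.\<close>
      have "((\<lambda>t. (cos t * f t - sin t * f' t) / 3) has_real_derivative sin t * f t) (at t)" for t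
        by (auto intro!: derivative_eq_intros df df' simp: algebra_simps)
      from integral_eq_diff(2)[OF this, of 0 pi]
      have "integral {0..pi} (\<lambda>t. sin t * f t) = (- f pi - f 0) / 3" by simp
      moreover have "f pi = f 0"
        using sin_periodic[of "2 * x"] cos_periodic[of "2 * x"] by (simp add: f_def distrib_left)
      moreover have "E' (x + t) = f t" for t by (simp add: E't f_def)
      ultimately have "v x = (- f 0 - f 0) / 3" and "E' x = f 0"
        unfolding v_def by (simp_all add: f_def[of 0] E't)
      then show ?thesis by simp
    qed
    have N_eq: "N = 0" unfolding N_def vE by simp
    have "circ (\<lambda>x. v' x * v' x) = - circ (\<lambda>x. v x * (2 * E' x - v x))"
    proof (rule circ_by_parts)
      show "(v' has_real_derivative 2 * E' x - v x) (at x)" for x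
        unfolding v'_def[abs_def] by (auto intro!: derivative_eq_intros dE dW)
      show "v' (x + 2 * pi) = v' x" for x by (simp only: v'_def per2)
    qed (use dv cv' per2 in \<open>auto intro!: continuous_intros\<close>)
    also have "(\<lambda>x. v x * (2 * E' x - v x)) = (\<lambda>x. - 4 * (v x)\<^sup>2)"
      by (simp add: vE power2_eq_square fun_eq_iff)
    also have "- circ (\<lambda>x. - 4 * (v x)\<^sup>2) = 4 * e" unfolding circ_cmult e_def by simp
    finally have "4 * a - 4 * c + d = 4 * e" using v'2 by (simp add: power2_eq_square)
    then show ?eq using key N_eq unfolding a_def[symmetric] b_def[symmetric] c_def[symmetric] by linarith
  qed
qed

text \<open>\<open>f cos\<close> and \<open>f sin\<close> are \<open>\<pi>\<close>-periodic, and the orthogonality assumptions say that they have mean zero.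
Their squares add up to \<open>f\<^sup>2\<close> and the squares of their derivatives to \<open>f'\<^sup>2 + f\<^sup>2\<close>, so that the sum of the two
Wirtinger inequalities is \<open>4 \<integral> f\<^sup>2 \<le> \<integral> f'\<^sup>2 + \<integral> f\<^sup>2\<close>. Equality would make both products multiples of
\<open>sin (2 x)\<close>, and then \<open>f\<close> would be a multiple of \<open>sin\<close> and of \<open>cos\<close> at the same time.\<close>

lemma pi_antiperiodic_inequality:
  fixes f f' :: "real \<Rightarrow> real"
  assumes df: "\<And>x. (f has_real_derivative f' x) (at x)" and cf': "continuous_on UNIV f'"
    and anti: "\<And>x. f (x + pi) = - f x"
    and mean: "circ (\<lambda>x. f x * cos x) = 0" "circ (\<lambda>x. f x * sin x) = 0"
  shows "3 * circ (\<lambda>x. (f x)\<^sup>2) \<le> circ (\<lambda>x. (f' x)\<^sup>2)"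
    and "3 * circ (\<lambda>x. (f x)\<^sup>2) = circ (\<lambda>x. (f' x)\<^sup>2) \<Longrightarrow> f x = 0"
proof -
  have cf: "continuous_on UNIV f" using continuous_of_deriv df by blast
  note [continuous_intros] = cf cf'
  define y where "y x = f x * cos x" for x
  define z where "z x = f x * sin x" for x
  define y' where "y' x = f' x * cos x - f x * sin x" for x
  define z' where "z' x = f' x * sin x + f x * cos x" for x
  have dy: "\<And>x. (y has_real_derivative y' x) (at x)"
    and dz: "\<And>x. (z has_real_derivative z' x) (at x)"
    unfolding y_def[abs_def] y'_def z_def[abs_def] z'_def by (auto intro!: derivative_eq_intros df)
  have c': "continuous_on UNIV y'" "continuous_on UNIV z'"
    unfolding y'_def[abs_def] z'_def[abs_def] by (intro continuous_intros)+
  have c: "continuous_on UNIV y" "continuous_on UNIV z"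
    unfolding y_def[abs_def] z_def[abs_def] by (intro continuous_intros)+
  note [continuous_intros] = c c'
  have per: "\<And>x. y (x + pi) = y x" "\<And>x. z (x + pi) = z x" by (simp_all add: y_def z_def anti)
  have m: "circ y = 0" "circ z = 0" using mean by (simp_all add: y_def[abs_def] z_def[abs_def])
  note wy = wirtinger_periodic[OF dy c'(1) per(1) m(1)]
  note wz = wirtinger_periodic[OF dz c'(2) per(2) m(2)]
  have sum1: "circ (\<lambda>x. (y x)\<^sup>2) + circ (\<lambda>x. (z x)\<^sup>2) = circ (\<lambda>x. (f x)\<^sup>2)"
  proof -
    have "(f x)\<^sup>2 = (y x)\<^sup>2 + (z x)\<^sup>2" for x
      by (simp add: y_def z_def power_mult_distrib flip: distrib_left)
    then show ?thesis by (simp only:) (rule circ_add[symmetric]; intro continuous_intros)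
  qed
  have sum2: "circ (\<lambda>x. (y' x)\<^sup>2) + circ (\<lambda>x. (z' x)\<^sup>2) = circ (\<lambda>x. (f' x)\<^sup>2) + circ (\<lambda>x. (f x)\<^sup>2)"
  proof -
    have "(y' x)\<^sup>2 + (z' x)\<^sup>2 = (f' x)\<^sup>2 + (f x)\<^sup>2" for x
    proof -
      have "(y' x)\<^sup>2 + (z' x)\<^sup>2 = ((f' x)\<^sup>2 + (f x)\<^sup>2) * ((sin x)\<^sup>2 + (cos x)\<^sup>2)"
        unfolding y'_def z'_def by algebra
      then show ?thesis by simp
    qed
    moreover have "circ (\<lambda>x. (y' x)\<^sup>2) + circ (\<lambda>x. (z' x)\<^sup>2) = circ (\<lambda>x. (y' x)\<^sup>2 + (z' x)\<^sup>2)"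
      by (rule circ_add[symmetric]; intro continuous_intros)
    moreover have "circ (\<lambda>x. (f' x)\<^sup>2) + circ (\<lambda>x. (f x)\<^sup>2) = circ (\<lambda>x. (f' x)\<^sup>2 + (f x)\<^sup>2)"
      by (rule circ_add[symmetric]; intro continuous_intros)
    ultimately show ?thesis by simp
  qed
  show "3 * circ (\<lambda>x. (f x)\<^sup>2) \<le> circ (\<lambda>x. (f' x)\<^sup>2)"
    using wy(1) wz(1) sum1 sum2 by linarith
  assume "3 * circ (\<lambda>x. (f x)\<^sup>2) = circ (\<lambda>x. (f' x)\<^sup>2)"
  then have e1: "4 * circ (\<lambda>x. (y x)\<^sup>2) = circ (\<lambda>x. (y' x)\<^sup>2)"
    and e2: "4 * circ (\<lambda>x. (z x)\<^sup>2) = circ (\<lambda>x. (z' x)\<^sup>2)"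
    using wy(1) wz(1) sum1 sum2 by linarith+
  obtain B b where yB: "\<And>x. y x = B * sin (2 * (x - b))" using wy(2)[OF e1] by blast
  obtain D d where zD: "\<And>x. z x = D * sin (2 * (x - d))" using wz(2)[OF e2] by blast
  define k where "k = B * cos (2 * b)"
  define l where "l = D * cos (2 * d)"
  have y1: "y x = k * sin (2 * x)" for x
  proof -
    have "y (pi / 2) = 0" by (simp add: y_def)
    then have "B * sin (2 * b) = 0"
      unfolding yB by (simp add: right_diff_distrib sin_diff)
    then show ?thesis unfolding yB k_def by (auto simp: right_diff_distrib sin_diff)
  qed
  have z1: "z x = l * sin (2 * x)" for x
  proof -
    have "z 0 = 0" by (simp add: z_def)
    then have "D * sin (2 * d) = 0" unfolding zD by simp
    then show ?thesis unfolding zD l_def by (auto simp: right_diff_distrib sin_diff)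
  qed
  have rel: "y x * sin x = z x * cos x" for x by (simp add: y_def z_def)
  have "k = l"
    using rel[of "pi / 4"] unfolding y1 z1 by (simp add: sin_45 cos_45)
  moreover have "k = - l"
  proof -
    have "k * sqrt 2 = (- l) * sqrt 2"
      using rel[of "- (pi / 4)"] unfolding y1 z1 by (simp add: sin_45 cos_45)
    then show ?thesis by (simp only: mult_cancel_right) simp
  qed
  ultimately have "y x = 0 \<and> z x = 0" by (simp add: y1 z1)
  then have "f x * cos x = 0 \<and> f x * sin x = 0" by (simp add: y_def z_def)
  then show "f x = 0" by (metis sin_zero_abs_cos_one abs_zero mult_eq_0_iff zero_neq_one)
qed

lemma DERIV_compose_shift:
  fixes f :: "real \<Rightarrow> real"
  assumes "\<And>x. (f has_real_derivative f' x) (at x)"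
  shows "((\<lambda>t. f (a + t)) has_real_derivative f' (a + t)) (at t)"
    and "((\<lambda>t. f (t + a)) has_real_derivative f' (t + a)) (at t)"
  using DERIV_chain2[OF assms DERIV_add[OF DERIV_const[of a] DERIV_ident]]
    DERIV_chain2[OF assms DERIV_add[OF DERIV_ident DERIV_const[of a]]] by simp_all

lemma integral_reflect:
  fixes f :: "real \<Rightarrow> real"
  assumes "continuous_on UNIV f" "0 \<le> a"
  shows "integral {0..a} (\<lambda>x. f (a - x)) = integral {0..a} f"
proof -
  obtain g where g: "\<And>x. (g has_real_derivative f x) (at x)"
    using continuous_imp_antiderivative assms(1) by blast
  have "((\<lambda>x. - g (a - x)) has_real_derivative f (a - x)) (at x)" for x
    by (auto intro!: derivative_eq_intros DERIV_chain2[OF g])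
  from integral_eq_diff(2)[OF this assms(2)] integral_eq_diff(2)[OF g assms(2)]
  show ?thesis by simp
qed

text \<open>With \<open>E x = q x + q (x + \<pi>)\<close> and \<open>Q x = q x - q (x + \<pi>)\<close>, the symmetry of the autocorrelation under
\<open>\<theta> \<mapsto> - \<theta>\<close> and the invariance of the sine under \<open>\<theta> \<mapsto> \<pi> - \<theta>\<close> remove \<open>Q\<close> from \<open>S\<close> and give
\<open>4 S = \<integral> E W\<close>. The integrals of \<open>q\<^sup>2\<close> and \<open>q'\<^sup>2\<close> split by the parallelogram law, so the claim is the sum
of the inequalities for \<open>E\<close> and \<open>Q\<close>.\<close>

lemma autocorrelation_inequality:
  fixes q q' q'' :: "real \<Rightarrow> real"
  assumes dq: "\<And>x. (q has_real_derivative q' x) (at x)"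
    and dq': "\<And>x. (q' has_real_derivative q'' x) (at x)"
    and cq'': "continuous_on UNIV q''"
    and per: "\<And>x. q (x + 2 * pi) = q x"
    and mean: "circ (\<lambda>x. q x * cos x) = 0" "circ (\<lambda>x. q x * sin x) = 0"
  defines "S \<equiv> integral {0..pi} (\<lambda>t. circ (\<lambda>x. q x * q (x + t)) * sin t)"
  shows "2 * circ (\<lambda>x. (q x)\<^sup>2) \<le> S + 2 / 3 * circ (\<lambda>x. (q' x)\<^sup>2)" (is ?le)
    and "2 * circ (\<lambda>x. (q x)\<^sup>2) = S + 2 / 3 * circ (\<lambda>x. (q' x)\<^sup>2) \<longleftrightarrow>
           (\<exists>a0 a2 b2. \<forall>x. q x = a0 + a2 * cos (2 * x) + b2 * sin (2 * x))" (is "?eq \<longleftrightarrow> ?trig")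
proof -
  have cq: "continuous_on UNIV q" and cq': "continuous_on UNIV q'"
    using continuous_of_deriv dq dq' by blast+
  note [continuous_intros] = continuous_on_compose2[OF cq _ subset_UNIV]
    continuous_on_compose2[OF cq' _ subset_UNIV] continuous_on_compose2[OF cq'' _ subset_UNIV]
  have per': "q' (x + 2 * pi) = q' x" for x using periodic_deriv[OF dq per] .
  have per2: "q (x + pi + pi) = q x" "q' (x + pi + pi) = q' x" for x
    using per[of x] per'[of x] by (simp_all add: algebra_simps)
  define E where "E x = q x + q (x + pi)" for x
  define E' where "E' x = q' x + q' (x + pi)" for x
  define E'' where "E'' x = q'' x + q'' (x + pi)" for x
  define Q where "Q x = q x - q (x + pi)" for x
  define Q' where "Q' x = q' x - q' (x + pi)" for x
  have dE: "(E has_real_derivative E' x) (at x)" and dE': "(E' has_real_derivative E'' x) (at x)"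
    and dQ: "(Q has_real_derivative Q' x) (at x)" for x
    unfolding E_def[abs_def] E'_def[abs_def] E''_def Q_def[abs_def] Q'_def
    by (intro DERIV_add DERIV_diff dq dq' DERIV_compose_shift)+
  have c: "continuous_on UNIV E" "continuous_on UNIV E'" "continuous_on UNIV E''"
    "continuous_on UNIV Q" "continuous_on UNIV Q'"
    unfolding E_def[abs_def] E'_def[abs_def] E''_def[abs_def] Q_def[abs_def] Q'_def[abs_def]
    by (intro continuous_intros)+
  note [continuous_intros] = c[THEN continuous_on_compose2, OF _ subset_UNIV]
  have perE: "E (x + pi) = E x" for x unfolding E_def per2 by simp
  have antiQ: "Q (x + pi) = - Q x" for x unfolding Q_def per2 by simp
  define W where "W x = integral {0..pi} (\<lambda>t. sin t * E (x + t))" for x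
  have dW: "(W has_real_derivative integral {0..pi} (\<lambda>t. sin t * E' (x + t))) (at x)" for x
    unfolding W_def[abs_def] by (rule sin_convolution(1)[OF dE dE' c(3) perE])
  have cW [continuous_intros]: "continuous_on UNIV W" by (rule continuous_of_deriv[OF dW])
  have meanQ: "circ (\<lambda>x. Q x * cos x) = 0" "circ (\<lambda>x. Q x * sin x) = 0"
  proof -
    have "circ (\<lambda>x. (\<lambda>y. q y * cos y) (x + pi)) = circ (\<lambda>y. q y * cos y)"
      "circ (\<lambda>x. (\<lambda>y. q y * sin y) (x + pi)) = circ (\<lambda>y. q y * sin y)"
      by (rule circ_shift; (intro continuous_intros)?; simp add: per)+
    then have "circ (\<lambda>x. q x * cos x + q (x + pi) * - cos x) = 0"
      "circ (\<lambda>x. q x * sin x + q (x + pi) * - sin x) = 0"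
      by (subst circ_add; (intro continuous_intros)?; simp add: mean)+
    then show "circ (\<lambda>x. Q x * cos x) = 0" "circ (\<lambda>x. Q x * sin x) = 0"
      by (simp_all add: Q_def left_diff_distrib)
  qed
  have para: "circ (\<lambda>x. (f x + f (x + pi))\<^sup>2) + circ (\<lambda>x. (f x - f (x + pi))\<^sup>2) = 4 * circ (\<lambda>x. (f x)\<^sup>2)"
    if cf: "continuous_on UNIV f" and pf: "\<And>x. f (x + 2 * pi) = f x" for f :: "real \<Rightarrow> real"
  proof -
    note [continuous_intros] = continuous_on_compose2[OF cf _ subset_UNIV]
    have 1: "circ (\<lambda>x. (\<lambda>y. (f y)\<^sup>2) (x + pi)) = circ (\<lambda>y. (f y)\<^sup>2)"
      by (rule circ_shift; (intro continuous_intros)?; simp add: pf)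
    have 2: "circ (\<lambda>x. (f x + f (x + pi))\<^sup>2) + circ (\<lambda>x. (f x - f (x + pi))\<^sup>2)
        = circ (\<lambda>x. (f x + f (x + pi))\<^sup>2 + (f x - f (x + pi))\<^sup>2)"
      by (rule circ_add[symmetric]; intro continuous_intros)
    have 3: "(f x + f (x + pi))\<^sup>2 + (f x - f (x + pi))\<^sup>2 =
        2 * (f x)\<^sup>2 + 2 * (f (x + pi))\<^sup>2 + 0 * (f x)" for x by algebra
    have 4: "circ (\<lambda>x. 2 * (f x)\<^sup>2 + 2 * (f (x + pi))\<^sup>2 + 0 * (f x)) =
        2 * circ (\<lambda>x. (f x)\<^sup>2) + 2 * circ (\<lambda>x. (f (x + pi))\<^sup>2) + 0 * circ f"
      by (rule circ_lin3; intro continuous_intros)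
    show ?thesis unfolding 2 3 4 using 1 by simp
  qed
  \<comment> \<open>The parallelogram law, as the shift by \<open>\<pi>\<close> preserves the integral over the circle.\<close>
  have paraq: "circ (\<lambda>x. (E x)\<^sup>2) + circ (\<lambda>x. (Q x)\<^sup>2) = 4 * circ (\<lambda>x. (q x)\<^sup>2)"
    unfolding E_def Q_def by (rule para[OF cq per])
  have paraq': "circ (\<lambda>x. (E' x)\<^sup>2) + circ (\<lambda>x. (Q' x)\<^sup>2) = 4 * circ (\<lambda>x. (q' x)\<^sup>2)"
    unfolding E'_def Q'_def by (rule para[OF cq' per'])
  define R where "R t = circ (\<lambda>x. q x * q (x + t))" for t
  have dR: "(R has_real_derivative circ (\<lambda>x. q x * q' (t + x))) (at t)" for t
    unfolding R_def[abs_def] add.commute[of _ t]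
    using DERIV_integral_shift[OF dq cq' cq, of 0 "2 * pi" t] by (simp add: add.commute)
  have cR: "continuous_on UNIV R" by (rule continuous_of_deriv[OF dR])
  note [continuous_intros] = continuous_on_compose2[OF cR _ subset_UNIV]
  have Reven: "R (- t) = R t" for t
  proof -
    have "circ (\<lambda>x. (\<lambda>y. q y * q (y + - t)) (x + t)) = circ (\<lambda>y. q y * q (y + - t))"
    proof (rule circ_shift)
      fix x
      have "x + 2 * pi + - t = (x + - t) + 2 * pi" by simp
      then show "q (x + 2 * pi) * q (x + 2 * pi + - t) = q x * q (x + - t)" by (simp only: per)
    qed (intro continuous_intros)
    then show ?thesis by (simp add: R_def mult.commute)
  qed
  have Rper: "R (t + 2 * pi) = R t" for t
  proof -
    have "x + (t + 2 * pi) = (x + t) + 2 * pi" for x by simp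
    then show ?thesis by (simp only: R_def per)
  qed
  have S: "S = integral {0..pi} (\<lambda>t. R t * sin t)" by (simp add: S_def R_def)
  \<comment> \<open>Reflect \<open>t\<close> to \<open>\<pi> - t\<close> and use that \<open>R\<close> is even and \<open>2 \<pi>\<close>-periodic.\<close>
  have S': "integral {0..pi} (\<lambda>t. R (t + pi) * sin t) = S"
  proof -
    have "integral {0..pi} (\<lambda>t. (\<lambda>t. R (t + pi) * sin t) (pi - t)) = integral {0..pi} (\<lambda>t. R (t + pi) * sin t)"
      by (rule integral_reflect) (auto intro!: continuous_intros)
    moreover have "R (pi - t + pi) = R t" for t
      using Rper[of "- t"] Reven[of t] by (simp add: algebra_simps)
    ultimately show ?thesis by (simp add: S)
  qed
  have RE: "R t + R (t + pi) = 1 / 2 * circ (\<lambda>x. E x * E (x + t))" for t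
  proof -
    have "R t + R (t + pi) = circ (\<lambda>x. q x * q (x + t) + q x * q (x + (t + pi)))"
      unfolding R_def by (rule circ_add[symmetric]; intro continuous_intros)
    also have "\<dots> = circ (\<lambda>x. q x * E (x + t))"
      by (simp add: E_def algebra_simps)
    finally have 1: "R t + R (t + pi) = circ (\<lambda>x. q x * E (x + t))" .
    have 2: "circ (\<lambda>x. (\<lambda>y. q y * E (y + t)) (x + pi)) = circ (\<lambda>y. q y * E (y + t))"
    proof (rule circ_shift)
      fix x
      have "x + 2 * pi + t = (x + t) + pi + pi" by simp
      then show "q (x + 2 * pi) * E (x + 2 * pi + t) = q x * E (x + t)" by (simp only: per perE)
    qed (intro continuous_intros)
    have "x + pi + t = (x + t) + pi" for x by simp
    then have 3: "circ (\<lambda>x. q (x + pi) * E (x + t)) = circ (\<lambda>y. q y * E (y + t))"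
      using 2 by (simp only: perE)
    have "circ (\<lambda>x. E x * E (x + t)) = circ (\<lambda>x. q x * E (x + t) + q (x + pi) * E (x + t))"
      by (simp add: E_def[of x for x] algebra_simps)
    also have "\<dots> = circ (\<lambda>x. q x * E (x + t)) + circ (\<lambda>x. q (x + pi) * E (x + t))"
      by (rule circ_add; intro continuous_intros)
    finally show ?thesis using 1 3 by simp
  qed
  have SEW: "4 * S = circ (\<lambda>x. E x * W x)"
  proof -
    have "2 * S = integral {0..pi} (\<lambda>t. R t * sin t) + integral {0..pi} (\<lambda>t. R (t + pi) * sin t)"
      unfolding S' using S by simp
    also have "\<dots> = integral {0..pi} (\<lambda>t. R t * sin t + R (t + pi) * sin t)"
      by (rule integral_add[symmetric]; intro integrable_continuous_real continuous_intros)
    also have "(\<lambda>t. R t * sin t + R (t + pi) * sin t) =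
        (\<lambda>t. 1 / 2 * circ (\<lambda>x. E x * (sin t * E (x + t))))"
    proof
      fix t
      have "R t * sin t + R (t + pi) * sin t = sin t * (R t + R (t + pi))" by (simp add: algebra_simps)
      also have "\<dots> = 1 / 2 * circ (\<lambda>x. sin t * (E x * E (x + t)))"
        unfolding RE circ_cmult by simp
      finally show "R t * sin t + R (t + pi) * sin t = 1 / 2 * circ (\<lambda>x. E x * (sin t * E (x + t)))"
        by (simp add: mult.left_commute)
    qed
    also have "integral {0..pi} (\<lambda>t. 1 / 2 * circ (\<lambda>x. E x * (sin t * E (x + t)))) =
        1 / 2 * integral {0..pi} (\<lambda>t. circ (\<lambda>x. E x * (sin t * E (x + t))))" by simp
    also have "integral {0..pi} (\<lambda>t. circ (\<lambda>x. E x * (sin t * E (x + t)))) =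
        circ (\<lambda>x. integral {0..pi} (\<lambda>t. E x * (sin t * E (x + t))))"
      by (rule integral_swap_real) (unfold case_prod_unfold, intro continuous_intros)
    also have "\<dots> = circ (\<lambda>x. E x * W x)" by (simp add: W_def)
    finally show ?thesis by simp
  qed
  note ev = pi_periodic_inequality[OF dE dE' c(3) perE, folded W_def, folded SEW]
  note od = pi_antiperiodic_inequality[OF dQ c(5) antiQ meanQ]
  show ?le using ev(1) od(1) paraq paraq' by linarith
  show "?eq \<longleftrightarrow> ?trig"
  proof
    assume eq: ?eq
    have "2 * circ (\<lambda>x. (E x)\<^sup>2) = 4 * S + 2 / 3 * circ (\<lambda>x. (E' x)\<^sup>2)"
      and o: "3 * circ (\<lambda>x. (Q x)\<^sup>2) = circ (\<lambda>x. (Q' x)\<^sup>2)"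
      using ev(1) od(1) paraq paraq' eq by linarith+
    then obtain a0 a2 b2 where "\<And>x. E x = a0 + a2 * cos (2 * x) + b2 * sin (2 * x)"
      using ev(2) by blast
    moreover have "Q x = 0" for x using od(2)[OF o] .
    then have "q x = E x / 2" for x by (simp add: E_def Q_def)
    ultimately have "q x = a0 / 2 + (a2 / 2) * cos (2 * x) + (b2 / 2) * sin (2 * x)" for x
      by (simp add: add_divide_distrib)
    then show ?trig by blast
  next
    assume ?trig
    then obtain a0 a2 b2 where t: "\<And>x. q x = a0 + a2 * cos (2 * x) + b2 * sin (2 * x)" by blast
    have qpi: "q (x + pi) = q x" for x
      using cos_periodic[of "2 * x"] sin_periodic[of "2 * x"] by (simp add: t distrib_left)
    have "q' (x + pi) = q' x" for x using periodic_deriv[OF dq qpi] .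
    then have "Q = (\<lambda>x. 0)" "Q' = (\<lambda>x. 0)" by (auto simp: Q_def Q'_def qpi)
    then have "circ (\<lambda>x. (Q x)\<^sup>2) = 0" "circ (\<lambda>x. (Q' x)\<^sup>2) = 0" by simp_all
    moreover have "E x = 2 * a0 + (2 * a2) * cos (2 * x) + (2 * b2) * sin (2 * x)" for x
      by (simp add: E_def qpi) (simp add: t algebra_simps)
    then have "2 * circ (\<lambda>x. (E x)\<^sup>2) = 4 * S + 2 / 3 * circ (\<lambda>x. (E' x)\<^sup>2)"
      using ev(2) by blast
    ultimately show ?eq using paraq paraq' by linarith
  qed
qed

section \<open>The moving frame of the plane\<close>

text \<open>The derivative of \<^const>\<open>unit_dir\<close>, which completes it to a positively oriented orthonormal frame.\<close>

definition rot_dir :: "real \<Rightarrow> real^2" where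
  "rot_dir \<phi> = vector [- sin \<phi>, cos \<phi>]"

lemma unit_dir_nth [simp]: "unit_dir \<phi> $ 1 = cos \<phi>" "unit_dir \<phi> $ 2 = sin \<phi>"
  and rot_dir_nth [simp]: "rot_dir \<phi> $ 1 = - sin \<phi>" "rot_dir \<phi> $ 2 = cos \<phi>"
  by (simp_all add: unit_dir_def rot_dir_def)

lemma inner_real2: "x \<bullet> y = x $ 1 * y $ 1 + x $ 2 * y $ 2" for x y :: "real^2"
  by (simp add: inner_vec_def sum_2)

lemma inner_unit_dir: "x \<bullet> unit_dir \<phi> = x $ 1 * cos \<phi> + x $ 2 * sin \<phi>"
  and inner_rot_dir: "x \<bullet> rot_dir \<phi> = - x $ 1 * sin \<phi> + x $ 2 * cos \<phi>"
  by (simp_all add: inner_real2)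

lemma unit_dir_add: "unit_dir (\<phi> + \<theta>) = cos \<theta> *\<^sub>R unit_dir \<phi> + sin \<theta> *\<^sub>R rot_dir \<phi>"
  and rot_dir_add: "rot_dir (\<phi> + \<theta>) = cos \<theta> *\<^sub>R rot_dir \<phi> - sin \<theta> *\<^sub>R unit_dir \<phi>"
  by (simp_all add: vec_eq_iff forall_2 cos_add sin_add mult.commute)

lemma unit_dir_frame [simp]:
  "unit_dir \<phi> \<bullet> unit_dir \<phi> = 1" "rot_dir \<phi> \<bullet> rot_dir \<phi> = 1"
  "unit_dir \<phi> \<bullet> rot_dir \<phi> = 0" "rot_dir \<phi> \<bullet> unit_dir \<phi> = 0"
  by (simp_all add: inner_real2 flip: power2_eq_square)

lemma norm_dirs [simp]: "norm (unit_dir \<phi>) = 1" "norm (rot_dir \<phi>) = 1"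
  by (simp_all add: norm_eq_sqrt_inner)

lemma frame_decomp: "x = (x \<bullet> unit_dir \<phi>) *\<^sub>R unit_dir \<phi> + (x \<bullet> rot_dir \<phi>) *\<^sub>R rot_dir \<phi>"
proof -
  have "sin \<phi> * sin \<phi> + cos \<phi> * cos \<phi> = 1" using sin_cos_squared_add[of \<phi>] by (simp add: power2_eq_square)
  then have "x $ 1 = (x $ 1 * cos \<phi> + x $ 2 * sin \<phi>) * cos \<phi> + (- x $ 1 * sin \<phi> + x $ 2 * cos \<phi>) * - sin \<phi>"
    "x $ 2 = (x $ 1 * cos \<phi> + x $ 2 * sin \<phi>) * sin \<phi> + (- x $ 1 * sin \<phi> + x $ 2 * cos \<phi>) * cos \<phi>"
    by algebra+
  then show ?thesis by (simp add: vec_eq_iff forall_2 inner_unit_dir inner_rot_dir)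
qed

lemma eq_by_frame:
  "x \<bullet> unit_dir \<phi> = y \<bullet> unit_dir \<phi> \<Longrightarrow> x \<bullet> rot_dir \<phi> = y \<bullet> rot_dir \<phi> \<Longrightarrow> x = y"
  using frame_decomp[of x \<phi>] frame_decomp[of y \<phi>] by simp

lemma unit_dir_eq_iff: "unit_dir a = unit_dir b \<longleftrightarrow> (\<exists>n::int. a = b + of_int n * (2 * pi))"
proof -
  have "unit_dir a = unit_dir b \<longleftrightarrow> sin a = sin b \<and> cos a = cos b"
    by (auto simp: vec_eq_iff forall_2)
  then show ?thesis by (simp add: sin_cos_eq_iff mult.commute mult.left_commute)
qed

lemma unit_dir_inj:
  assumes "unit_dir a = unit_dir b" "\<bar>a - b\<bar> < 2 * pi"
  shows "a = b"
proof -
  obtain n :: int where n: "a = b + of_int n * (2 * pi)" using assms(1) unit_dir_eq_iff by blast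
  then have "\<bar>real_of_int n\<bar> * (2 * pi) < 1 * (2 * pi)" using assms(2) by (simp add: abs_mult)
  then have "\<bar>real_of_int n\<bar> < 1" by (simp only: mult_less_cancel_right) auto
  then have "n = 0" by linarith
  then show ?thesis using n by simp
qed

lemma polar_decomposition:
  fixes x :: "real^2"
  obtains r \<phi> where "0 \<le> r" "0 \<le> \<phi>" "\<phi> < 2 * pi" "x = r *\<^sub>R unit_dir \<phi>" "r = norm x"
proof (cases "x = 0")
  case True
  then show ?thesis using that[of 0 0] by simp
next
  case False
  define r where "r = norm x"
  have r: "r > 0" using False by (simp add: r_def)
  have "(x $ 1)\<^sup>2 + (x $ 2)\<^sup>2 = r\<^sup>2"
    by (simp add: r_def power2_norm_eq_inner inner_real2 flip: power2_eq_square)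
  then have "(x $ 1 / r)\<^sup>2 + (x $ 2 / r)\<^sup>2 = 1"
    using r by (simp add: power_divide flip: add_divide_distrib)
  then obtain t where t: "0 \<le> t" "t < 2 * pi" "x $ 1 / r = cos t" "x $ 2 / r = sin t"
    using sincos_total_2pi by metis
  then have xr: "x = r *\<^sub>R unit_dir t" using r by (simp add: vec_eq_iff forall_2 field_simps)
  show ?thesis by (rule that[OF less_imp_le[OF r] t(1,2) xr r_def])
qed

lemma sin_three_directions:
  "sin (b - a) *\<^sub>R unit_dir c = sin (b - c) *\<^sub>R unit_dir a + sin (c - a) *\<^sub>R unit_dir b"
proof -
  show ?thesis by (simp add: vec_eq_iff forall_2 sin_diff algebra_simps)
qed

section \<open>Convex bodies with a differentiable support function\<close>

text \<open>A differentiable support function means that each support line has a single point of contact: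
\<open>p - x \<bullet> u\<close> attains its minimum \<open>0\<close> at \<open>\<phi>\<close>, so its derivative vanishes there, and this
fixes the second coordinate of \<open>x\<close> in the frame at \<open>\<phi>\<close>.\<close>

lemma touching_point_of_derivative:
  fixes p p' :: "real \<Rightarrow> real"
  assumes dp: "\<And>\<psi>. (p has_real_derivative p' \<psi>) (at \<psi>)"
    and le: "\<And>\<psi>. x \<bullet> unit_dir \<psi> \<le> p \<psi>" and eq: "x \<bullet> unit_dir \<phi> = p \<phi>"
  shows "x = p \<phi> *\<^sub>R unit_dir \<phi> + p' \<phi> *\<^sub>R rot_dir \<phi>"
proof -
  define g where "g \<psi> = p \<psi> - x \<bullet> unit_dir \<psi>" for \<psi>
  have "(g has_real_derivative p' \<psi> - x \<bullet> rot_dir \<psi>) (at \<psi>)" for \<psi>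
    unfolding g_def[abs_def] inner_unit_dir inner_rot_dir
    by (auto intro!: derivative_eq_intros dp simp: algebra_simps)
  moreover have "g \<phi> \<le> g \<psi>" for \<psi>
    using eq le[of \<psi>] by (simp add: g_def)
  ultimately have "p' \<phi> - x \<bullet> rot_dir \<phi> = 0"
    using DERIV_local_min[of g _ \<phi> 1] by (metis zero_less_one)
  then show ?thesis using frame_decomp[of x \<phi>] eq by simp
qed

text \<open>A convex body described by its support function \<open>q\<close> about an interior point \<open>s\<close>. The last two
assumptions say that the envelope of the support lines consists of points of \<open>K\<close>, and that no point
of \<open>K\<close> lies on two support lines, that is, \<open>K\<close> has no corners.\<close>

locale support_oval =
  fixes K :: "(real^2) set" and s :: "real^2" and q q' q'' :: "real \<Rightarrow> real"
  assumes dq: "\<And>x. (q has_real_derivative q' x) (at x)"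
    and dq': "\<And>x. (q' has_real_derivative q'' x) (at x)"
    and cq'': "continuous_on UNIV q''"
    and per: "\<And>x. q (x + 2 * pi) = q x"
    and pos: "\<And>\<phi>. q \<phi> > 0"
    and K_eq: "K = {x. \<forall>\<phi>. (x - s) \<bullet> unit_dir \<phi> \<le> q \<phi>}"
    and contact_mem: "\<And>\<phi>. s + q \<phi> *\<^sub>R unit_dir \<phi> + q' \<phi> *\<^sub>R rot_dir \<phi> \<in> K"
    and contact_inj: "\<And>\<phi> \<psi>. s + q \<phi> *\<^sub>R unit_dir \<phi> + q' \<phi> *\<^sub>R rot_dir \<phi> =
          s + q \<psi> *\<^sub>R unit_dir \<psi> + q' \<psi> *\<^sub>R rot_dir \<psi> \<Longrightarrow> unit_dir \<phi> = unit_dir \<psi>"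
begin

lemma cq: "continuous_on UNIV q" and cq': "continuous_on UNIV q'"
  using continuous_of_deriv dq dq' by blast+

lemmas continuous_on_q [continuous_intros] = cq[THEN continuous_on_compose2, OF _ subset_UNIV]
  cq'[THEN continuous_on_compose2, OF _ subset_UNIV] cq''[THEN continuous_on_compose2, OF _ subset_UNIV]

lemma per': "q' (x + 2 * pi) = q' x"
  using periodic_deriv[OF dq per] .

definition contact :: "real \<Rightarrow> real^2" where
  "contact \<phi> = s + q \<phi> *\<^sub>R unit_dir \<phi> + q' \<phi> *\<^sub>R rot_dir \<phi>"

definition touches :: "real^2 \<Rightarrow> real \<Rightarrow> bool" where
  "touches P \<phi> \<longleftrightarrow> (P - s) \<bullet> unit_dir \<phi> = q \<phi>"

lemma contact_in: "contact \<phi> \<in> K" and contact_inj': "contact \<phi> = contact \<psi> \<Longrightarrow> unit_dir \<phi> = unit_dir \<psi>"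
  using contact_mem contact_inj by (auto simp: contact_def)

lemma contact_inner [simp]: "(contact \<phi> - s) \<bullet> unit_dir \<phi> = q \<phi>" "(contact \<phi> - s) \<bullet> rot_dir \<phi> = q' \<phi>"
  by (simp_all add: contact_def inner_add_left)

lemma touches_contact: "touches (contact \<phi>) \<phi>"
  by (simp add: touches_def)

lemma K_le: "x \<in> K \<Longrightarrow> (x - s) \<bullet> unit_dir \<phi> \<le> q \<phi>"
  by (simp add: K_eq)

lemma unit_dir_cong:
  assumes "unit_dir a = unit_dir b"
  shows "q a = q b" "contact a = contact b" "touches P a \<longleftrightarrow> touches P b"
proof -
  obtain n :: int where n: "a = b + of_int n * (2 * pi)" using assms unit_dir_eq_iff by blast
  have 1: "q a = q b" "q' a = q' b"
    unfolding n using periodic_of_int[of q "2 * pi"] periodic_of_int[of q' "2 * pi"] per per' by blast+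
  moreover have "rot_dir a = rot_dir b"
    using assms by (auto simp: vec_eq_iff forall_2)
  ultimately show "q a = q b" "contact a = contact b" "touches P a \<longleftrightarrow> touches P b"
    using assms by (simp_all add: contact_def touches_def)
qed

lemma touching_point_unique:
  assumes "x \<in> K" "touches x \<phi>"
  shows "x = contact \<phi>"
proof -
  have "x - s = q \<phi> *\<^sub>R unit_dir \<phi> + q' \<phi> *\<^sub>R rot_dir \<phi>"
    by (rule touching_point_of_derivative[OF dq])
       (use assms K_le[OF assms(1)] in \<open>simp_all add: touches_def\<close>)
  then show ?thesis by (simp add: contact_def algebra_simps)
qed

lemma q_convex:
  assumes "a < c" "c < b" "b - a < pi"
  shows "sin (b - a) * q c \<le> sin (b - c) * q a + sin (c - a) * q b"
proof -
  have "sin (b - a) * q c = (contact c - s) \<bullet> (sin (b - a) *\<^sub>R unit_dir c)" by simp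
  also have "\<dots> = sin (b - c) * ((contact c - s) \<bullet> unit_dir a) + sin (c - a) * ((contact c - s) \<bullet> unit_dir b)"
    by (subst sin_three_directions) (simp add: inner_add_right)
  also have "\<dots> \<le> sin (b - c) * q a + sin (c - a) * q b"
    by (intro add_mono mult_left_mono K_le contact_in) (use assms in \<open>auto intro!: sin_ge_zero\<close>)
  finally show ?thesis .
qed

text \<open>If three support lines through \<open>P\<close> had normals within an angle less than \<open>\<pi>\<close>, the contact point of
the middle one would have to satisfy the other two constraints with equality, because the middle
normal is a positive combination of the outer ones. A contact point lies on one support line only.\<close>

lemma touches_middle:
  assumes "touches P a" "touches P c" "touches P b" "a < c" "c < b" "b - a < pi"
  shows "P \<in> K"
proof -
  define z where "z = contact c"
  have s: "sin (b - c) > 0" "sin (c - a) > 0" using assms(4-) by (auto intro!: sin_gt_zero)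
  have le: "(z - P) \<bullet> unit_dir a \<le> 0" "(z - P) \<bullet> unit_dir b \<le> 0"
    using K_le[OF contact_in, of c a] K_le[OF contact_in, of c b] assms(1,3)
    by (simp_all add: z_def touches_def inner_diff_left)
  have zc: "(z - P) \<bullet> unit_dir c = 0"
    using assms(2) touches_contact[of c] by (simp add: z_def touches_def inner_diff_left)
  have eq: "sin (b - c) * ((z - P) \<bullet> unit_dir a) + sin (c - a) * ((z - P) \<bullet> unit_dir b) = 0"
    using arg_cong[OF sin_three_directions[of b a c], of "\<lambda>v. (z - P) \<bullet> v"] zc
    by (simp add: inner_add_right)
  have "sin (b - c) * ((z - P) \<bullet> unit_dir a) \<le> 0" "sin (c - a) * ((z - P) \<bullet> unit_dir b) \<le> 0"
    using s le by (simp_all add: mult_le_0_iff)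
  then have "(z - P) \<bullet> unit_dir a = 0" using eq s by (smt (verit) mult_eq_0_iff)
  then have "touches z a" using assms(1) by (simp add: touches_def inner_diff_left)
  then have "contact c = contact a" using touching_point_unique[OF contact_in] by (simp add: z_def)
  then have "unit_dir c = unit_dir a" by (rule contact_inj')
  moreover have "unit_dir c \<noteq> unit_dir a" using unit_dir_inj[of c a] assms(4-) by auto
  ultimately show ?thesis by blast
qed

lemma not_touches_opposite: "touches P a \<Longrightarrow> \<not> touches P (a + pi)"
  using pos[of a] pos[of "a + pi"] by (simp add: touches_def inner_unit_dir)

text \<open>Zero would be a positive combination of the three normals, and so of the three positive values of \<open>q\<close>.\<close>

lemma not_touches_surround:
  assumes "touches P a" "touches P b" "touches P c" "a < b" "b - a < pi" "c - b < pi" "c - a > pi" "c < a + 2 * pi"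
  shows False
proof -
  have "b < c" using assms by linarith
  have s: "sin (b - a) > 0" "sin (c - b) > 0" using assms(4-) \<open>b < c\<close> by (auto intro!: sin_gt_zero)
  have s3: "sin (c - a) < 0" using sin_lt_zero[of "c - a"] assms by simp
  have "sin (b - c) = - sin (c - b)" by (metis minus_diff_eq sin_minus)
  then have "sin (b - a) * ((P - s) \<bullet> unit_dir c) + sin (c - b) * ((P - s) \<bullet> unit_dir a)
      = sin (c - a) * ((P - s) \<bullet> unit_dir b)"
    using arg_cong[OF sin_three_directions[of b a c], of "\<lambda>v. (P - s) \<bullet> v"]
    by (simp add: inner_add_right inner_diff_right)
  then have "sin (b - a) * q c + sin (c - b) * q a = sin (c - a) * q b"
    using assms(1-3) by (simp add: touches_def)
  moreover have "sin (b - a) * q c > 0" "sin (c - b) * q a > 0" "sin (c - a) * q b < 0"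
    using s s3 pos by (simp_all add: mult_neg_pos)
  ultimately show False by linarith
qed

text \<open>Rotating \<open>\<psi>\<close> once around, every position other than \<open>\<phi>\<close> and \<open>\<phi> + \<theta>\<close> falls under one of the three
preceding exclusions.\<close>

lemma two_tangent_directions:
  assumes "P \<notin> K" "0 < \<theta>" "\<theta> < pi" "touches P \<phi>" "touches P (\<phi> + \<theta>)" "touches P \<psi>"
  shows "unit_dir \<psi> = unit_dir \<phi> \<or> unit_dir \<psi> = unit_dir (\<phi> + \<theta>)"
proof -
  obtain n :: int where n: "\<phi> \<le> \<psi> + of_int n * (2 * pi)" "\<psi> + of_int n * (2 * pi) < \<phi> + 2 * pi"
    using shift_into_period[of "2 * pi" \<phi> \<psi>] by auto
  define x where "x = \<psi> + of_int n * (2 * pi)"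
  have ux: "unit_dir x = unit_dir \<psi>" unfolding unit_dir_eq_iff x_def by blast
  have tx: "touches P x" using assms(6) unit_dir_cong(3)[OF ux] by simp
  have u2: "unit_dir (x - 2 * pi) = unit_dir x" unfolding unit_dir_eq_iff by (rule exI[of _ "-1"]) simp
  have tx2: "touches P (x - 2 * pi)" using tx unit_dir_cong(3)[OF u2] by simp
  have x: "\<phi> \<le> x" "x < \<phi> + 2 * pi" using n by (simp_all add: x_def)
  consider "x = \<phi>" | "\<phi> < x" "x < \<phi> + \<theta>" | "x = \<phi> + \<theta>" | "\<phi> + \<theta> < x" "x < \<phi> + pi" | "x = \<phi> + pi"
    | "\<phi> + pi < x" "x < \<phi> + \<theta> + pi" | "x = \<phi> + \<theta> + pi" | "\<phi> + \<theta> + pi < x" "x < \<phi> + 2 * pi"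
    using x by linarith
  then show ?thesis
  proof cases
    case 2
    then show ?thesis using touches_middle[OF assms(4) tx assms(5)] assms(1,3) by simp
  next
    case 4
    then show ?thesis using touches_middle[OF assms(4,5) tx] assms(1,2) by simp
  next
    case 5
    then show ?thesis using not_touches_opposite[OF assms(4)] tx by simp
  next
    case 6
    then show ?thesis using not_touches_surround[OF assms(4,5) tx] assms(2,3) x by simp
  next
    case 7
    then show ?thesis using not_touches_opposite[OF assms(5)] tx by simp
  next
    case 8
    then show ?thesis using touches_middle[OF tx2 assms(4,5)] assms(1,2,3) by simp
  qed (use ux in auto)
qed

text \<open>The signed distance \<open>d \<psi>\<close> from \<open>P\<close> to the support lines is negative for some \<open>x\<close> because \<open>P \<notin> K\<close>, and
positive for \<open>x \<plusminus> \<pi>\<close>, since \<open>d x + d (x + \<pi>)\<close> is the width of \<open>K\<close>. So there are zeros on both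
sides of \<open>x\<close>. Their distance is not \<open>\<pi>\<close>, again by the positive width, and not larger, because then
\<open>u (x + \<pi>)\<close> would be in the cone of the two normals and \<open>d (x + \<pi>) \<le> 0\<close> by convexity.\<close>

lemma tangent_directions_exist:
  assumes "P \<notin> K"
  obtains \<phi> \<theta> where "0 \<le> \<phi>" "\<phi> < 2 * pi" "0 < \<theta>" "\<theta> < pi" "touches P \<phi>" "touches P (\<phi> + \<theta>)"
proof -
  define d where "d \<psi> = q \<psi> - (P - s) \<bullet> unit_dir \<psi>" for \<psi>
  have cd: "continuous_on S d" for S
    unfolding d_def inner_unit_dir
    by (intro continuous_intros continuous_on_subset[OF cq]) auto
  have td: "touches P \<psi> \<longleftrightarrow> d \<psi> = 0" for \<psi> by (auto simp: touches_def d_def)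
  obtain x where x: "d x < 0" using assms by (auto simp: K_eq d_def not_le)
  have opp: "d \<psi> + d (\<psi> + pi) > 0" for \<psi>
    using pos[of \<psi>] pos[of "\<psi> + pi"] by (simp add: d_def inner_unit_dir)
  have x1: "d (x + pi) > 0" using opp[of x] x by simp
  have x2: "d (x - pi) > 0" using opp[of "x - pi"] x by simp
  obtain a where a: "x - pi \<le> a" "a \<le> x" "d a = 0"
    using IVT2'[of d x 0 "x - pi"] cd x x2 by auto
  obtain b where b: "x \<le> b" "b \<le> x + pi" "d b = 0"
    using IVT'[of d x 0 "x + pi"] cd x x1 by auto
  have ne: "a \<noteq> x" "b \<noteq> x" "a \<noteq> x - pi" "b \<noteq> x + pi" using x x1 x2 a b by auto
  have "b - a < pi"
  proof (rule ccontr)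
    assume "\<not> b - a < pi"
    moreover have "b - a \<noteq> pi"
      using opp[of a] a b by (auto simp: algebra_simps)
    ultimately have gt: "b - a > pi" by simp
    \<comment> \<open>The arc from \<open>b\<close> to \<open>a + 2 \<pi>\<close> is shorter than \<open>\<pi>\<close> and contains \<open>x + \<pi>\<close>.\<close>
    define a2 where "a2 = a + 2 * pi"
    have ua2: "unit_dir a2 = unit_dir a" unfolding unit_dir_eq_iff a2_def by (rule exI[of _ 1]) simp
    have da2: "d a2 = 0" using a(3) unit_dir_cong(1)[OF ua2] ua2 by (simp add: d_def)
    have o: "b < x + pi" "x + pi < a2" "a2 - b < pi" using a b ne gt by (auto simp: a2_def)
    let ?c = "x + pi"
    have "sin (a2 - b) * ((P - s) \<bullet> unit_dir ?c) =
        sin (a2 - ?c) * ((P - s) \<bullet> unit_dir b) + sin (?c - b) * ((P - s) \<bullet> unit_dir a2)"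
      using arg_cong[OF sin_three_directions[of a2 b ?c], of "\<lambda>v. (P - s) \<bullet> v"]
      by (simp add: inner_add_right)
    with q_convex[OF o] have "sin (a2 - b) * d ?c \<le> sin (a2 - ?c) * d b + sin (?c - b) * d a2"
      unfolding d_def right_diff_distrib by linarith
    then have "sin (a2 - b) * d ?c \<le> 0" using b(3) da2 by simp
    moreover have "sin (a2 - b) > 0" using o by (intro sin_gt_zero) auto
    ultimately show False using x1 by (simp add: mult_le_0_iff)
  qed
  obtain n :: int where n: "0 \<le> a + of_int n * (2 * pi)" "a + of_int n * (2 * pi) < 0 + 2 * pi"
    using shift_into_period[of "2 * pi" 0 a] by auto
  define \<phi> where "\<phi> = a + of_int n * (2 * pi)"
  have u: "unit_dir \<phi> = unit_dir a" unfolding unit_dir_eq_iff \<phi>_def by blast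
  have u': "unit_dir (\<phi> + (b - a)) = unit_dir b"
    unfolding unit_dir_eq_iff \<phi>_def by (rule exI[of _ n]) simp
  show ?thesis
    by (rule that[of \<phi> "b - a"])
       (use n a b ne \<open>b - a < pi\<close> unit_dir_cong(3)[OF u] unit_dir_cong(3)[OF u'] td in \<open>auto simp: \<phi>_def\<close>)
qed

text \<open>The intersection of the support lines with normals \<open>u \<phi>\<close> and \<open>u (\<phi> + \<theta>)\<close>, when \<open>sin \<theta> \<noteq> 0\<close>.\<close>

definition ext_point :: "real \<Rightarrow> real \<Rightarrow> real^2" where
  "ext_point \<theta> \<phi> = s + q \<phi> *\<^sub>R unit_dir \<phi> + ((q (\<phi> + \<theta>) - q \<phi> * cos \<theta>) / sin \<theta>) *\<^sub>R rot_dir \<phi>"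

text \<open>\<open>N1 / sin \<theta>\<close> and \<open>N2 / sin \<theta>\<close> are the lengths of the tangents from \<open>ext_point \<theta> \<phi>\<close> to the contact
points at \<open>\<phi>\<close> and \<open>\<phi> + \<theta>\<close>. \<open>N1\<close> itself is the distance of \<open>contact \<phi>\<close> from the support line at
\<open>\<phi> + \<theta>\<close>, and \<open>N2\<close> that of \<open>contact (\<phi> + \<theta>)\<close> from the one at \<open>\<phi>\<close>.\<close>

definition N1 :: "real \<Rightarrow> real \<Rightarrow> real" where
  "N1 \<theta> \<phi> = q (\<phi> + \<theta>) - q \<phi> * cos \<theta> - q' \<phi> * sin \<theta>"

definition N2 :: "real \<Rightarrow> real \<Rightarrow> real" where
  "N2 \<theta> \<phi> = q \<phi> - q (\<phi> + \<theta>) * cos \<theta> + q' (\<phi> + \<theta>) * sin \<theta>"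

lemma ext_point_inner:
  "(ext_point \<theta> \<phi> - s) \<bullet> unit_dir \<phi> = q \<phi>"
  "(ext_point \<theta> \<phi> - s) \<bullet> rot_dir \<phi> = (q (\<phi> + \<theta>) - q \<phi> * cos \<theta>) / sin \<theta>"
  by (simp_all add: ext_point_def inner_add_left)

lemma ext_point_touches:
  assumes "sin \<theta> \<noteq> 0"
  shows "touches (ext_point \<theta> \<phi>) \<phi>" "touches (ext_point \<theta> \<phi>) (\<phi> + \<theta>)"
  using assms ext_point_inner[of \<theta> \<phi>]
  by (simp_all add: touches_def unit_dir_add inner_add_right mult.commute)

lemma ext_point_unique:
  assumes "sin \<theta> \<noteq> 0" "touches P \<phi>" "touches P (\<phi> + \<theta>)"
  shows "P = ext_point \<theta> \<phi>"
proof -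
  have "(P - s) \<bullet> rot_dir \<phi> = (q (\<phi> + \<theta>) - q \<phi> * cos \<theta>) / sin \<theta>"
    using assms by (simp add: touches_def unit_dir_add inner_add_right field_simps)
  then have "P - s = ext_point \<theta> \<phi> - s"
    using assms(2) ext_point_inner[of \<theta> \<phi>] by (intro eq_by_frame[of _ \<phi>]) (simp_all add: touches_def)
  then show ?thesis by simp
qed

lemma unit_dir_add_neq: "0 < \<theta> \<Longrightarrow> \<theta> < pi \<Longrightarrow> unit_dir (\<phi> + \<theta>) \<noteq> unit_dir \<phi>"
  using unit_dir_inj[of "\<phi> + \<theta>" \<phi>] by auto

lemma contact_add_neq: "0 < \<theta> \<Longrightarrow> \<theta> < pi \<Longrightarrow> contact (\<phi> + \<theta>) \<noteq> contact \<phi>"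
  using unit_dir_add_neq contact_inj' by blast

lemma ext_point_notin:
  assumes "0 < \<theta>" "\<theta> < pi"
  shows "ext_point \<theta> \<phi> \<notin> K"
proof
  assume "ext_point \<theta> \<phi> \<in> K"
  moreover have "sin \<theta> \<noteq> 0" using sin_gt_zero assms by force
  ultimately have "contact \<phi> = contact (\<phi> + \<theta>)"
    using touching_point_unique ext_point_touches by metis
  then show False using contact_add_neq assms by metis
qed

lemma N1_eq: "N1 \<theta> \<phi> = q (\<phi> + \<theta>) - (contact \<phi> - s) \<bullet> unit_dir (\<phi> + \<theta>)"
  by (simp add: N1_def unit_dir_add inner_add_right mult.commute)

lemma N2_eq: "N2 \<theta> \<phi> = q \<phi> - (contact (\<phi> + \<theta>) - s) \<bullet> unit_dir \<phi>"
  using unit_dir_add[of "\<phi> + \<theta>" "- \<theta>"] by (simp add: N2_def inner_diff_right mult.commute)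

lemma N_nonneg: "0 \<le> N1 \<theta> \<phi>" "0 \<le> N2 \<theta> \<phi>"
  unfolding N1_eq N2_eq using K_le[OF contact_in] by simp_all

lemma N_pos:
  assumes "0 < \<theta>" "\<theta> < pi"
  shows "0 < N1 \<theta> \<phi>" "0 < N2 \<theta> \<phi>"
proof -
  have "N1 \<theta> \<phi> \<noteq> 0" "N2 \<theta> \<phi> \<noteq> 0"
    unfolding N1_eq N2_eq
    using touching_point_unique[OF contact_in, of \<phi> "\<phi> + \<theta>"] touching_point_unique[OF contact_in, of "\<phi> + \<theta>" \<phi>]
      contact_add_neq[OF assms, of \<phi>]
    by (auto simp: touches_def)
  then show "0 < N1 \<theta> \<phi>" "0 < N2 \<theta> \<phi>" using N_nonneg[of \<theta> \<phi>] by linarith+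
qed

lemma ext_point_bij:
  "inj_on (\<lambda>(\<theta>, \<phi>). ext_point \<theta> \<phi>) ({0<..<pi} \<times> {0..<2 * pi})" (is "inj_on ?e ?X")
  "(\<lambda>(\<theta>, \<phi>). ext_point \<theta> \<phi>) ` ({0<..<pi} \<times> {0..<2 * pi}) = - K"
proof -
  have sin: "sin \<theta> \<noteq> 0" if "0 < \<theta>" "\<theta> < pi" for \<theta> using sin_gt_zero that by force
  show "inj_on ?e ?X"
  proof (rule inj_onI, clarify)
    fix \<theta> \<phi> \<theta>' \<phi>' :: real
    assume 1: "\<theta> \<in> {0<..<pi}" "\<phi> \<in> {0..<2 * pi}" "\<theta>' \<in> {0<..<pi}" "\<phi>' \<in> {0..<2 * pi}"
      and eq: "ext_point \<theta> \<phi> = ext_point \<theta>' \<phi>'"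
    define P where "P = ext_point \<theta> \<phi>"
    have P: "P \<notin> K" using 1 ext_point_notin by (simp add: P_def)
    have t: "touches P \<phi>" "touches P (\<phi> + \<theta>)"
      unfolding P_def using 1 sin ext_point_touches by simp_all
    have t': "touches P \<phi>'" "touches P (\<phi>' + \<theta>')"
      unfolding P_def eq using 1 sin ext_point_touches by simp_all
    have "unit_dir \<phi>' = unit_dir \<phi> \<or> unit_dir \<phi>' = unit_dir (\<phi> + \<theta>)"
      using two_tangent_directions[OF P _ _ t t'(1)] 1 by simp
    moreover have "unit_dir (\<phi>' + \<theta>') = unit_dir \<phi> \<or> unit_dir (\<phi>' + \<theta>') = unit_dir (\<phi> + \<theta>)"
      using two_tangent_directions[OF P _ _ t t'(2)] 1 by simp
    moreover have "unit_dir (\<phi>' + \<theta>') \<noteq> unit_dir \<phi>'" using unit_dir_add_neq 1 by simp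
    ultimately consider "unit_dir \<phi>' = unit_dir \<phi>" "unit_dir (\<phi>' + \<theta>') = unit_dir (\<phi> + \<theta>)"
      | "unit_dir \<phi>' = unit_dir (\<phi> + \<theta>)" "unit_dir (\<phi>' + \<theta>') = unit_dir \<phi>" by metis
    then show "\<theta> = \<theta>' \<and> \<phi> = \<phi>'"
    proof cases
      case 1
      have "\<phi>' = \<phi>" using unit_dir_inj[OF 1(1)] \<open>\<phi> \<in> _\<close> \<open>\<phi>' \<in> _\<close> by (auto simp: abs_less_iff)
      moreover have "\<phi>' + \<theta>' = \<phi> + \<theta>"
        using unit_dir_inj[OF 1(2)] \<open>\<phi>' = \<phi>\<close> \<open>\<theta> \<in> _\<close> \<open>\<theta>' \<in> _\<close> by (auto simp: abs_less_iff)
      ultimately show ?thesis by simp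
    next
      case 2
      obtain m :: int where m: "\<phi>' = \<phi> + \<theta> + of_int m * (2 * pi)" using 2(1) unit_dir_eq_iff by blast
      obtain n :: int where n: "\<phi>' + \<theta>' = \<phi> + of_int n * (2 * pi)" using 2(2) unit_dir_eq_iff by blast
      have "\<theta> + \<theta>' = of_int (n - m) * (2 * pi)" using m n by (simp add: algebra_simps)
      moreover have "0 < \<theta> + \<theta>'" "\<theta> + \<theta>' < 2 * pi" using \<open>\<theta> \<in> _\<close> \<open>\<theta>' \<in> _\<close> by auto
      ultimately have "0 < of_int (n - m) * (2 * pi)" "of_int (n - m) * (2 * pi) < 1 * (2 * pi)" by linarith+
      then have "0 < real_of_int (n - m)" "real_of_int (n - m) < 1"
        by (simp_all only: mult_less_cancel_right zero_less_mult_iff) auto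
      then have "0 < n - m" "n - m < 1" by (simp_all only: of_int_0_less_iff of_int_less_1_iff)
      then have False by simp
      then show ?thesis ..
    qed
  qed
  show "?e ` ?X = - K"
  proof
    show "?e ` ?X \<subseteq> - K"
      using ext_point_notin by auto
    show "- K \<subseteq> ?e ` ?X"
    proof
      fix P assume "P \<in> - K"
      then obtain \<phi> \<theta> where "0 \<le> \<phi>" "\<phi> < 2 * pi" "0 < \<theta>" "\<theta> < pi" "touches P \<phi>" "touches P (\<phi> + \<theta>)"
        using tangent_directions_exist by auto
      then show "P \<in> ?e ` ?X"
        using ext_point_unique sin by (intro image_eqI[of _ _ "(\<theta>, \<phi>)"]) auto
    qed
  qed
qed

end

context support_oval
begin

lemma touches_tangent_line: "tangent_line K {x. touches x \<psi>}"
  unfolding tangent_line_def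
proof (intro exI conjI ballI)
  show "unit_dir \<psi> \<noteq> 0" by (metis norm_dirs(1) norm_zero zero_neq_one)
  show "{x. touches x \<psi>} = {x. unit_dir \<psi> \<bullet> x = q \<psi> + s \<bullet> unit_dir \<psi>}"
    by (auto simp: touches_def inner_diff_left inner_commute[of "unit_dir \<psi>"])
  show "unit_dir \<psi> \<bullet> x \<le> q \<psi> + s \<bullet> unit_dir \<psi>" if "x \<in> K" for x
    using K_le[OF that, of \<psi>] by (simp add: inner_diff_left inner_commute[of "unit_dir \<psi>"])
  show "{x. touches x \<psi>} \<inter> K \<noteq> {}" using touches_contact contact_in by auto
qed

lemma tangent_line_touches:
  assumes "tangent_line K l"
  obtains \<psi> where "l = {x. touches x \<psi>}"
proof -
  obtain n c where nc: "n \<noteq> 0" "l = {x. n \<bullet> x = c}" "\<And>x. x \<in> K \<Longrightarrow> n \<bullet> x \<le> c" "l \<inter> K \<noteq> {}"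
    using assms by (auto simp: tangent_line_def)
  obtain r \<psi> where r: "0 \<le> r" "n = r *\<^sub>R unit_dir \<psi>" using polar_decomposition by metis
  have rp: "r > 0" using r nc(1) by (cases "r = 0") auto
  obtain z where z: "z \<in> K" "n \<bullet> z = c" using nc(2,4) by auto
  have nx: "n \<bullet> x = r * ((x - s) \<bullet> unit_dir \<psi> + s \<bullet> unit_dir \<psi>)" for x
    by (simp add: r inner_diff_left inner_commute algebra_simps)
  have "r * (q \<psi> + s \<bullet> unit_dir \<psi>) \<le> c"
    using nc(3)[OF contact_in, of \<psi>] unfolding nx by simp
  moreover have "c \<le> r * (q \<psi> + s \<bullet> unit_dir \<psi>)"
    using z K_le[OF z(1), of \<psi>] rp unfolding nx by auto
  ultimately have "c = r * (q \<psi> + s \<bullet> unit_dir \<psi>)" by simp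
  then have "l = {x. touches x \<psi>}" using rp unfolding nc(2) nx by (simp add: touches_def)
  then show ?thesis by (rule that)
qed

text \<open>From the intersection point the contact points lie in the directions \<open>- rot_dir \<phi>\<close> and
\<open>rot_dir (\<phi> + \<theta>)\<close>, at the positive distances \<open>N1 / sin \<theta>\<close> and \<open>N2 / sin \<theta>\<close>.\<close>

lemma vangle_contact:
  assumes "0 < \<theta>" "\<theta> < pi"
  shows "vangle (contact \<phi> - ext_point \<theta> \<phi>) (contact (\<phi> + \<theta>) - ext_point \<theta> \<phi>) = pi - \<theta>"
proof -
  define P where "P = ext_point \<theta> \<phi>"
  have sin: "sin \<theta> > 0" using sin_gt_zero assms by simp
  define \<alpha> where "\<alpha> = N1 \<theta> \<phi> / sin \<theta>"
  define \<beta> where "\<beta> = N2 \<theta> \<phi> / sin \<theta>"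
  have ab: "\<alpha> > 0" "\<beta> > 0" using N_pos[OF assms] sin by (simp_all add: \<alpha>_def \<beta>_def)
  have sc: "cos \<theta> * cos \<theta> = 1 - sin \<theta> * sin \<theta>"
    using sin_cos_squared_add[of \<theta>] by (simp add: power2_eq_square)
  have v1: "contact \<phi> - P = - \<alpha> *\<^sub>R rot_dir \<phi>"
    using sin by (simp add: contact_def P_def ext_point_def \<alpha>_def N1_def field_simps flip: scaleR_add_left)
  have r2: "(P - s) \<bullet> rot_dir (\<phi> + \<theta>) = (q (\<phi> + \<theta>) * cos \<theta> - q \<phi>) / sin \<theta>"
  proof -
    have "(P - s) \<bullet> rot_dir (\<phi> + \<theta>) = cos \<theta> * ((q (\<phi> + \<theta>) - q \<phi> * cos \<theta>) / sin \<theta>) - sin \<theta> * q \<phi>"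
      by (simp add: rot_dir_add inner_diff_right P_def ext_point_inner)
    also have "\<dots> = (q (\<phi> + \<theta>) * cos \<theta> - q \<phi>) / sin \<theta>"
    proof -
      have e: "q \<phi> = cos \<theta> * (cos \<theta> * q \<phi>) + sin \<theta> * (sin \<theta> * q \<phi>)" using sc by algebra
      show ?thesis using sin by (simp add: field_simps) (rule e)
    qed
    finally show ?thesis .
  qed
  have v2: "contact (\<phi> + \<theta>) - P = \<beta> *\<^sub>R rot_dir (\<phi> + \<theta>)"
  proof (rule eq_by_frame[of _ "\<phi> + \<theta>"])
    have "touches P (\<phi> + \<theta>)" using sin ext_point_touches by (simp add: P_def)
    then show "(contact (\<phi> + \<theta>) - P) \<bullet> unit_dir (\<phi> + \<theta>) = \<beta> *\<^sub>R rot_dir (\<phi> + \<theta>) \<bullet> unit_dir (\<phi> + \<theta>)"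
      using touches_contact[of "\<phi> + \<theta>"] by (simp add: touches_def inner_diff_left)
    have "(contact (\<phi> + \<theta>) - P) \<bullet> rot_dir (\<phi> + \<theta>) =
        (contact (\<phi> + \<theta>) - s) \<bullet> rot_dir (\<phi> + \<theta>) - (P - s) \<bullet> rot_dir (\<phi> + \<theta>)"
      by (simp only: inner_diff_left)
    also have "\<dots> = \<beta>" unfolding r2 contact_inner using sin by (simp add: \<beta>_def N2_def field_simps)
    finally show "(contact (\<phi> + \<theta>) - P) \<bullet> rot_dir (\<phi> + \<theta>) = \<beta> *\<^sub>R rot_dir (\<phi> + \<theta>) \<bullet> rot_dir (\<phi> + \<theta>)"
      by simp
  qed
  have "rot_dir \<phi> \<bullet> rot_dir (\<phi> + \<theta>) = cos \<theta>"
    by (simp add: rot_dir_add inner_diff_right)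
  then have "(contact \<phi> - P) \<bullet> (contact (\<phi> + \<theta>) - P) / (norm (contact \<phi> - P) * norm (contact (\<phi> + \<theta>) - P)) = - cos \<theta>"
    unfolding v1 v2 using ab by simp
  then show ?thesis using assms
    by (simp add: vangle_def P_def arccos_minus arccos_cos)
qed

lemma vangle_commute: "vangle u v = vangle v u"
  by (simp add: vangle_def inner_commute mult.commute)

lemma visual_angle_ext_point:
  assumes "0 < \<theta>" "\<theta> < pi"
  shows "visual_angle K (ext_point \<theta> \<phi>) = pi - \<theta>"
  unfolding visual_angle_def
proof (rule the_equality)
  have sin: "sin \<theta> \<noteq> 0" using sin_gt_zero assms by force
  define P where "P = ext_point \<theta> \<phi>"
  have P: "P \<notin> K" using ext_point_notin assms by (simp add: P_def)
  have t: "touches P \<phi>" "touches P (\<phi> + \<theta>)"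
    unfolding P_def using sin ext_point_touches by simp_all
  have ne: "{x. touches x \<phi>} \<noteq> {x. touches x (\<phi> + \<theta>)}"
  proof
    assume "{x. touches x \<phi>} = {x. touches x (\<phi> + \<theta>)}"
    then have "touches (contact \<phi>) (\<phi> + \<theta>)" using touches_contact by auto
    then show False using touching_point_unique[OF contact_in] contact_add_neq[OF assms] by metis
  qed
  let ?angle = "\<lambda>\<omega>. \<exists>l1 l2 T1 T2. tangent_line K l1 \<and> tangent_line K l2 \<and> l1 \<noteq> l2 \<and>
      ext_point \<theta> \<phi> \<in> l1 \<and> ext_point \<theta> \<phi> \<in> l2 \<and> T1 \<in> l1 \<inter> K \<and> T2 \<in> l2 \<inter> K \<and>
      \<omega> = vangle (T1 - ext_point \<theta> \<phi>) (T2 - ext_point \<theta> \<phi>)"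
  show "?angle (pi - \<theta>)"
    using vangle_contact[OF assms, of \<phi>] ne t touches_tangent_line contact_in touches_contact
    unfolding P_def
    by (intro exI[of _ "{x. touches x \<phi>}"] exI[of _ "{x. touches x (\<phi> + \<theta>)}"]
        exI[of _ "contact \<phi>"] exI[of _ "contact (\<phi> + \<theta>)"]) simp
  fix \<omega>
  assume "?angle \<omega>"
  then obtain l1 l2 T1 T2 where l: "tangent_line K l1" "tangent_line K l2" "l1 \<noteq> l2" "P \<in> l1" "P \<in> l2"
      "T1 \<in> l1" "T1 \<in> K" "T2 \<in> l2" "T2 \<in> K" and \<omega>: "\<omega> = vangle (T1 - P) (T2 - P)"
    unfolding P_def by auto
  obtain a where a: "l1 = {x. touches x a}" using tangent_line_touches l(1) by blast
  obtain b where b: "l2 = {x. touches x b}" using tangent_line_touches l(2) by blast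
  have T: "T1 = contact a" "T2 = contact b"
    using touching_point_unique l a b by auto
  have da: "unit_dir a = unit_dir \<phi> \<or> unit_dir a = unit_dir (\<phi> + \<theta>)"
    using two_tangent_directions[OF P assms t] l(4) a by simp
  have db: "unit_dir b = unit_dir \<phi> \<or> unit_dir b = unit_dir (\<phi> + \<theta>)"
    using two_tangent_directions[OF P assms t] l(5) b by simp
  have dab: "unit_dir a \<noteq> unit_dir b"
  proof
    assume "unit_dir a = unit_dir b"
    then have "l1 = l2" unfolding a b using unit_dir_cong(3) by blast
    then show False using l(3) by simp
  qed
  from da db dab consider "unit_dir a = unit_dir \<phi>" "unit_dir b = unit_dir (\<phi> + \<theta>)"
    | "unit_dir a = unit_dir (\<phi> + \<theta>)" "unit_dir b = unit_dir \<phi>" by metis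
  then show "\<omega> = pi - \<theta>"
  proof cases
    case 1
    then have "T1 = contact \<phi>" "T2 = contact (\<phi> + \<theta>)" using T unit_dir_cong(2) by metis+
    then show ?thesis using \<omega> vangle_contact[OF assms] by (simp add: P_def)
  next
    case 2
    then have "T1 = contact (\<phi> + \<theta>)" "T2 = contact \<phi>" using T unit_dir_cong(2) by metis+
    then show ?thesis using \<omega> vangle_contact[OF assms] vangle_commute by (simp add: P_def)
  qed
qed

end

section \<open>Change of variables from a rectangle to the plane\<close>

lemma has_integral_rectangle:
  fixes f :: "real \<Rightarrow> real \<Rightarrow> real"
  assumes "continuous_on ({a..b} \<times> {c..d}) (\<lambda>(s, t). f s t)"
  shows "((\<lambda>x::real^2. f (x $ 1) (x $ 2)) has_integral
           integral {a..b} (\<lambda>s. integral {c..d} (f s))) (cbox (vector [a, c]) (vector [b, d]))"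
proof -
  define g :: "real^2 \<Rightarrow> real \<times> real" where "g x = (x $ 1, x $ 2)" for x
  define h :: "real \<times> real \<Rightarrow> real^2" where "h y = vector [fst y, snd y]" for y
  have hg: "h (g x) = x" for x by (simp add: g_def h_def vec_eq_iff forall_2)
  have gh: "g (h y) = y" for y by (simp add: g_def h_def)
  have gc: "g ` cbox u v = cbox (u $ 1, u $ 2) (v $ 1, v $ 2)" for u v
  proof
    show "g ` cbox u v \<subseteq> cbox (u $ 1, u $ 2) (v $ 1, v $ 2)"
      by (auto simp: g_def mem_box_cart forall_2 cbox_Pair_eq)
    show "cbox (u $ 1, u $ 2) (v $ 1, v $ 2) \<subseteq> g ` cbox u v"
    proof
      fix y assume "y \<in> cbox (u $ 1, u $ 2) (v $ 1, v $ 2)"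
      then have "h y \<in> cbox u v" by (auto simp: h_def mem_box_cart forall_2 cbox_Pair_eq)
      then show "y \<in> g ` cbox u v" using gh by (metis imageI)
    qed
  qed
  have hc: "h ` cbox u v = cbox (h u) (h v)" for u v
  proof -
    have "cbox u v = g ` cbox (h u) (h v)" unfolding gc by (simp add: h_def)
    then show ?thesis by (simp add: image_image hg)
  qed
  have content: "measure lborel (g ` cbox u v) = 1 * measure lborel (cbox u v)" for u v
  proof -
    have "cbox u v = {} \<longleftrightarrow> g ` cbox u v = {}" by blast
    then show ?thesis
      unfolding gc content_Pair
      by (auto simp: content_cbox_if_cart UNIV_2 cbox_Pair_eq split: if_splits)
  qed
  have cont: "continuous_on (cbox (a, c) (b, d)) (\<lambda>(s, t). f s t)"
    using assms by (simp add: cbox_Pair_eq)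
  have int: "((\<lambda>(s, t). f s t) has_integral integral {a..b} (\<lambda>s. integral {c..d} (f s))) (cbox (a, c) (b, d))"
    using integrable_integral[OF integrable_continuous[OF cont]]
    unfolding integral_prod_continuous[OF cont] by simp
  have contg: "continuous (at x) g" for x
  proof -
    have "continuous_on UNIV g" unfolding g_def[abs_def] by (intro continuous_intros)
    then show ?thesis by (simp add: continuous_on_eq_continuous_at)
  qed
  have "((\<lambda>x. (\<lambda>(s, t). f s t) (g x)) has_integral (1 / 1) *\<^sub>R integral {a..b} (\<lambda>s. integral {c..d} (f s)))
      (h ` cbox (a, c) (b, d))"
    by (rule has_integral_twiddle[OF zero_less_one hg gh contg _ _ content int]) (use gc hc in blast)+
  then show ?thesis unfolding hc by (simp add: g_def h_def)
qed

lemma has_absolute_integral_change_of_variables_real_valued: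
  fixes f :: "real^'n::{finite,wellorder} \<Rightarrow> real" and g :: "real^'n::_ \<Rightarrow> real^'n::_"
  assumes S: "S \<in> sets lebesgue"
    and der_g: "\<And>x. x \<in> S \<Longrightarrow> (g has_derivative g' x) (at x within S)"
    and inj: "inj_on g S"
  shows "(\<lambda>x. \<bar>det (matrix (g' x))\<bar> * f (g x)) absolutely_integrable_on S \<and>
           integral S (\<lambda>x. \<bar>det (matrix (g' x))\<bar> * f (g x)) = b
     \<longleftrightarrow> f absolutely_integrable_on (g ` S) \<and> integral (g ` S) f = b"
proof -
  have "(\<lambda>x. \<bar>det (matrix (g' x))\<bar> *\<^sub>R (vec (f (g x)) :: real^1)) absolutely_integrable_on S \<and>
           integral S (\<lambda>x. \<bar>det (matrix (g' x))\<bar> *\<^sub>R (vec (f (g x)) :: real^1)) = vec b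
     \<longleftrightarrow> (\<lambda>x. vec (f x) :: real^1) absolutely_integrable_on (g ` S) \<and>
           integral (g ` S) (\<lambda>x. vec (f x) :: real^1) = vec b"
    by (rule has_absolute_integral_change_of_variables[OF assms])
  then show ?thesis by (simp add: absolutely_integrable_on_1_iff integral_on_1_eq)
qed

text \<open>\<open>A\<close> and \<open>B\<close> are the partial derivatives of \<open>\<Phi>\<close>. The integrand \<open>J\<close> has to extend continuously to the
closed rectangle, which gives integrability and the iterated integral at once, although \<open>\<Phi>\<close> may
degenerate on the sides that \<open>T\<close> leaves out. The half-open second side suits angles.\<close>

lemma change_of_variables_rectangle:
  fixes \<Phi> :: "real \<Rightarrow> real \<Rightarrow> real^2" and f :: "real^2 \<Rightarrow> real"
  assumes T: "{a<..<b} \<subseteq> T" "T \<subseteq> {a..b}"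
    and der: "\<And>s t. s \<in> T \<Longrightarrow> t \<in> {c..<d} \<Longrightarrow>
      ((\<lambda>x::real^2. \<Phi> (x $ 1) (x $ 2)) has_derivative (\<lambda>h. h $ 1 *\<^sub>R A s t + h $ 2 *\<^sub>R B s t)) (at (vector [s, t]))"
    and inj: "inj_on (\<lambda>(s, t). \<Phi> s t) (T \<times> {c..<d})"
    and J: "continuous_on ({a..b} \<times> {c..d}) (\<lambda>(s, t). J s t)"
    and J_eq: "\<And>s t. s \<in> T \<Longrightarrow> t \<in> {c..<d} \<Longrightarrow>
      J s t = \<bar>A s t $ 1 * B s t $ 2 - A s t $ 2 * B s t $ 1\<bar> * f (\<Phi> s t)"
  shows "f absolutely_integrable_on ((\<lambda>(s, t). \<Phi> s t) ` (T \<times> {c..<d}))"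
    and "integral ((\<lambda>(s, t). \<Phi> s t) ` (T \<times> {c..<d})) f = integral {a..b} (\<lambda>s. integral {c..d} (J s))"
proof -
  define S where "S = {x::real^2. x $ 1 \<in> T \<and> x $ 2 \<in> {c..<d}}"
  define R :: "(real^2) set" where "R = cbox (vector [a, c]) (vector [b, d])"
  define g where "g x = \<Phi> (x $ 1) (x $ 2)" for x :: "real^2"
  define g' where "g' x = (\<lambda>h::real^2. h $ 1 *\<^sub>R A (x $ 1) (x $ 2) + h $ 2 *\<^sub>R B (x $ 1) (x $ 2))" for x :: "real^2"
  have SR: "S \<subseteq> R" using T by (auto simp: S_def R_def mem_box_cart forall_2)
  have neg: "negligible (R - S)"
  proof (rule negligible_subset)
    show "negligible ({x::real^2. x $ 1 = a} \<union> {x. x $ 1 = b} \<union> {x. x $ 2 = d})"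
      using negligible_standard_hyperplane[of "axis 1 1 :: real^2"]
        negligible_standard_hyperplane[of "axis 2 1 :: real^2"]
      by (intro negligible_Un) (simp_all add: inner_axis)
    show "R - S \<subseteq> {x::real^2. x $ 1 = a} \<union> {x. x $ 1 = b} \<union> {x. x $ 2 = d}"
      using T by (force simp: S_def R_def mem_box_cart forall_2)
  qed
  have S: "S \<in> sets lebesgue"
  proof -
    have "R \<in> sets lebesgue" "R - S \<in> sets lebesgue"
      using neg negligible_iff_null_sets null_setsD2 by (simp add: R_def, blast)
    then have "R - (R - S) \<in> sets lebesgue" by blast
    moreover have "R - (R - S) = S" using SR by blast
    ultimately show ?thesis by simp
  qed
  have img: "(\<lambda>(s, t). \<Phi> s t) ` (T \<times> {c..<d}) = g ` S"
  proof
    show "(\<lambda>(s, t). \<Phi> s t) ` (T \<times> {c..<d}) \<subseteq> g ` S"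
    proof clarify
      fix s t assume "s \<in> T" "t \<in> {c..<d}"
      then show "\<Phi> s t \<in> g ` S"
        by (intro image_eqI[of _ _ "vector [s, t]"]) (auto simp: g_def S_def)
    qed
    show "g ` S \<subseteq> (\<lambda>(s, t). \<Phi> s t) ` (T \<times> {c..<d})"
      by (force simp: g_def S_def)
  qed
  have injg: "inj_on g S"
  proof (rule inj_onI)
    fix x y assume "x \<in> S" "y \<in> S" "g x = g y"
    then have "(x $ 1, x $ 2) = (y $ 1, y $ 2)"
      by (intro inj_onD[OF inj]) (auto simp: g_def S_def)
    then show "x = y" by (simp add: vec_eq_iff forall_2)
  qed
  have derg: "(g has_derivative g' x) (at x within S)" if "x \<in> S" for x
  proof -
    have "vector [x $ 1, x $ 2] = x" by (simp add: vec_eq_iff forall_2)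
    then show ?thesis
      using der[of "x $ 1" "x $ 2"] that
      by (auto simp: g_def[abs_def] g'_def S_def intro: has_derivative_at_withinI)
  qed
  have det: "det (matrix (g' x)) =
      A (x $ 1) (x $ 2) $ 1 * B (x $ 1) (x $ 2) $ 2 - A (x $ 1) (x $ 2) $ 2 * B (x $ 1) (x $ 2) $ 1" for x
    by (simp add: det_2 matrix_def g'_def axis_def mult.commute)
  let ?h = "\<lambda>x::real^2. J (x $ 1) (x $ 2)"
  have h: "(?h has_integral integral {a..b} (\<lambda>s. integral {c..d} (J s))) R"
    unfolding R_def by (rule has_integral_rectangle[OF J])
  have "continuous_on R ?h"
  proof -
    have "continuous_on R (\<lambda>x. (\<lambda>(s, t). J s t) (x $ 1, x $ 2))"
      by (rule continuous_on_compose2[OF J])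
         (auto intro!: continuous_intros simp: R_def mem_box_cart forall_2)
    then show ?thesis by simp
  qed
  then have "?h absolutely_integrable_on R" unfolding R_def by (rule absolutely_integrable_continuous)
  then have hS: "?h absolutely_integrable_on S" by (rule set_integrable_subset[OF _ S SR])
  have iS: "integral S ?h = integral {a..b} (\<lambda>s. integral {c..d} (J s))"
  proof -
    have "integral S ?h = integral R ?h"
      by (rule integral_spike_set; rule negligible_subset[OF neg]; use SR in blast)
    then show ?thesis using integral_unique[OF h] by simp
  qed
  have eq: "?h x = \<bar>det (matrix (g' x))\<bar> * f (g x)" if "x \<in> S" for x
    using J_eq that unfolding det by (auto simp: S_def g_def)
  have "(\<lambda>x. \<bar>det (matrix (g' x))\<bar> * f (g x)) absolutely_integrable_on S \<and>
      integral S (\<lambda>x. \<bar>det (matrix (g' x))\<bar> * f (g x)) = integral {a..b} (\<lambda>s. integral {c..d} (J s))"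
  proof
    show "(\<lambda>x. \<bar>det (matrix (g' x))\<bar> * f (g x)) absolutely_integrable_on S"
      using hS eq by (simp cong: set_integrable_cong)
    show "integral S (\<lambda>x. \<bar>det (matrix (g' x))\<bar> * f (g x)) = integral {a..b} (\<lambda>s. integral {c..d} (J s))"
      using iS eq by (simp cong: integral_cong)
  qed
  then have "f absolutely_integrable_on (g ` S) \<and> integral (g ` S) f = integral {a..b} (\<lambda>s. integral {c..d} (J s))"
    using has_absolute_integral_change_of_variables_real_valued[OF S derg injg] by blast
  then show "f absolutely_integrable_on ((\<lambda>(s, t). \<Phi> s t) ` (T \<times> {c..<d}))"
    "integral ((\<lambda>(s, t). \<Phi> s t) ` (T \<times> {c..<d})) f = integral {a..b} (\<lambda>s. integral {c..d} (J s))"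
    unfolding img by blast+
qed

lemma unit_dir_has_vector_derivative: "(unit_dir has_vector_derivative rot_dir \<phi>) (at \<phi>)"
  and rot_dir_has_vector_derivative: "(rot_dir has_vector_derivative - unit_dir \<phi>) (at \<phi>)"
proof -
  define e1 :: "real^2" where "e1 = vector [1, 0]"
  define e2 :: "real^2" where "e2 = vector [0, 1]"
  have 1: "unit_dir = (\<lambda>x. cos x *\<^sub>R e1 + sin x *\<^sub>R e2)" "rot_dir = (\<lambda>x. (- sin x) *\<^sub>R e1 + cos x *\<^sub>R e2)"
    by (auto simp: vec_eq_iff forall_2 fun_eq_iff e1_def e2_def)
  show "(unit_dir has_vector_derivative rot_dir \<phi>) (at \<phi>)"
    unfolding 1 by (auto intro!: derivative_eq_intros)
  show "(rot_dir has_vector_derivative - unit_dir \<phi>) (at \<phi>)"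
    unfolding 1 by (auto intro!: derivative_eq_intros)
qed

lemma has_derivative_nth2:
  assumes "(f has_vector_derivative f') (at (x $ k))"
  shows "((\<lambda>x::real^2. f (x $ k)) has_derivative (\<lambda>h. h $ k *\<^sub>R f')) (at x)"
proof -
  have "((\<lambda>x::real^2. x $ k) has_derivative (\<lambda>h. h $ k)) (at x)"
    by (rule bounded_linear.has_derivative[OF bounded_linear_vec_nth]) simp
  from has_derivative_compose[OF this, of f "\<lambda>h. h *\<^sub>R f'"] show ?thesis
    using assms by (simp add: has_vector_derivative_def)
qed

section \<open>The integral over the exterior in tangent coordinates\<close>

lemma quadratic_Taylor_bound:
  fixes f f' f'' :: "real \<Rightarrow> real"
  assumes "\<And>x. (f has_real_derivative f' x) (at x)" "\<And>x. (f' has_real_derivative f'' x) (at x)"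
    "f 0 = 0" "f' 0 = 0" "\<And>x. \<bar>f'' x\<bar> \<le> C"
  shows "\<bar>f x\<bar> \<le> C * x\<^sup>2"
proof -
  define D where "D n = (if n = 0 then f else if n = Suc 0 then f' else f'')" for n :: nat
  have "\<exists>t. \<bar>t\<bar> \<le> \<bar>x\<bar> \<and> f x = (\<Sum>m<2. D m 0 / fact m * x ^ m) + D 2 t / fact 2 * x ^ 2"
    by (rule Maclaurin_bi_le) (auto simp: D_def assms less_2_cases_iff)
  then obtain t where t: "f x = f'' t / 2 * x\<^sup>2"
    by (auto simp: D_def assms(3,4) numeral_2_eq_2)
  have "\<bar>f'' t / 2\<bar> \<le> C" using assms(5)[of t] abs_ge_zero[of "f'' t"] by linarith
  then have "\<bar>f'' t / 2\<bar> * \<bar>x\<^sup>2\<bar> \<le> C * \<bar>x\<^sup>2\<bar>" by (rule mult_right_mono) simp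
  then show ?thesis unfolding t abs_mult by simp
qed

lemma periodic_continuous_bounded:
  fixes f :: "real \<Rightarrow> real"
  assumes "continuous_on UNIV f" "\<And>x. f (x + T) = f x" "T > 0"
  obtains C where "\<And>x. \<bar>f x\<bar> \<le> C"
  by (rule periodic_attains_sup[of "\<lambda>x. \<bar>f x\<bar>" T]) (use assms in \<open>auto intro: continuous_intros\<close>)

text \<open>The value of \<open>\<omega>\<^sup>2 - sin\<^sup>2 \<omega>\<close> at \<open>\<omega> = \<pi> - \<theta>\<close>.\<close>

definition weight :: "real \<Rightarrow> real" where
  "weight \<theta> = (pi - \<theta>)\<^sup>2 - (sin \<theta>)\<^sup>2"

lemma weight_nonneg: "0 \<le> \<theta> \<Longrightarrow> \<theta> \<le> pi \<Longrightarrow> 0 \<le> weight \<theta>"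
  using sin_x_le_x[of "pi - \<theta>"] sin_ge_zero[of \<theta>] power_mono[of "sin \<theta>" "pi - \<theta>" 2]
  by (simp add: weight_def)

lemma filterlim_at_left_pi:
  fixes f :: "real \<Rightarrow> real"
  assumes "((\<lambda>x. f (pi - x)) \<longlongrightarrow> l) (at_right 0)"
  shows "(f \<longlongrightarrow> l) (at_left pi)"
proof -
  have "filterlim (\<lambda>x. pi - x) (at_right 0) (at_left pi)"
    by real_asymp
  from filterlim_compose[OF assms this] show ?thesis by simp
qed

lemma weight_limits:
  "((\<lambda>\<theta>. weight \<theta> / sin \<theta>) \<longlongrightarrow> 0) (at_left pi)"
  "((\<lambda>\<theta>. weight \<theta> / (sin \<theta>)\<^sup>2) \<longlongrightarrow> 0) (at_left pi)"
  "((\<lambda>\<theta>. (- 2 * (pi - \<theta>) - 2 * sin \<theta> * cos \<theta>) / sin \<theta>) \<longlongrightarrow> 0) (at_left pi)"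
  "((\<lambda>\<theta>. weight \<theta> * \<theta> ^ 4 / sin \<theta> ^ 3) \<longlongrightarrow> 0) (at_left pi)"
  "((\<lambda>\<theta>. weight \<theta> * \<theta> ^ 4 / sin \<theta> ^ 3) \<longlongrightarrow> 0) (at_right 0)"
proof -
  have sc: "sin (pi - x) = sin x" "cos (pi - x) = - cos x" for x :: real by simp_all
  show "((\<lambda>\<theta>. weight \<theta> / sin \<theta>) \<longlongrightarrow> 0) (at_left pi)"
    by (rule filterlim_at_left_pi, unfold weight_def sc) real_asymp
  show "((\<lambda>\<theta>. weight \<theta> / (sin \<theta>)\<^sup>2) \<longlongrightarrow> 0) (at_left pi)"
    by (rule filterlim_at_left_pi, unfold weight_def sc) real_asymp
  show "((\<lambda>\<theta>. (- 2 * (pi - \<theta>) - 2 * sin \<theta> * cos \<theta>) / sin \<theta>) \<longlongrightarrow> 0) (at_left pi)"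
    by (rule filterlim_at_left_pi, unfold sc) real_asymp
  show "((\<lambda>\<theta>. weight \<theta> * \<theta> ^ 4 / sin \<theta> ^ 3) \<longlongrightarrow> 0) (at_left pi)"
    by (rule filterlim_at_left_pi, unfold weight_def sc) real_asymp
  show "((\<lambda>\<theta>. weight \<theta> * \<theta> ^ 4 / sin \<theta> ^ 3) \<longlongrightarrow> 0) (at_right 0)"
    unfolding weight_def by real_asymp
qed

context support_oval
begin

lemma per'': "q'' (x + 2 * pi) = q'' x"
  using periodic_deriv[OF dq' per'] .

definition ext_d1 :: "real \<Rightarrow> real \<Rightarrow> real^2" where
  "ext_d1 \<theta> \<phi> = (N2 \<theta> \<phi> / (sin \<theta>)\<^sup>2) *\<^sub>R rot_dir \<phi>"

definition ext_d2 :: "real \<Rightarrow> real \<Rightarrow> real^2" where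
  "ext_d2 \<theta> \<phi> = (- N1 \<theta> \<phi> / sin \<theta>) *\<^sub>R unit_dir \<phi> +
      (q \<phi> + (q' (\<phi> + \<theta>) - q' \<phi> * cos \<theta>) / sin \<theta>) *\<^sub>R rot_dir \<phi>"

lemma ext_point_has_derivative:
  assumes "sin \<theta> \<noteq> 0"
  shows "((\<lambda>x::real^2. ext_point (x $ 1) (x $ 2)) has_derivative
           (\<lambda>h. h $ 1 *\<^sub>R ext_d1 \<theta> \<phi> + h $ 2 *\<^sub>R ext_d2 \<theta> \<phi>)) (at (vector [\<theta>, \<phi>]))"
proof -
  define x0 :: "real^2" where "x0 = vector [\<theta>, \<phi>]"
  have x0: "x0 $ 1 = \<theta>" "x0 $ 2 = \<phi>" by (simp_all add: x0_def)
  have du: "((\<lambda>x. unit_dir (x $ 2)) has_derivative (\<lambda>h. h $ 2 *\<^sub>R rot_dir \<phi>)) (at x0)"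
    and dr: "((\<lambda>x. rot_dir (x $ 2)) has_derivative (\<lambda>h. h $ 2 *\<^sub>R - unit_dir \<phi>)) (at x0)"
    using has_derivative_nth2[of _ _ x0 2] unit_dir_has_vector_derivative rot_dir_has_vector_derivative x0
    by metis+
  have dqx: "((\<lambda>x. q (x $ 2)) has_derivative (\<lambda>h. h $ 2 * q' \<phi>)) (at x0)"
    using has_derivative_nth2[of q "q' \<phi>" x0 2] dq[of \<phi>] x0
    by (simp add: has_real_derivative_iff_has_vector_derivative)
  have dc: "((\<lambda>x. cos (x $ 1)) has_derivative (\<lambda>h. h $ 1 * - sin \<theta>)) (at x0)"
    and ds: "((\<lambda>x. sin (x $ 1)) has_derivative (\<lambda>h. h $ 1 * cos \<theta>)) (at x0)"
    using has_derivative_nth2[of cos "- sin \<theta>" x0 1] has_derivative_nth2[of sin "cos \<theta>" x0 1] x0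
      DERIV_cos[of \<theta>] DERIV_sin[of \<theta>]
    by (simp_all add: has_real_derivative_iff_has_vector_derivative)
  have dn: "\<And>k. ((\<lambda>x::real^2. x $ k) has_derivative (\<lambda>h. h $ k)) (at x0)"
    by (rule bounded_linear.has_derivative[OF bounded_linear_vec_nth]) simp
  have dq2: "((\<lambda>x. q (x $ 2 + x $ 1)) has_derivative (\<lambda>h. (h $ 2 + h $ 1) * q' (\<phi> + \<theta>))) (at x0)"
    using DERIV_compose_FDERIV[OF _ has_derivative_add[OF dn dn], of q "q' (\<phi> + \<theta>)" 2 1] dq x0 by simp
  define k where "k = (q (\<phi> + \<theta>) - q \<phi> * cos \<theta>) / sin \<theta>"
  define k' where "k' = (q' (\<phi> + \<theta>) - q' \<phi> * cos \<theta>) / sin \<theta>"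
  have dk: "((\<lambda>x. (q (x $ 2 + x $ 1) - q (x $ 2) * cos (x $ 1)) / sin (x $ 1)) has_derivative
      (\<lambda>h. h $ 1 * (N2 \<theta> \<phi> / (sin \<theta>)\<^sup>2) + h $ 2 * k')) (at x0)"
  proof -
    let ?N = "\<lambda>b a. ((a + b) * q' (\<phi> + \<theta>) - (q \<phi> * (b * - sin \<theta>) + (a * q' \<phi>) * cos \<theta>)) * sin \<theta>
           - (q (\<phi> + \<theta>) - q \<phi> * cos \<theta>) * (b * cos \<theta>)"
    have "((\<lambda>x. (q (x $ 2 + x $ 1) - q (x $ 2) * cos (x $ 1)) / sin (x $ 1)) has_derivative
      (\<lambda>h. ?N (h $ 1) (h $ 2) / (sin \<theta> * sin \<theta>))) (at x0)"
      using has_derivative_divide'[OF has_derivative_diff[OF dq2 has_derivative_mult[OF dqx dc]] ds] assms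
      by (simp add: x0)
    moreover have "?N b a / (sin \<theta> * sin \<theta>) = b * (N2 \<theta> \<phi> / (sin \<theta>)\<^sup>2) + a * k'" for a b
    proof -
      have "?N b a = b * N2 \<theta> \<phi> + a * (q' (\<phi> + \<theta>) - q' \<phi> * cos \<theta>) * sin \<theta>"
        unfolding N2_def using sin_cos_squared_add[of \<theta>] by algebra
      then show ?thesis using assms by (simp add: k'_def power2_eq_square add_divide_distrib)
    qed
    ultimately show ?thesis by simp
  qed
  let ?D = "\<lambda>h::real^2. 0 + (q \<phi> *\<^sub>R (h $ 2 *\<^sub>R rot_dir \<phi>) + (h $ 2 * q' \<phi>) *\<^sub>R unit_dir \<phi>) +
        (k *\<^sub>R (h $ 2 *\<^sub>R - unit_dir \<phi>) + (h $ 1 * (N2 \<theta> \<phi> / (sin \<theta>)\<^sup>2) + h $ 2 * k') *\<^sub>R rot_dir \<phi>)"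
  have "((\<lambda>x. ext_point (x $ 1) (x $ 2)) has_derivative ?D) (at x0)"
    unfolding ext_point_def
    using has_derivative_add[OF has_derivative_add[OF has_derivative_const has_derivative_scaleR[OF dqx du]]
        has_derivative_scaleR[OF dk dr]]
    by (simp add: x0 k_def)
  also have "?D = (\<lambda>h. h $ 1 *\<^sub>R ext_d1 \<theta> \<phi> + h $ 2 *\<^sub>R ext_d2 \<theta> \<phi>)"
  proof
    fix h :: "real^2"
    have "- N1 \<theta> \<phi> / sin \<theta> = q' \<phi> - k" using assms by (simp add: N1_def k_def field_simps)
    then have e2: "ext_d2 \<theta> \<phi> = (q' \<phi> - k) *\<^sub>R unit_dir \<phi> + (q \<phi> + k') *\<^sub>R rot_dir \<phi>"
      by (simp add: ext_d2_def k'_def)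
    show "?D h = h $ 1 *\<^sub>R ext_d1 \<theta> \<phi> + h $ 2 *\<^sub>R ext_d2 \<theta> \<phi>"
      unfolding e2 ext_d1_def by (simp add: vec_eq_iff forall_2 algebra_simps)
  qed
  finally show ?thesis by (simp add: x0_def)
qed

text \<open>Moving \<open>\<theta>\<close> shifts the point along the support line at \<open>\<phi>\<close>, so only the component of \<open>ext_d2\<close> normal
to that line enters.\<close>

lemma ext_jacobian:
  "ext_d1 \<theta> \<phi> $ 1 * ext_d2 \<theta> \<phi> $ 2 - ext_d1 \<theta> \<phi> $ 2 * ext_d2 \<theta> \<phi> $ 1 = N1 \<theta> \<phi> * N2 \<theta> \<phi> / sin \<theta> ^ 3"
proof -
  define a b c where "a = N2 \<theta> \<phi> / (sin \<theta>)\<^sup>2" and "b = - N1 \<theta> \<phi> / sin \<theta>"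
    and "c = q \<phi> + (q' (\<phi> + \<theta>) - q' \<phi> * cos \<theta>) / sin \<theta>"
  have "ext_d1 \<theta> \<phi> $ 1 * ext_d2 \<theta> \<phi> $ 2 - ext_d1 \<theta> \<phi> $ 2 * ext_d2 \<theta> \<phi> $ 1 = - (a * b) * (sin \<phi> * sin \<phi> + cos \<phi> * cos \<phi>)"
  proof -
    have "(a * - S) * (b * S + c * T) - (a * T) * (b * T + c * - S) = - (a * b) * (S * S + T * T)" for S T
      by algebra
    from this[of "sin \<phi>" "cos \<phi>"] show ?thesis
      unfolding ext_d1_def ext_d2_def a_def[symmetric] b_def[symmetric] c_def[symmetric]
      by (simp only: vector_add_component vector_scaleR_component unit_dir_nth rot_dir_nth real_scaleR_def)
  qed
  also have "\<dots> = - (a * b)" using sin_cos_squared_add[of \<phi>] by (simp add: power2_eq_square)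
  also have "\<dots> = N1 \<theta> \<phi> * N2 \<theta> \<phi> / sin \<theta> ^ 3"
    by (simp add: a_def b_def power2_eq_square power3_eq_cube)
  finally show ?thesis .
qed

definition ext_density :: "real \<Rightarrow> real \<Rightarrow> real" where
  "ext_density \<theta> \<phi> = weight \<theta> * N1 \<theta> \<phi> * N2 \<theta> \<phi> / sin \<theta> ^ 3"

text \<open>For fixed \<open>\<phi>\<close> both expressions vanish to second order at \<open>\<theta> = 0\<close>. This tames the factor
\<open>1 / sin\<^sup>3 \<theta>\<close> near the boundary of \<open>K\<close>.\<close>

lemma N_bound:
  obtains C where "C \<ge> 0" "\<And>\<theta> \<phi>. \<bar>N1 \<theta> \<phi>\<bar> \<le> C * \<theta>\<^sup>2" "\<And>\<theta> \<phi>. \<bar>N2 \<theta> \<phi>\<bar> \<le> C * \<theta>\<^sup>2"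
proof -
  have tp: "2 * pi > 0" by simp
  obtain C0 where C0: "\<And>x. \<bar>q x\<bar> \<le> C0" by (rule periodic_continuous_bounded[OF cq per tp]) blast
  obtain C1 where C1: "\<And>x. \<bar>q' x\<bar> \<le> C1" by (rule periodic_continuous_bounded[OF cq' per' tp]) blast
  obtain C2 where C2: "\<And>x. \<bar>q'' x\<bar> \<le> C2" by (rule periodic_continuous_bounded[OF cq'' per'' tp]) blast
  define C where "C = C2 + C0 + C1"
  have n: "\<bar>q (\<phi> + t) - q \<phi> * cos t - q' \<phi> * sin t\<bar> \<le> C * t\<^sup>2" for \<phi> t
  proof (rule quadratic_Taylor_bound[where f = "\<lambda>t. q (\<phi> + t) - q \<phi> * cos t - q' \<phi> * sin t"
        and f' = "\<lambda>t. q' (\<phi> + t) + q \<phi> * sin t - q' \<phi> * cos t"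
        and f'' = "\<lambda>t. q'' (\<phi> + t) + q \<phi> * cos t + q' \<phi> * sin t"])
    fix t
    show "((\<lambda>t. q (\<phi> + t) - q \<phi> * cos t - q' \<phi> * sin t) has_real_derivative
        q' (\<phi> + t) + q \<phi> * sin t - q' \<phi> * cos t) (at t)"
      by (auto intro!: derivative_eq_intros DERIV_compose_shift dq)
    show "((\<lambda>t. q' (\<phi> + t) + q \<phi> * sin t - q' \<phi> * cos t) has_real_derivative
        q'' (\<phi> + t) + q \<phi> * cos t + q' \<phi> * sin t) (at t)"
      by (auto intro!: derivative_eq_intros DERIV_compose_shift dq')
    have "\<bar>q \<phi> * cos t\<bar> \<le> C0 * 1" "\<bar>q' \<phi> * sin t\<bar> \<le> C1 * 1"
      unfolding abs_mult using C0[of \<phi>] C1[of \<phi>] by (intro mult_mono; force)+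
    then show "\<bar>q'' (\<phi> + t) + q \<phi> * cos t + q' \<phi> * sin t\<bar> \<le> C"
      using C2[of "\<phi> + t"] unfolding C_def by linarith
  qed auto
  show ?thesis
  proof (rule that[of C])
    show "0 \<le> C" unfolding C_def using C0[of 0] C1[of 0] C2[of 0] by linarith
    show "\<bar>N1 \<theta> \<phi>\<bar> \<le> C * \<theta>\<^sup>2" for \<theta> \<phi> unfolding N1_def by (rule n)
    show "\<bar>N2 \<theta> \<phi>\<bar> \<le> C * \<theta>\<^sup>2" for \<theta> \<phi> using n[of "\<phi> + \<theta>" "- \<theta>"] by (simp add: N2_def)
  qed
qed

text \<open>At \<open>\<theta> = 0\<close> and \<open>\<theta> = \<pi>\<close> the quotient has the value \<open>0\<close> by the convention on division by zero, and this is
the continuous value: the density is bounded by a multiple of \<open>weight \<theta> \<theta>\<^sup>4 / sin\<^sup>3 \<theta>\<close>, which tends to \<open>0\<close> at both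
ends, at \<open>\<pi>\<close> because the weight vanishes there to fourth order.\<close>

lemma continuous_on_ext_density:
  "continuous_on ({0..pi} \<times> {0..2 * pi}) (\<lambda>(\<theta>, \<phi>). ext_density \<theta> \<phi>)"
proof -
  obtain C where C: "C \<ge> 0" "\<And>\<theta> \<phi>. \<bar>N1 \<theta> \<phi>\<bar> \<le> C * \<theta>\<^sup>2" "\<And>\<theta> \<phi>. \<bar>N2 \<theta> \<phi>\<bar> \<le> C * \<theta>\<^sup>2"
    by (rule N_bound) blast
  define \<kappa> where "\<kappa> \<theta> = weight \<theta> * \<theta> ^ 4 / sin \<theta> ^ 3" for \<theta> :: real
  have bound: "\<bar>ext_density \<theta> \<phi>\<bar> \<le> C\<^sup>2 * \<kappa> \<theta>" if "0 \<le> \<theta>" "\<theta> \<le> pi" for \<theta> \<phi>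
  proof -
    have "\<bar>N1 \<theta> \<phi>\<bar> * \<bar>N2 \<theta> \<phi>\<bar> \<le> (C * \<theta>\<^sup>2) * (C * \<theta>\<^sup>2)"
      by (intro mult_mono C) (use C(1) in auto)
    also have "\<dots> = C\<^sup>2 * \<theta> ^ 4" by (simp add: power2_eq_square power4_eq_xxxx)
    finally have N: "\<bar>N1 \<theta> \<phi> * N2 \<theta> \<phi>\<bar> \<le> C\<^sup>2 * \<theta> ^ 4" by (simp add: abs_mult)
    have w: "0 \<le> weight \<theta> / sin \<theta> ^ 3"
      using weight_nonneg[OF that] sin_ge_zero[OF that] by simp
    have "\<bar>ext_density \<theta> \<phi>\<bar> = weight \<theta> / sin \<theta> ^ 3 * \<bar>N1 \<theta> \<phi> * N2 \<theta> \<phi>\<bar>"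
    proof -
      have "ext_density \<theta> \<phi> = weight \<theta> / sin \<theta> ^ 3 * (N1 \<theta> \<phi> * N2 \<theta> \<phi>)" by (simp add: ext_density_def)
      then show ?thesis by (simp only: abs_mult abs_of_nonneg[OF w])
    qed
    also have "\<dots> \<le> weight \<theta> / sin \<theta> ^ 3 * (C\<^sup>2 * \<theta> ^ 4)"
      by (rule mult_left_mono[OF N w])
    also have "\<dots> = C\<^sup>2 * \<kappa> \<theta>" by (simp add: \<kappa>_def)
    finally show ?thesis .
  qed
  have \<kappa>lim: "(\<kappa> \<longlongrightarrow> 0) (at \<theta> within {0..pi})" if "\<theta> = 0 \<or> \<theta> = pi" for \<theta>
    using that weight_limits(4,5)
    by (auto simp: \<kappa>_def[abs_def] at_within_Icc_at_right at_within_Icc_at_left)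
  show ?thesis
    unfolding continuous_on_def
  proof clarify
    fix \<theta> \<phi> :: real assume \<theta>: "\<theta> \<in> {0..pi}" and \<phi>: "\<phi> \<in> {0..2 * pi}"
    let ?R = "{0..pi} \<times> {0..2 * pi}"
    let ?f = "\<lambda>(\<theta>, \<phi>). ext_density \<theta> \<phi>"
    show "(?f \<longlongrightarrow> ext_density \<theta> \<phi>) (at (\<theta>, \<phi>) within ?R)"
    proof (cases "\<theta> = 0 \<or> \<theta> = pi")
      case True
      have "continuous (at \<theta> within {0..pi}) \<kappa>"
        using \<kappa>lim[OF True] True by (auto simp: continuous_within \<kappa>_def)
      then have "((\<lambda>x. \<kappa> (fst x)) \<longlongrightarrow> \<kappa> \<theta>) (at (\<theta>, \<phi>) within ?R)"
        using continuous_within_compose2[of "(\<theta>, \<phi>)" ?R fst \<kappa>]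
          tendsto_fst[OF tendsto_ident_at, of "(\<theta>, \<phi>)" ?R]
        by (simp add: continuous_within fst_image_times)
      then have "((\<lambda>x. C\<^sup>2 * \<kappa> (fst x)) \<longlongrightarrow> 0) (at (\<theta>, \<phi>) within ?R)"
      proof -
        assume *: "((\<lambda>x. \<kappa> (fst x)) \<longlongrightarrow> \<kappa> \<theta>) (at (\<theta>, \<phi>) within ?R)"
        have "\<kappa> \<theta> = 0" using True by (auto simp: \<kappa>_def)
        then show ?thesis using tendsto_mult_left[OF *, of "C\<^sup>2"] by simp
      qed
      then have "(?f \<longlongrightarrow> 0) (at (\<theta>, \<phi>) within ?R)"
        by (rule Lim_null_comparison[rotated])
           (auto simp: eventually_at_filter bound intro!: always_eventually)
      moreover have "ext_density \<theta> \<phi> = 0" using True by (auto simp: ext_density_def)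
      ultimately show ?thesis by simp
    next
      case False
      then have th: "\<theta> \<in> {0<..<pi}" using \<theta> by auto
      have "continuous_on ({0<..<pi} \<times> UNIV) ?f"
        unfolding case_prod_unfold ext_density_def weight_def N1_def N2_def
        by (intro continuous_intros) (use sin_gt_zero in force)
      then have "isCont ?f (\<theta>, \<phi>)"
        using th by (auto simp: continuous_on_eq_continuous_at open_Times)
      then show ?thesis
        by (auto simp: isCont_def intro: tendsto_within_subset)
    qed
  qed
qed

lemma exterior_integral:
  "(LINT P:-K|lebesgue. (visual_angle K P)\<^sup>2 - (sin (visual_angle K P))\<^sup>2) =
     integral {0..pi} (\<lambda>\<theta>. circ (ext_density \<theta>))"
proof -
  let ?f = "\<lambda>P. (visual_angle K P)\<^sup>2 - (sin (visual_angle K P))\<^sup>2"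
  have sin: "0 < sin \<theta>" if "\<theta> \<in> {0<..<pi}" for \<theta> using sin_gt_zero that by simp
  have J: "ext_density \<theta> \<phi> = \<bar>ext_d1 \<theta> \<phi> $ 1 * ext_d2 \<theta> \<phi> $ 2 - ext_d1 \<theta> \<phi> $ 2 * ext_d2 \<theta> \<phi> $ 1\<bar> * ?f (ext_point \<theta> \<phi>)"
    if "\<theta> \<in> {0<..<pi}" for \<theta> \<phi>
  proof -
    have "?f (ext_point \<theta> \<phi>) = weight \<theta>"
      using visual_angle_ext_point[of \<theta> \<phi>] that by (simp add: weight_def)
    then show ?thesis
      unfolding ext_jacobian ext_density_def using N_nonneg[of \<theta> \<phi>] sin[OF that] by simp
  qed
  have sub: "{0<..<pi} \<subseteq> {0<..<pi}" "{0<..<pi} \<subseteq> {0..pi}" by auto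
  have der: "((\<lambda>x::real^2. ext_point (x $ 1) (x $ 2)) has_derivative
           (\<lambda>h. h $ 1 *\<^sub>R ext_d1 \<theta> \<phi> + h $ 2 *\<^sub>R ext_d2 \<theta> \<phi>)) (at (vector [\<theta>, \<phi>]))"
    if "\<theta> \<in> {0<..<pi}" "\<phi> \<in> {0..<2 * pi}" for \<theta> \<phi>
    by (rule ext_point_has_derivative) (use sin[OF that(1)] in simp)
  note cov = change_of_variables_rectangle[OF sub der ext_point_bij(1) continuous_on_ext_density J, unfolded ext_point_bij(2)]
  show ?thesis using cov set_lebesgue_integral_eq_integral(2)[OF cov(1)] by simp
qed

end

section \<open>Integration by parts in the angle between the normals\<close>

lemma second_order_quotient:
  fixes n n1 :: "real \<Rightarrow> real"
  assumes dn: "\<And>x. (n has_real_derivative n1 x) (at x)" and dn1: "(n1 has_real_derivative c) (at 0)"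
    and n0: "n 0 = 0" "n1 0 = 0"
  shows "((\<lambda>x. n x / x\<^sup>2) \<longlongrightarrow> c / 2) (at_right 0)"
proof (rule lhopital_right_0)
  have n1l: "((\<lambda>x. n1 x / x) \<longlongrightarrow> c) (at_right 0)"
    using dn1 n0(2) by (auto simp: has_field_derivative_iff intro: tendsto_within_subset)
  show "(n \<longlongrightarrow> 0) (at_right 0)"
    using DERIV_isCont[OF dn, of 0] n0 by (auto simp: isCont_def intro: tendsto_within_subset)
  show "((\<lambda>x::real. x\<^sup>2) \<longlongrightarrow> 0) (at_right 0)" by real_asymp
  show "\<forall>\<^sub>F x::real in at_right 0. x\<^sup>2 \<noteq> 0" by (simp add: eventually_at_filter)
  show "\<forall>\<^sub>F x::real in at_right 0. 2 * x \<noteq> 0" by (simp add: eventually_at_filter)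
  show "\<forall>\<^sub>F x in at_right 0. (n has_real_derivative n1 x) (at x)" using dn by simp
  show "\<forall>\<^sub>F x in at_right 0. ((\<lambda>x. x\<^sup>2) has_real_derivative 2 * x) (at x)"
    by (auto intro!: always_eventually derivative_eq_intros)
  have "((\<lambda>x. n1 x / x * (1 / 2)) \<longlongrightarrow> c * (1 / 2)) (at_right 0)"
    by (intro tendsto_intros n1l)
  then show "((\<lambda>x. n1 x / (2 * x)) \<longlongrightarrow> c / 2) (at_right 0)" by (simp add: mult.commute)
qed

context support_oval
begin

text \<open>The autocorrelation of \<open>q\<close> and its first two derivatives.\<close>

definition R0 :: "real \<Rightarrow> real" where "R0 \<theta> = circ (\<lambda>\<phi>. q \<phi> * q (\<phi> + \<theta>))"
definition R1 :: "real \<Rightarrow> real" where "R1 \<theta> = circ (\<lambda>\<phi>. q \<phi> * q' (\<phi> + \<theta>))"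
definition R2 :: "real \<Rightarrow> real" where "R2 \<theta> = circ (\<lambda>\<phi>. q \<phi> * q'' (\<phi> + \<theta>))"

lemma dR0: "(R0 has_real_derivative R1 \<theta>) (at \<theta>)"
  and dR1: "(R1 has_real_derivative R2 \<theta>) (at \<theta>)"
  using DERIV_integral_shift[OF dq cq' cq, of 0 "2 * pi" \<theta>]
    DERIV_integral_shift[OF dq' cq'' cq, of 0 "2 * pi" \<theta>]
  by (simp_all add: R0_def[abs_def] R1_def[abs_def] R2_def add.commute)

lemma shifted_per: "q (x + 2 * pi + t) = q (x + t)" "q' (x + 2 * pi + t) = q' (x + t)"
proof -
  have "x + 2 * pi + t = (x + t) + 2 * pi" by simp
  then show "q (x + 2 * pi + t) = q (x + t)" "q' (x + 2 * pi + t) = q' (x + t)"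
    by (simp_all only: per per')
qed

text \<open>The right-hand side is \<open>sin\<^sup>3 \<theta>\<close> times the second derivative of \<open>(R0 \<theta> - R0 0 cos \<theta>) / sin \<theta>\<close>.\<close>

lemma circ_N1_N2:
  "circ (\<lambda>\<phi>. N1 \<theta> \<phi> * N2 \<theta> \<phi>) =
     (1 + (cos \<theta>)\<^sup>2) * R0 \<theta> - 2 * cos \<theta> * R0 0 - 2 * cos \<theta> * sin \<theta> * R1 \<theta> + (sin \<theta>)\<^sup>2 * R2 \<theta>"
proof -
  have d2: "((\<lambda>x. q (x + \<theta>)) has_real_derivative q' (x + \<theta>)) (at x)"
    "((\<lambda>x. q' (x + \<theta>)) has_real_derivative q'' (x + \<theta>)) (at x)" for x
    by (intro DERIV_compose_shift dq dq')+
  have qq': "circ (\<lambda>x. q x * q' x) = 0"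
  proof -
    have "circ (\<lambda>x. q' x * q x) = - circ (\<lambda>x. q x * q' x)"
      by (rule circ_by_parts) (auto intro: dq cq' per)
    then show ?thesis by (simp add: mult.commute)
  qed
  have 1: "circ (\<lambda>x. q' x * q (x + \<theta>)) = - R1 \<theta>"
    unfolding R1_def by (rule circ_by_parts) (auto intro!: dq cq' per d2 continuous_intros shifted_per)
  have 2: "circ (\<lambda>x. q' x * q' (x + \<theta>)) = - R2 \<theta>"
    unfolding R2_def by (rule circ_by_parts) (auto intro!: dq cq' per d2 continuous_intros shifted_per)
  have 3: "circ (\<lambda>x. q x * q x) = R0 0" by (simp add: R0_def)
  have 4: "circ (\<lambda>x. q (x + \<theta>) * q (x + \<theta>)) = R0 0"
  proof -
    have "circ (\<lambda>x. (\<lambda>y. q y * q y) (x + \<theta>)) = circ (\<lambda>y. q y * q y)"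
      by (rule circ_shift) (auto intro!: continuous_intros simp: per)
    then show ?thesis unfolding 3 by simp
  qed
  have 5: "circ (\<lambda>x. q (x + \<theta>) * q' (x + \<theta>)) = 0"
  proof -
    have "circ (\<lambda>x. (\<lambda>y. q y * q' y) (x + \<theta>)) = circ (\<lambda>y. q y * q' y)"
      by (rule circ_shift) (auto intro!: continuous_intros simp: per per')
    then show ?thesis unfolding qq' by simp
  qed
  let ?c = "cos \<theta>" and ?s = "sin \<theta>"
  let ?f = "\<lambda>x. (1 + ?c\<^sup>2) * (q x * q (x + \<theta>)) + (- ?c) * (q (x + \<theta>) * q (x + \<theta>)) + (- ?c) * (q x * q x)"
  let ?g = "\<lambda>x. ?s * (q (x + \<theta>) * q' (x + \<theta>)) + (- ?s) * (q x * q' x) + (- ?c * ?s) * (q x * q' (x + \<theta>))"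
  let ?h = "\<lambda>x. (?c * ?s) * (q' x * q (x + \<theta>)) + (- (?s\<^sup>2)) * (q' x * q' (x + \<theta>)) + 0 * q x"
  have "N1 \<theta> x * N2 \<theta> x = 1 * ?f x + 1 * ?g x + 1 * ?h x" for x
    unfolding N1_def N2_def by algebra
  then have "circ (\<lambda>x. N1 \<theta> x * N2 \<theta> x) = 1 * circ ?f + 1 * circ ?g + 1 * circ ?h"
    by (simp only:) (rule circ_lin3; intro continuous_intros)
  also have "circ ?f
      = (1 + ?c\<^sup>2) * R0 \<theta> + (- ?c) * circ (\<lambda>x. q (x + \<theta>) * q (x + \<theta>)) + (- ?c) * circ (\<lambda>x. q x * q x)"
    unfolding R0_def by (rule circ_lin3; intro continuous_intros)
  also have "circ ?g
      = ?s * circ (\<lambda>x. q (x + \<theta>) * q' (x + \<theta>)) + (- ?s) * circ (\<lambda>x. q x * q' x) + (- ?c * ?s) * R1 \<theta>"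
    unfolding R1_def by (rule circ_lin3; intro continuous_intros)
  also have "circ ?h
      = (?c * ?s) * circ (\<lambda>x. q' x * q (x + \<theta>)) + (- (?s\<^sup>2)) * circ (\<lambda>x. q' x * q' (x + \<theta>)) + 0 * circ q"
    by (rule circ_lin3; intro continuous_intros)
  finally show ?thesis unfolding 1 2 3 4 5 qq' by (simp add: algebra_simps)
qed

lemma R1_0: "R1 0 = 0"
  using circ_by_parts[OF dq dq cq' cq' per per] by (simp add: R1_def mult.commute)

text \<open>Put \<open>h \<theta> = (R0 \<theta> - R0 0 cos \<theta>) / sin \<theta>\<close>. By \<open>circ_N1_N2\<close> the integrand is \<open>weight h''\<close>, and
\<open>weight'' = 4 sin\<^sup>2\<close>, so \<open>H = weight h' - weight' h\<close> is an antiderivative of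
\<open>weight h'' - 4 sin (R0 - R0 0 cos)\<close>. At \<open>\<theta> = \<pi>\<close> the function \<open>H\<close> vanishes with the weight; at \<open>\<theta> = 0\<close>, where
\<open>R0 \<theta> - R0 0 cos \<theta>\<close> is \<open>(R2 0 + R0 0) \<theta>\<^sup>2 / 2\<close> up to higher order, its limit is \<open>\<pi>\<^sup>2 (R0 0 + R2 0) / 2\<close>.
The remaining integral of \<open>R0 0 sin cos\<close> is zero.\<close>

lemma exterior_integral_by_parts:
  "integral {0..pi} (\<lambda>\<theta>. circ (ext_density \<theta>)) =
     4 * integral {0..pi} (\<lambda>\<theta>. R0 \<theta> * sin \<theta>) - pi\<^sup>2 * (R0 0 + R2 0) / 2"
proof -
  have cR: "continuous_on UNIV R0" "continuous_on UNIV R1"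
    by (rule continuous_of_deriv, rule dR0 dR1)+
  have iR: "isCont R0 x" "isCont R1 x" for x
    using cR by (simp_all add: continuous_on_eq_continuous_at)
  define n where "n \<theta> = R0 \<theta> - R0 0 * cos \<theta>" for \<theta>
  define n1 where "n1 \<theta> = R1 \<theta> + R0 0 * sin \<theta>" for \<theta>
  define n2 where "n2 \<theta> = R2 \<theta> + R0 0 * cos \<theta>" for \<theta>
  have dn: "(n has_real_derivative n1 \<theta>) (at \<theta>)" and dn1: "(n1 has_real_derivative n2 \<theta>) (at \<theta>)" for \<theta>
    unfolding n_def[abs_def] n1_def[abs_def] n2_def by (auto intro!: derivative_eq_intros dR0 dR1)
  have n0: "n 0 = 0" "n1 0 = 0" by (simp_all add: n_def n1_def R1_0)
  define w1 where "w1 \<theta> = - 2 * (pi - \<theta>) - 2 * sin \<theta> * cos \<theta>" for \<theta> :: real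
  have dw: "(weight has_real_derivative w1 \<theta>) (at \<theta>)" for \<theta>
    unfolding weight_def[abs_def] w1_def by (auto intro!: derivative_eq_intros)
  have dw1: "(w1 has_real_derivative 4 * (sin \<theta>)\<^sup>2) (at \<theta>)" for \<theta>
  proof -
    have "(w1 has_real_derivative 2 - 2 * (cos \<theta> * cos \<theta> - sin \<theta> * sin \<theta>)) (at \<theta>)"
      unfolding w1_def[abs_def] by (auto intro!: derivative_eq_intros)
    moreover have "2 - 2 * (cos \<theta> * cos \<theta> - sin \<theta> * sin \<theta>) = 4 * (sin \<theta>)\<^sup>2"
      using sin_cos_squared_add[of \<theta>] by algebra
    ultimately show ?thesis by simp
  qed
  define h where "h \<theta> = n \<theta> / sin \<theta>" for \<theta>
  define h1 where "h1 \<theta> = n1 \<theta> / sin \<theta> - n \<theta> * cos \<theta> / (sin \<theta>)\<^sup>2" for \<theta>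
  \<comment> \<open>Division by zero gives \<open>H\<close> its correct value at \<open>\<pi>\<close>, but not at \<open>0\<close>.\<close>
  define H where "H \<theta> = (if \<theta> = 0 then pi\<^sup>2 * (R0 0 + R2 0) / 2 else weight \<theta> * h1 \<theta> - w1 \<theta> * h \<theta>)" for \<theta>
  define r where "r \<theta> = circ (ext_density \<theta>) - 4 * (R0 \<theta> * sin \<theta>) + 4 * R0 0 * (sin \<theta> * cos \<theta>)" for \<theta>
  have sin: "sin \<theta> > 0" if "\<theta> \<in> {0<..<pi}" for \<theta> using sin_gt_zero that by simp
  have dH: "(H has_real_derivative r \<theta>) (at \<theta>)" if th: "\<theta> \<in> {0<..<pi}" for \<theta>
  proof -
    let ?c = "cos \<theta>" and ?s = "sin \<theta>"
    have s0: "?s \<noteq> 0" using sin[OF th] by simp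
    have sc: "?s\<^sup>2 + ?c\<^sup>2 = 1" by simp
    have dh: "(h has_real_derivative h1 \<theta>) (at \<theta>)"
      unfolding h_def[abs_def] h1_def
      by (rule derivative_eq_intros dn refl s0)+ (use s0 in \<open>simp add: field_simps power2_eq_square\<close>)
    define h2 where "h2 = circ (\<lambda>\<phi>. N1 \<theta> \<phi> * N2 \<theta> \<phi>) / ?s ^ 3"
    have dh1: "(h1 has_real_derivative h2) (at \<theta>)"
    proof -
      have "(h1 has_real_derivative (n2 \<theta> * ?s - n1 \<theta> * ?c) / (?s * ?s) -
          ((n1 \<theta> * ?c + n \<theta> * - ?s) * ?s\<^sup>2 - n \<theta> * ?c * (2 * ?s * ?c)) / (?s\<^sup>2 * ?s\<^sup>2)) (at \<theta>)"
        unfolding h1_def[abs_def]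
        by (rule derivative_eq_intros dn dn1 refl | simp add: s0)+
      also have "(n2 \<theta> * ?s - n1 \<theta> * ?c) / (?s * ?s) -
          ((n1 \<theta> * ?c + n \<theta> * - ?s) * ?s\<^sup>2 - n \<theta> * ?c * (2 * ?s * ?c)) / (?s\<^sup>2 * ?s\<^sup>2) =
          ((n2 \<theta> * ?s - n1 \<theta> * ?c) * ?s - (n1 \<theta> * ?c - n \<theta> * ?s) * ?s + 2 * n \<theta> * ?c\<^sup>2) / ?s ^ 3"
        using s0 by (simp add: field_simps power2_eq_square power3_eq_cube)
      also have "(n2 \<theta> * ?s - n1 \<theta> * ?c) * ?s - (n1 \<theta> * ?c - n \<theta> * ?s) * ?s + 2 * n \<theta> * ?c\<^sup>2 =
          circ (\<lambda>\<phi>. N1 \<theta> \<phi> * N2 \<theta> \<phi>)"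
        unfolding circ_N1_N2 n_def n1_def n2_def using sc by algebra
      finally show ?thesis unfolding h2_def .
    qed
    have d: "((\<lambda>\<theta>. weight \<theta> * h1 \<theta> - w1 \<theta> * h \<theta>) has_real_derivative
        (weight \<theta> * h2 + w1 \<theta> * h1 \<theta>) - (w1 \<theta> * h1 \<theta> + 4 * ?s\<^sup>2 * h \<theta>)) (at \<theta>)"
      by (rule derivative_eq_intros dw dw1 dh dh1 refl | simp)+
    have e1: "4 * ?s\<^sup>2 * h \<theta> = 4 * (R0 \<theta> * ?s) - 4 * R0 0 * (?s * ?c)"
      using s0 by (simp add: h_def n_def power2_eq_square field_simps)
    have e2: "weight \<theta> * h2 = circ (ext_density \<theta>)"
    proof -
      have "ext_density \<theta> = (\<lambda>\<phi>. (weight \<theta> / ?s ^ 3) * (N1 \<theta> \<phi> * N2 \<theta> \<phi>))"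
        by (simp add: ext_density_def fun_eq_iff)
      then show ?thesis unfolding h2_def by (simp only: circ_cmult) simp
    qed
    have "(weight \<theta> * h2 + w1 \<theta> * h1 \<theta>) - (w1 \<theta> * h1 \<theta> + 4 * ?s\<^sup>2 * h \<theta>) = r \<theta>"
      unfolding e1 e2 r_def by simp
    with d have "((\<lambda>\<theta>. weight \<theta> * h1 \<theta> - w1 \<theta> * h \<theta>) has_real_derivative r \<theta>) (at \<theta>)"
      by simp
    moreover have "\<forall>\<^sub>F x in nhds \<theta>. H x = weight x * h1 x - w1 x * h x"
    proof -
      have "\<forall>\<^sub>F x in nhds \<theta>. x \<in> {0<..<pi}" using th by (intro eventually_nhds_in_open) auto
      then show ?thesis by eventually_elim (simp add: H_def)
    qed
    ultimately show ?thesis by (simp cong: DERIV_cong_ev)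
  qed
  have contH: "continuous_on {0..pi} H"
  proof (rule continuous_on_eq_continuous_within[THEN iffD2], rule ballI)
    fix \<theta> :: real assume "\<theta> \<in> {0..pi}"
    then consider "\<theta> \<in> {0<..<pi}" | "\<theta> = 0" | "\<theta> = pi" by force
    then show "continuous (at \<theta> within {0..pi}) H"
    proof cases
      case 1
      then show ?thesis using DERIV_isCont[OF dH] continuous_at_imp_continuous_at_within by blast
    next
      case 2
      have s1: "((\<lambda>x::real. sin x / x) \<longlongrightarrow> 1) (at_right 0)" "((\<lambda>x::real. x / sin x) \<longlongrightarrow> 1) (at_right 0)"
        by real_asymp+
      have n1l: "((\<lambda>x. n1 x / x) \<longlongrightarrow> n2 0) (at_right 0)"
        using dn1[of 0] n0(2) by (auto simp: has_field_derivative_iff intro: tendsto_within_subset)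
      have nl: "((\<lambda>x. n x / x\<^sup>2) \<longlongrightarrow> n2 0 / 2) (at_right 0)"
        by (rule second_order_quotient[OF dn dn1 n0])
      let ?G = "\<lambda>x. weight x * (n1 x / x * (x / sin x) - n x / x\<^sup>2 * (x / sin x)\<^sup>2 * cos x) -
             w1 x * (n x / x\<^sup>2 * (x / sin x) * x)"
      let ?l = "weight 0 * (n2 0 * 1 - n2 0 / 2 * 1\<^sup>2 * 1) - w1 0 * (n2 0 / 2 * 1 * 0)"
      have lim: "(?G \<longlongrightarrow> ?l) (at_right 0)"
      proof -
        have gen: "((\<lambda>x. W x * (A x * S x - B x * (S x)\<^sup>2 * c x) - V x * (B x * S x * x)) \<longlongrightarrow>
            w * (n2 0 * 1 - n2 0 / 2 * 1\<^sup>2 * 1) - v * (n2 0 / 2 * 1 * 0)) (at_right 0)"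
          if "(A \<longlongrightarrow> n2 0) (at_right 0)" "(B \<longlongrightarrow> n2 0 / 2) (at_right 0)" "(S \<longlongrightarrow> 1) (at_right 0)"
            "(W \<longlongrightarrow> w) (at_right 0)" "(V \<longlongrightarrow> v) (at_right 0)" "(c \<longlongrightarrow> 1) (at_right 0)"
          for A B S W V c :: "real \<Rightarrow> real" and w v
          by (intro tendsto_intros that)
        have ww: "(weight \<longlongrightarrow> weight 0) (at_right 0)" "(w1 \<longlongrightarrow> w1 0) (at_right 0)"
          using DERIV_isCont[OF dw, of 0] DERIV_isCont[OF dw1, of 0]
          by (auto simp: isCont_def intro: tendsto_within_subset)
        have cos1: "(cos \<longlongrightarrow> (1::real)) (at_right 0)" by real_asymp
        show ?thesis by (rule gen[OF n1l nl s1(2) ww cos1])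
      qed
      moreover have "\<forall>\<^sub>F x in at_right 0. ?G x = H x"
      proof -
        have "\<forall>\<^sub>F x::real in at_right 0. x > 0" by (simp add: eventually_at_filter)
        then show ?thesis
          by eventually_elim (simp add: H_def h1_def h_def power_divide power2_eq_square)
      qed
      ultimately have "(H \<longlongrightarrow> ?l) (at_right 0)"
        by (rule Lim_transform_eventually)
      moreover have "?l = H 0"
        by (simp add: H_def weight_def n2_def field_simps)
      ultimately show ?thesis using 2 by (simp add: continuous_within at_within_Icc_at_right)
    next
      case 3
      have c: "(n \<longlongrightarrow> n pi) (at_left pi)" "(n1 \<longlongrightarrow> n1 pi) (at_left pi)" "(cos \<longlongrightarrow> cos pi) (at_left pi)"
        using DERIV_isCont[OF dn, of pi] DERIV_isCont[OF dn1, of pi] isCont_cos[of pi]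
        by (auto simp: isCont_def intro: tendsto_within_subset)
      have "((\<lambda>x. weight x / sin x * n1 x - weight x / (sin x)\<^sup>2 * (n x * cos x) - w1 x / sin x * n x) \<longlongrightarrow>
          0 * n1 pi - 0 * (n pi * cos pi) - 0 * n pi) (at_left pi)"
      proof -
        have gen: "((\<lambda>x. A x * n1 x - B x * (n x * cos x) - V x * n x) \<longlongrightarrow>
            0 * n1 pi - 0 * (n pi * cos pi) - 0 * n pi) (at_left pi)"
          if "(A \<longlongrightarrow> 0) (at_left pi)" "(B \<longlongrightarrow> 0) (at_left pi)" "(V \<longlongrightarrow> 0) (at_left pi)"
          for A B V :: "real \<Rightarrow> real"
          by (intro tendsto_intros that c)
        show ?thesis by (rule gen[OF weight_limits(1,2) weight_limits(3)[folded w1_def]])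
      qed
      moreover have "\<forall>\<^sub>F x in at_left pi. weight x / sin x * n1 x - weight x / (sin x)\<^sup>2 * (n x * cos x) - w1 x / sin x * n x = H x"
      proof -
        have "\<forall>\<^sub>F x in at_left pi. x > 0"
          using eventually_at_left_real[OF pi_gt_zero] by (rule eventually_mono) simp
        then show ?thesis
          by eventually_elim (simp add: H_def h1_def h_def algebra_simps)
      qed
      ultimately have "(H \<longlongrightarrow> 0 * n1 pi - 0 * (n pi * cos pi) - 0 * n pi) (at_left pi)"
        by (rule Lim_transform_eventually)
      moreover have "H pi = 0" by (simp add: H_def h1_def h_def)
      ultimately show ?thesis using 3 by (simp add: continuous_within at_within_Icc_at_left)
    qed
  qed
  have ri: "(r has_integral H pi - H 0) {0..pi}"
    by (rule fundamental_theorem_of_calculus_interior)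
       (use contH dH in \<open>auto simp: has_real_derivative_iff_has_vector_derivative\<close>)
  have H: "H pi = 0" "H 0 = pi\<^sup>2 * (R0 0 + R2 0) / 2"
    by (simp_all add: H_def h1_def h_def)
  have i1: "((\<lambda>\<theta>. R0 \<theta> * sin \<theta>) has_integral integral {0..pi} (\<lambda>\<theta>. R0 \<theta> * sin \<theta>)) {0..pi}"
    by (intro integrable_integral integrable_continuous_real continuous_intros continuous_on_subset[OF cR(1)]) auto
  have i2: "((\<lambda>\<theta>. sin \<theta> * cos \<theta>) has_integral (sin pi)\<^sup>2 / 2 - (sin 0)\<^sup>2 / 2) {0..pi}"
    by (rule integral_eq_diff) (auto intro!: derivative_eq_intros)
  have "((\<lambda>\<theta>. r \<theta> + 4 * (R0 \<theta> * sin \<theta>) - 4 * R0 0 * (sin \<theta> * cos \<theta>)) has_integral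
      (H pi - H 0) + 4 * integral {0..pi} (\<lambda>\<theta>. R0 \<theta> * sin \<theta>) - 4 * R0 0 * ((sin pi)\<^sup>2 / 2 - (sin 0)\<^sup>2 / 2)) {0..pi}"
    by (intro has_integral_add has_integral_diff has_integral_mult_right ri i1 i2)
  then have "((\<lambda>\<theta>. circ (ext_density \<theta>)) has_integral
      4 * integral {0..pi} (\<lambda>\<theta>. R0 \<theta> * sin \<theta>) - pi\<^sup>2 * (R0 0 + R2 0) / 2) {0..pi}"
    by (simp add: r_def H)
  then show ?thesis by (rule integral_unique)
qed

end

section \<open>The area of the body and of its pedal region\<close>

text \<open>The parametrisation \<open>s + t C(\<phi>)\<close> has Jacobian \<open>t w(\<phi>)\<close>, and \<open>t\<close> integrates to \<open>1/2\<close>. The set \<open>T\<close>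
may contain its upper end or not, because \<open>K\<close> is swept with the curve included and the pedal region without it.\<close>

lemma star_area:
  fixes C C' :: "real \<Rightarrow> real^2"
  assumes dC: "\<And>\<phi>. (C has_vector_derivative C' \<phi>) (at \<phi>)"
    and w: "\<And>\<phi>. C \<phi> $ 1 * C' \<phi> $ 2 - C \<phi> $ 2 * C' \<phi> $ 1 = w \<phi>" "\<And>\<phi>. 0 \<le> w \<phi>" "continuous_on UNIV w"
    and T: "{0<..<1} \<subseteq> T" "T \<subseteq> {0..1}"
    and inj: "inj_on (\<lambda>(t, \<phi>). s + t *\<^sub>R C \<phi>) (T \<times> {0..<2 * pi})"
  shows "(\<lambda>(t, \<phi>). s + t *\<^sub>R C \<phi>) ` (T \<times> {0..<2 * pi}) \<in> lmeasurable"
    and "measure lebesgue ((\<lambda>(t, \<phi>). s + t *\<^sub>R C \<phi>) ` (T \<times> {0..<2 * pi})) = circ w / 2"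
proof -
  let ?X = "(\<lambda>(t, \<phi>). s + t *\<^sub>R C \<phi>) ` (T \<times> {0..<2 * pi})"
  have der: "((\<lambda>x::real^2. s + x $ 1 *\<^sub>R C (x $ 2)) has_derivative
      (\<lambda>h. h $ 1 *\<^sub>R C \<phi> + h $ 2 *\<^sub>R (t *\<^sub>R C' \<phi>))) (at (vector [t, \<phi>]))" for t \<phi>
  proof -
    have dn: "((\<lambda>x::real^2. x $ 1) has_derivative (\<lambda>h. h $ 1)) (at (vector [t, \<phi>]))"
      by (rule bounded_linear.has_derivative[OF bounded_linear_vec_nth]) simp
    have "((\<lambda>x::real^2. C (x $ 2)) has_derivative (\<lambda>h. h $ 2 *\<^sub>R C' \<phi>)) (at (vector [t, \<phi>]))"
      using dC[of \<phi>] by (intro has_derivative_nth2) simp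
    from has_derivative_add[OF has_derivative_const[of s] has_derivative_scaleR[OF dn this]]
    show ?thesis by (simp add: algebra_simps)
  qed
  have J: "t * w \<phi> = \<bar>C \<phi> $ 1 * (t *\<^sub>R C' \<phi>) $ 2 - C \<phi> $ 2 * (t *\<^sub>R C' \<phi>) $ 1\<bar> * 1"
    if "t \<in> T" "\<phi> \<in> {0..<2 * pi}" for t \<phi>
  proof -
    have "C \<phi> $ 1 * (t *\<^sub>R C' \<phi>) $ 2 - C \<phi> $ 2 * (t *\<^sub>R C' \<phi>) $ 1 = t * w \<phi>"
      by (simp add: w(1)[symmetric] algebra_simps)
    moreover have "t * w \<phi> \<ge> 0" using that T w(2) by auto
    ultimately show ?thesis by simp
  qed
  have cont: "continuous_on ({0..1} \<times> {0..2 * pi}) (\<lambda>(t, \<phi>). t * w \<phi>)"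
    unfolding case_prod_unfold
    by (intro continuous_intros continuous_on_compose2[OF w(3) _ subset_UNIV])
  note cov = change_of_variables_rectangle[OF T der inj cont J]
  have "(\<lambda>x. 1::real) absolutely_integrable_on ?X" by (rule cov(1))
  then show lm: "?X \<in> lmeasurable"
    unfolding lmeasurable_iff_integrable_on by (rule set_lebesgue_integral_eq_integral(1))
  have "integral ?X (\<lambda>x. 1) = integral {0..1} (\<lambda>t. integral {0..2 * pi} (\<lambda>\<phi>. t * w \<phi>))"
    by (rule cov(2))
  also have "\<dots> = integral {0..1} (\<lambda>t. t) * circ w" by simp
  also have "integral {0..1} (\<lambda>t. t) = (1::real)\<^sup>2 / 2 - 0\<^sup>2 / 2"
    by (rule integral_eq_diff) (auto intro!: derivative_eq_intros)
  finally show "measure lebesgue ?X = circ w / 2" using lmeasure_integral[OF lm] by simp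
qed

lemma measure_insert_lebesgue:
  fixes S :: "'a::euclidean_space set"
  assumes "S \<in> lmeasurable"
  shows "measure lebesgue (insert x S) = measure lebesgue S"
  by (rule measure_negligible_symdiff[OF assms]) (rule negligible_subset[of "{x}"], auto)

lemma polar_unique:
  assumes "r *\<^sub>R unit_dir a = t *\<^sub>R unit_dir b" "0 \<le> r" "0 \<le> t"
  shows "r = t" "r \<noteq> 0 \<Longrightarrow> unit_dir a = unit_dir b"
proof -
  have "norm (r *\<^sub>R unit_dir a) = norm (t *\<^sub>R unit_dir b)" using assms(1) by simp
  then show "r = t" using assms(2,3) by simp
  then show "r \<noteq> 0 \<Longrightarrow> unit_dir a = unit_dir b" using assms(1) by simp
qed

context support_oval
begin

text \<open>\<open>q + q''\<close> is the second derivative at \<open>\<theta> = 0\<close> of \<open>N1\<close>, which is nonnegative and vanishes to second order.\<close>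

lemma curvature_radius_nonneg: "0 \<le> q \<phi> + q'' \<phi>"
proof -
  define n where "n t = q (\<phi> + t) - q \<phi> * cos t - q' \<phi> * sin t" for t
  define n1 where "n1 t = q' (\<phi> + t) + q \<phi> * sin t - q' \<phi> * cos t" for t
  have dn: "(n has_real_derivative n1 t) (at t)" for t
    unfolding n_def[abs_def] n1_def by (auto intro!: derivative_eq_intros DERIV_compose_shift dq)
  have dn1: "(n1 has_real_derivative q'' \<phi> + q \<phi>) (at 0)"
    unfolding n1_def[abs_def] by (rule derivative_eq_intros DERIV_compose_shift dq' refl | simp)+
  have "((\<lambda>t. n t / t\<^sup>2) \<longlongrightarrow> (q'' \<phi> + q \<phi>) / 2) (at_right 0)"
    by (rule second_order_quotient[OF dn dn1]) (simp_all add: n_def n1_def)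
  moreover have "n t \<ge> 0" for t using N_nonneg(1)[of t \<phi>] by (simp add: n_def N1_def)
  ultimately have "0 \<le> (q'' \<phi> + q \<phi>) / 2"
    by (intro tendsto_lowerbound[of _ _ "at_right 0"]) auto
  then show ?thesis by simp
qed

lemma unit_dir_inj_on: "a \<in> {0..<2 * pi} \<Longrightarrow> b \<in> {0..<2 * pi} \<Longrightarrow> unit_dir a = unit_dir b \<Longrightarrow> a = b"
  by (rule unit_dir_inj) auto

text \<open>The contact points \<open>s + C(\<phi>)\<close> have velocity \<open>(q + q'') rot_dir \<phi>\<close>, so the cross product is \<open>q (q + q'')\<close>.
Each point of \<open>K\<close> other than \<open>s\<close> is \<open>s + t C(\<phi>)\<close> for exactly one \<open>(t, \<phi>)\<close>: \<open>t\<close> is the gauge of the point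
with respect to \<open>K - s\<close>, the maximum of \<open>((x - s) \<bullet> u \<psi>) / q \<psi>\<close>, and \<open>\<phi>\<close> is where it is attained.\<close>

lemma area_K: "measure lebesgue K = circ (\<lambda>\<phi>. q \<phi> * (q \<phi> + q'' \<phi>)) / 2"
proof -
  define C where "C \<phi> = q \<phi> *\<^sub>R unit_dir \<phi> + q' \<phi> *\<^sub>R rot_dir \<phi>" for \<phi>
  have Cc: "contact \<phi> = s + C \<phi>" for \<phi> by (simp add: contact_def C_def)
  define C' where "C' \<phi> = (q \<phi> + q'' \<phi>) *\<^sub>R rot_dir \<phi>" for \<phi>
  have dC: "(C has_vector_derivative C' \<phi>) (at \<phi>)" for \<phi>
  proof -
    have "(C has_vector_derivative (q \<phi> *\<^sub>R rot_dir \<phi> + q' \<phi> *\<^sub>R unit_dir \<phi>) +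
        (q' \<phi> *\<^sub>R - unit_dir \<phi> + q'' \<phi> *\<^sub>R rot_dir \<phi>)) (at \<phi>)"
      unfolding C_def[abs_def]
      by (intro has_vector_derivative_add has_vector_derivative_scaleR
          unit_dir_has_vector_derivative rot_dir_has_vector_derivative dq dq')
    then show ?thesis by (simp add: C'_def algebra_simps)
  qed
  have w: "C \<phi> $ 1 * C' \<phi> $ 2 - C \<phi> $ 2 * C' \<phi> $ 1 = q \<phi> * (q \<phi> + q'' \<phi>)" for \<phi>
  proof -
    have "(a * c + b * - s) * (d * c) - (a * s + b * c) * (d * - s) = a * d * (s\<^sup>2 + c\<^sup>2)" for a b c d s :: real
      by algebra
    from this[of "q \<phi>" "cos \<phi>" "q' \<phi>" "sin \<phi>" "q \<phi> + q'' \<phi>"] show ?thesis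
      by (simp add: C_def C'_def)
  qed
  have w0: "0 \<le> q \<phi> * (q \<phi> + q'' \<phi>)" for \<phi>
    using curvature_radius_nonneg[of \<phi>] pos[of \<phi>] by simp
  have cw: "continuous_on UNIV (\<lambda>\<phi>. q \<phi> * (q \<phi> + q'' \<phi>))"
    by (intro continuous_intros cq cq'')
  have T: "{0<..<1} \<subseteq> {0<..(1::real)}" "{0<..(1::real)} \<subseteq> {0..1}" by auto
  have le: "t \<le> t'" if "s + t *\<^sub>R C \<phi> = s + t' *\<^sub>R C \<psi>" "0 \<le> t'" for t t' \<phi> \<psi>
  proof -
    have "t * q \<phi> = (t *\<^sub>R C \<phi>) \<bullet> unit_dir \<phi>" by (simp add: C_def inner_add_left)
    also have "\<dots> = t' * ((contact \<psi> - s) \<bullet> unit_dir \<phi>)" using that(1) by (simp add: Cc)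
    also have "\<dots> \<le> t' * q \<phi>" using K_le[OF contact_in] that(2) by (intro mult_left_mono)
    finally show ?thesis using pos[of \<phi>] by simp
  qed
  have inj: "inj_on (\<lambda>(t, \<phi>). s + t *\<^sub>R C \<phi>) ({0<..1} \<times> {0..<2 * pi})"
  proof (rule inj_onI, clarify)
    fix t \<phi> t' \<psi> :: real
    assume t: "t \<in> {0<..1}" "t' \<in> {0<..1}" and \<phi>: "\<phi> \<in> {0..<2 * pi}" "\<psi> \<in> {0..<2 * pi}"
      and eq: "s + t *\<^sub>R C \<phi> = s + t' *\<^sub>R C \<psi>"
    have tt: "t = t'" using le[OF eq] le[OF eq[symmetric]] t by force
    then have "contact \<phi> = contact \<psi>" using eq t by (simp add: Cc)
    then show "t = t' \<and> \<phi> = \<psi>" using contact_inj' unit_dir_inj_on \<phi> tt by blast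
  qed
  note area = star_area[OF dC w w0 cw T inj]
  let ?X = "(\<lambda>(t, \<phi>). s + t *\<^sub>R C \<phi>) ` ({0<..1} \<times> {0..<2 * pi})"
  have "K = insert s ?X"
  proof
    have "s + t *\<^sub>R C \<phi> \<in> K" if "0 \<le> t" "t \<le> 1" for t \<phi>
    proof -
      have "t * ((contact \<phi> - s) \<bullet> unit_dir \<psi>) \<le> q \<psi>" for \<psi>
      proof -
        have "t * ((contact \<phi> - s) \<bullet> unit_dir \<psi>) \<le> t * q \<psi>"
          using K_le[OF contact_in] that(1) by (intro mult_left_mono)
        also have "\<dots> \<le> 1 * q \<psi>" using that pos[of \<psi>] by (intro mult_right_mono) auto
        finally show ?thesis by simp
      qed
      then show ?thesis by (simp add: K_eq Cc)
    qed
    moreover have "s \<in> K" using pos by (simp add: K_eq less_imp_le)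
    ultimately show "insert s ?X \<subseteq> K" by auto
    show "K \<subseteq> insert s ?X"
    proof
      fix x assume x: "x \<in> K"
      show "x \<in> insert s ?X"
      proof (cases "x = s")
        case False
        define g where "g \<psi> = ((x - s) \<bullet> unit_dir \<psi>) / q \<psi>" for \<psi>
        have "continuous_on UNIV g"
          unfolding g_def[abs_def] inner_unit_dir
          by (intro continuous_intros cq) (use pos less_imp_neq in \<open>auto, force\<close>)
        moreover have "g (\<psi> + 2 * pi) = g \<psi>" for \<psi>
          by (simp add: g_def per inner_unit_dir)
        ultimately obtain a where a: "0 \<le> a" "a < 2 * pi" "\<And>\<psi>. g \<psi> \<le> g a"
          using periodic_attains_sup[of g "2 * pi"] by auto
        obtain r b where b: "0 \<le> b" "b < 2 * pi" "x - s = r *\<^sub>R unit_dir b" "r = norm (x - s)"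
          using polar_decomposition[of "x - s"] by metis
        have "(x - s) \<bullet> unit_dir b = r" by (subst b(3)) simp
        moreover have "r > 0" using b(4) False by simp
        ultimately have gb: "g b > 0" using pos[of b] by (simp add: g_def)
        define m where "m = g a"
        have m0: "m > 0" using gb a(3)[of b] by (simp add: m_def)
        have m1: "m \<le> 1" using K_le[OF x, of a] pos[of a] by (simp add: m_def g_def)
        \<comment> \<open>The boundary point on the ray from \<open>s\<close> through \<open>x\<close>.\<close>
        define y where "y = s + (1 / m) *\<^sub>R (x - s)"
        have y\<psi>: "(y - s) \<bullet> unit_dir \<psi> = g \<psi> / m * q \<psi>" for \<psi>
          using pos[of \<psi>] by (simp add: y_def g_def)
        have "g \<psi> / m * q \<psi> \<le> 1 * q \<psi>" for \<psi>
          using a(3)[of \<psi>] m0 pos[of \<psi>] unfolding m_def by (intro mult_right_mono) auto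
        then have yK: "y \<in> K" by (simp add: K_eq y\<psi>)
        have "touches y a" using m0 by (simp add: touches_def y\<psi>) (simp add: m_def)
        then have "y = contact a" by (rule touching_point_unique[OF yK])
        then have "C a = (1 / m) *\<^sub>R (x - s)" by (simp add: y_def Cc)
        then have "x = s + m *\<^sub>R C a" using m0 by simp
        then show ?thesis using m0 m1 a(1,2) by (auto intro!: image_eqI[of _ _ "(m, a)"])
      qed simp
    qed
  qed
  then show "measure lebesgue K = circ (\<lambda>\<phi>. q \<phi> * (q \<phi> + q'' \<phi>)) / 2"
    using area(2) measure_insert_lebesgue[OF area(1)] by simp
qed

text \<open>The points inside the pedal curve form the star-shaped set \<open>D\<close>. It is open because its complement
consists of the points \<open>x\<close>, at least the minimum of \<open>q\<close> away from \<open>s\<close>, for which the disc with diameter from \<open>s\<close> to \<open>z\<close> does not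
contain \<open>x\<close> in its interior for any \<open>z \<in> K\<close>: an intersection of closed sets. From a point beyond the curve the ray
away from \<open>s\<close> escapes to infinity.\<close>

lemma pedal_area_eq:
  "measure lebesgue (inside ((\<lambda>\<phi>. s + q \<phi> *\<^sub>R unit_dir \<phi>) ` {0..2 * pi})) = circ (\<lambda>\<phi>. (q \<phi>)\<^sup>2) / 2"
proof -
  define \<Gamma> where "\<Gamma> = (\<lambda>\<phi>. s + q \<phi> *\<^sub>R unit_dir \<phi>) ` {0..2 * pi}"
  define D where "D = {x. \<exists>r \<phi>. 0 \<le> \<phi> \<and> \<phi> < 2 * pi \<and> 0 \<le> r \<and> r < q \<phi> \<and> x = s + r *\<^sub>R unit_dir \<phi>}"
  have notD: "s + r *\<^sub>R unit_dir \<phi> \<notin> D" if "q \<phi> \<le> r" for r \<phi>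
  proof
    assume "s + r *\<^sub>R unit_dir \<phi> \<in> D"
    then obtain t \<psi> where t: "0 \<le> t" "t < q \<psi>" "r *\<^sub>R unit_dir \<phi> = t *\<^sub>R unit_dir \<psi>" by (auto simp: D_def)
    have r: "r > 0" using that pos[of \<phi>] by simp
    have "r = t" "unit_dir \<phi> = unit_dir \<psi>" using polar_unique[OF t(3)] r t(1) by auto
    then show False using that t(2) unit_dir_cong(1)[of \<phi> \<psi>] by simp
  qed
  have cu: "continuous_on S unit_dir" for S
    using unit_dir_has_vector_derivative has_vector_derivative_continuous
    by (blast intro: continuous_at_imp_continuous_on)
  obtain m where m: "m > 0" "\<And>\<phi>. m \<le> q \<phi>"
  proof -
    have "continuous_on UNIV (\<lambda>x. - q x)" by (intro continuous_intros cq)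
    then obtain a where a: "\<And>\<psi>. - q \<psi> \<le> - q a"
      by (rule periodic_attains_sup[of "\<lambda>x. - q x" "2 * pi"]) (auto simp: per)
    show ?thesis by (rule that[OF pos[of a]]) (use a in simp)
  qed
  have "- D = {x. m \<le> norm (x - s)} \<inter> (\<Inter>z\<in>K. {x. (z - s) \<bullet> (x - s) \<le> (x - s) \<bullet> (x - s)})" (is "_ = ?E")
  proof
    show "- D \<subseteq> ?E"
    proof
      fix x assume x: "x \<in> - D"
      obtain r b where b: "0 \<le> r" "0 \<le> b" "b < 2 * pi" "x - s = r *\<^sub>R unit_dir b"
        using polar_decomposition[of "x - s"] by metis
      have xs: "x = s + r *\<^sub>R unit_dir b" using b(4) by (simp add: algebra_simps)
      have r: "q b \<le> r" using x b xs by (force simp: D_def)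
      have "(z - s) \<bullet> (x - s) \<le> (x - s) \<bullet> (x - s)" if "z \<in> K" for z
      proof -
        have "(z - s) \<bullet> (x - s) = r * ((z - s) \<bullet> unit_dir b)" using b(4) by simp
        also have "\<dots> \<le> r * r" using K_le[OF that, of b] r b(1) by (intro mult_left_mono) auto
        finally show ?thesis using b(4) by simp
      qed
      moreover have "m \<le> norm (x - s)" using b(1,4) r m(2)[of b] by simp
      ultimately show "x \<in> ?E" by simp
    qed
    show "?E \<subseteq> - D"
    proof
      fix x assume x: "x \<in> ?E"
      obtain r b where b: "0 \<le> r" "0 \<le> b" "b < 2 * pi" "x - s = r *\<^sub>R unit_dir b"
        using polar_decomposition[of "x - s"] by metis
      have xs: "x = s + r *\<^sub>R unit_dir b" using b(4) by (simp add: algebra_simps)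
      have r: "r > 0" using x m(1) b by simp
      have "(contact b - s) \<bullet> (x - s) \<le> (x - s) \<bullet> (x - s)" using x contact_in by simp
      then have "r * q b \<le> r * r" using b(4) by simp
      then have "q b \<le> r" using r by simp
      then show "x \<in> - D" using notD xs by simp
    qed
  qed
  moreover have "closed ?E"
    by (intro closed_Int closed_INT ballI closed_Collect_le continuous_intros)
  ultimately have openD: "open D" by (simp add: open_closed)
  have unD: "D \<union> \<Gamma> = (\<lambda>(t, \<phi>). s + t *\<^sub>R (q \<phi> *\<^sub>R unit_dir \<phi>)) ` ({0..1} \<times> {0..2 * pi})" (is "_ = ?B")
  proof
    show "D \<union> \<Gamma> \<subseteq> ?B"
    proof
      fix x assume "x \<in> D \<union> \<Gamma>"
      then obtain r \<phi> where r: "0 \<le> r" "r \<le> q \<phi>" "\<phi> \<in> {0..2 * pi}" "x = s + r *\<^sub>R unit_dir \<phi>"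
      proof (cases "x \<in> \<Gamma>")
        case True
        then obtain \<phi> where "\<phi> \<in> {0..2 * pi}" "x = s + q \<phi> *\<^sub>R unit_dir \<phi>" by (auto simp: \<Gamma>_def)
        then show ?thesis using pos[of \<phi>] by (intro that[of "q \<phi>" \<phi>]) auto
      next
        case False
        then have "x \<in> D" using \<open>x \<in> D \<union> \<Gamma>\<close> by simp
        then obtain r \<phi> where "0 \<le> \<phi>" "\<phi> < 2 * pi" "0 \<le> r" "r < q \<phi>" "x = s + r *\<^sub>R unit_dir \<phi>"
          by (auto simp: D_def)
        then show ?thesis by (intro that[of r \<phi>]) auto
      qed
      then show "x \<in> ?B"
        using pos[of \<phi>] by (intro image_eqI[of _ _ "(r / q \<phi>, \<phi>)"]) (auto simp: field_simps)
    qed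
    show "?B \<subseteq> D \<union> \<Gamma>"
    proof clarify
      fix t \<phi> :: real assume t: "t \<in> {0..1}" and \<phi>: "\<phi> \<in> {0..2 * pi}"
        and n: "s + t *\<^sub>R (q \<phi> *\<^sub>R unit_dir \<phi>) \<notin> \<Gamma>"
      have "t \<noteq> 1" using n \<phi> by (auto simp: \<Gamma>_def)
      then have t1: "t * q \<phi> < q \<phi>" using t pos[of \<phi>] by simp
      define a where "a = (if \<phi> = 2 * pi then 0 else \<phi>)"
      have a: "0 \<le> a" "a < 2 * pi" "unit_dir a = unit_dir \<phi>"
        using \<phi> by (auto simp: a_def vec_eq_iff forall_2)
      show "s + t *\<^sub>R (q \<phi> *\<^sub>R unit_dir \<phi>) \<in> D"
        unfolding D_def using a t t1 pos[of \<phi>] unit_dir_cong(1)[OF a(3)]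
        by (intro CollectI exI[of _ "t * q \<phi>"] exI[of _ a]) simp
    qed
  qed
  have "compact ?B"
    unfolding case_prod_unfold
    by (intro compact_continuous_image continuous_intros compact_Times compact_Icc
        continuous_on_compose2[OF cq _ subset_UNIV] continuous_on_compose2[OF cu[of UNIV] _ subset_UNIV])
  then have B: "closed (D \<union> \<Gamma>)" "bounded D"
    using unD compact_imp_closed compact_imp_bounded bounded_subset by (metis, metis Un_upper1)
  have disj: "D \<inter> \<Gamma> = {}" using notD by (auto simp: \<Gamma>_def)
  have "inside \<Gamma> = D"
  proof
    have "frontier D \<subseteq> \<Gamma>"
      using closure_minimal[OF _ B(1), of D] openD by (auto simp: frontier_def interior_open)
    then have "inside (frontier D) - \<Gamma> \<subseteq> inside \<Gamma>" by (rule inside_mono)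
    moreover have "D \<subseteq> inside (frontier D)"
      using interior_inside_frontier[OF B(2)] openD by (simp add: interior_open)
    ultimately show "D \<subseteq> inside \<Gamma>" using disj by blast
    show "inside \<Gamma> \<subseteq> D"
    proof (rule ccontr)
      assume "\<not> inside \<Gamma> \<subseteq> D"
      then obtain x where x: "x \<in> inside \<Gamma>" "x \<notin> D" by blast
      obtain r b where b: "0 \<le> r" "0 \<le> b" "b < 2 * pi" "x - s = r *\<^sub>R unit_dir b"
        using polar_decomposition[of "x - s"] by metis
      have xs: "x = s + r *\<^sub>R unit_dir b" using b(4) by (simp add: algebra_simps)
      have "r \<ge> q b" using x(2) b xs by (force simp: D_def)
      moreover have "r \<noteq> q b"
      proof
        assume "r = q b"
        then have "x \<in> \<Gamma>" using b xs by (auto simp: \<Gamma>_def)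
        then show False using x(1) inside_no_overlap by blast
      qed
      ultimately have r: "r > q b" by simp
      define U where "U = (\<lambda>t. s + t *\<^sub>R unit_dir b) ` {r..}"
      have "connected U"
        unfolding U_def by (intro connected_continuous_image continuous_intros) simp
      moreover have "x \<in> U" using xs by (auto simp: U_def)
      moreover have "U \<subseteq> - \<Gamma>"
      proof
        fix y assume "y \<in> U"
        then obtain t where t: "t \<ge> r" "y = s + t *\<^sub>R unit_dir b" by (auto simp: U_def)
        have t0: "t > 0" using t(1) r pos[of b] by linarith
        have "y \<notin> \<Gamma>"
        proof
          assume "y \<in> \<Gamma>"
          then obtain \<psi> where "t *\<^sub>R unit_dir b = q \<psi> *\<^sub>R unit_dir \<psi>" using t(2) by (auto simp: \<Gamma>_def)
          from polar_unique[OF this] t0 pos[of \<psi>] have "t = q \<psi>" "unit_dir b = unit_dir \<psi>" by auto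
          then show False using unit_dir_cong(1)[of b \<psi>] t(1) r by simp
        qed
        then show "y \<in> - \<Gamma>" by simp
      qed
      ultimately have "U \<subseteq> connected_component_set (- \<Gamma>) x" by (intro connected_component_maximal)
      then have "bounded U" using x(1) bounded_subset by (auto simp: inside_def)
      then obtain M where M: "\<And>y. y \<in> U \<Longrightarrow> norm y \<le> M" by (auto simp: bounded_iff)
      define t where "t = max r (M + norm s + 1)"
      have "norm (s + t *\<^sub>R unit_dir b) \<le> M" by (rule M) (auto simp: U_def t_def)
      moreover have "norm (t *\<^sub>R unit_dir b) \<le> norm (s + t *\<^sub>R unit_dir b) + norm s"
        using norm_triangle_ineq4[of "s + t *\<^sub>R unit_dir b" s] by simp
      ultimately show False using b(1) by (auto simp: t_def)
    qed
  qed
  moreover have "measure lebesgue D = circ (\<lambda>\<phi>. (q \<phi>)\<^sup>2) / 2"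
  proof -
    define C where "C \<phi> = q \<phi> *\<^sub>R unit_dir \<phi>" for \<phi>
    define C' where "C' \<phi> = q \<phi> *\<^sub>R rot_dir \<phi> + q' \<phi> *\<^sub>R unit_dir \<phi>" for \<phi>
    have dC: "(C has_vector_derivative C' \<phi>) (at \<phi>)" for \<phi>
      unfolding C_def[abs_def] C'_def
      by (intro has_vector_derivative_scaleR unit_dir_has_vector_derivative dq)
    have w: "C \<phi> $ 1 * C' \<phi> $ 2 - C \<phi> $ 2 * C' \<phi> $ 1 = (q \<phi>)\<^sup>2" for \<phi>
    proof -
      have "(a * c) * (a * c + b * s) - (a * s) * (a * - s + b * c) = a\<^sup>2 * (s\<^sup>2 + c\<^sup>2)" for a b c s :: real
        by algebra
      from this[of "q \<phi>" "cos \<phi>" "q' \<phi>" "sin \<phi>"] show ?thesis by (simp add: C_def C'_def)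
    qed
    have T: "{0<..<1} \<subseteq> {0<..<(1::real)}" "{0<..<(1::real)} \<subseteq> {0..1}" by auto
    have cw: "continuous_on UNIV (\<lambda>\<phi>. (q \<phi>)\<^sup>2)" by (intro continuous_intros cq)
    have inj: "inj_on (\<lambda>(t, \<phi>). s + t *\<^sub>R C \<phi>) ({0<..<1} \<times> {0..<2 * pi})"
    proof (rule inj_onI, clarify)
      fix t \<phi> t' \<psi> :: real
      assume t: "t \<in> {0<..<1}" "t' \<in> {0<..<1}" and \<phi>: "\<phi> \<in> {0..<2 * pi}" "\<psi> \<in> {0..<2 * pi}"
        and eq: "s + t *\<^sub>R C \<phi> = s + t' *\<^sub>R C \<psi>"
      have p: "(t * q \<phi>) *\<^sub>R unit_dir \<phi> = (t' * q \<psi>) *\<^sub>R unit_dir \<psi>" using eq by (simp add: C_def)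
      have n: "t * q \<phi> > 0" "t' * q \<psi> > 0" using t pos by simp_all
      have "unit_dir \<phi> = unit_dir \<psi>" 
        using polar_unique(2)[OF p less_imp_le[OF n(1)] less_imp_le[OF n(2)]] n(1) by (metis less_irrefl)
      then have "\<phi> = \<psi>" using unit_dir_inj_on \<phi> by blast
      moreover have "t * q \<phi> = t' * q \<psi>" using polar_unique(1)[OF p] n by simp
      ultimately show "t = t' \<and> \<phi> = \<psi>" using pos[of \<psi>] by simp
    qed
    note area = star_area[OF dC w zero_le_power2 cw T inj]
    have "D = insert s ((\<lambda>(t, \<phi>). s + t *\<^sub>R C \<phi>) ` ({0<..<1} \<times> {0..<2 * pi}))"
    proof
      show "D \<subseteq> insert s ((\<lambda>(t, \<phi>). s + t *\<^sub>R C \<phi>) ` ({0<..<1} \<times> {0..<2 * pi}))"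
      proof
        fix x assume "x \<in> D"
        then obtain r \<phi> where r: "0 \<le> \<phi>" "\<phi> < 2 * pi" "0 \<le> r" "r < q \<phi>" "x = s + r *\<^sub>R unit_dir \<phi>"
          by (auto simp: D_def)
        show "x \<in> insert s ((\<lambda>(t, \<phi>). s + t *\<^sub>R C \<phi>) ` ({0<..<1} \<times> {0..<2 * pi}))"
        proof (cases "r = 0")
          case False
          have "x = (\<lambda>(t, \<phi>). s + t *\<^sub>R C \<phi>) (r / q \<phi>, \<phi>)" using r pos[of \<phi>] by (simp add: C_def)
          moreover have "(r / q \<phi>, \<phi>) \<in> {0<..<1} \<times> {0..<2 * pi}" using r False pos[of \<phi>] by simp
          ultimately show ?thesis by blast
        qed (use r in simp)
      qed
      have "s \<in> D" unfolding D_def using pos[of 0]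
        by (intro CollectI exI[of _ 0]) simp
      moreover have "s + t *\<^sub>R C \<phi> \<in> D" if "0 < t" "t < 1" "0 \<le> \<phi>" "\<phi> < 2 * pi" for t \<phi>
        unfolding D_def using that pos[of \<phi>]
        by (intro CollectI exI[of _ "t * q \<phi>"] exI[of _ \<phi>]) (simp add: C_def)
      ultimately show "insert s ((\<lambda>(t, \<phi>). s + t *\<^sub>R C \<phi>) ` ({0<..<1} \<times> {0..<2 * pi})) \<subseteq> D" by auto
    qed
    then show ?thesis using area(2) measure_insert_lebesgue[OF area(1)] by simp
  qed
  ultimately show ?thesis by (simp add: \<Gamma>_def)
qed

end

section \<open>The support function about the Steiner point\<close>

lemma integral_unit_dir_squares:
  "circ (\<lambda>x. cos x * cos x) = pi" "circ (\<lambda>x. sin x * sin x) = pi" "circ (\<lambda>x. cos x * sin x) = 0"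
proof -
  have "circ (\<lambda>x. cos x * cos x) = - circ (\<lambda>x. sin x * - sin x)"
    by (rule circ_by_parts) (auto intro!: derivative_eq_intros continuous_intros)
  moreover have "circ (\<lambda>x. cos x * cos x) + circ (\<lambda>x. sin x * sin x) = circ (\<lambda>x. cos x * cos x + sin x * sin x)"
    by (rule circ_add[symmetric]; intro continuous_intros)
  ultimately show "circ (\<lambda>x. cos x * cos x) = pi" "circ (\<lambda>x. sin x * sin x) = pi" by simp_all
  have "circ (\<lambda>x. cos x * sin x) = (sin (2 * pi))\<^sup>2 / 2 - (sin 0)\<^sup>2 / 2"
    by (rule integral_eq_diff(2)) (auto intro!: derivative_eq_intros)
  then show "circ (\<lambda>x. cos x * sin x) = 0" by simp
qed

lemma circ_eq_0_imp_0:
  fixes f :: "real \<Rightarrow> real"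
  assumes "continuous_on UNIV f" "\<And>x. 0 \<le> f x" "\<And>x. f (x + 2 * pi) = f x" "circ f = 0"
  shows "f x = 0"
proof -
  obtain n :: int where n: "0 \<le> x + of_int n * (2 * pi)" "x + of_int n * (2 * pi) < 0 + 2 * pi"
    using shift_into_period[of "2 * pi" 0 x] by auto
  have "f (x + of_int n * (2 * pi)) = 0"
    by (rule has_integral_0_cbox_imp_0[of 0 "2 * pi"])
       (use n assms circ_has_integral[OF assms(1)] continuous_on_subset[OF assms(1)] in auto)
  then show ?thesis using periodic_of_int[of f "2 * pi" x n, OF assms(3)] by simp
qed

lemma support_fun_properties:
  assumes K: "compact K" "K \<noteq> {}"
  shows "x \<in> K \<Longrightarrow> x \<bullet> unit_dir \<phi> \<le> support_fun K \<phi>"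
    and "\<exists>z\<in>K. z \<bullet> unit_dir \<phi> = support_fun K \<phi>"
    and "support_fun K (\<phi> + 2 * pi) = support_fun K \<phi>"
proof -
  have eq: "support_fun K \<phi> = (SUP z\<in>K. z \<bullet> unit_dir \<phi>)" for \<phi>
    by (simp add: support_fun_def inner_unit_dir)
  obtain z where z: "z \<in> K" "\<And>y. y \<in> K \<Longrightarrow> y \<bullet> unit_dir \<phi> \<le> z \<bullet> unit_dir \<phi>"
  proof -
    have "continuous_on K (\<lambda>z. z \<bullet> unit_dir \<phi>)" by (intro continuous_intros)
    from continuous_attains_sup[OF K this] show ?thesis using that by blast
  qed
  have "(SUP y\<in>K. y \<bullet> unit_dir \<phi>) = z \<bullet> unit_dir \<phi>"
    using z by (intro cSup_eq_maximum) auto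
  then show "x \<in> K \<Longrightarrow> x \<bullet> unit_dir \<phi> \<le> support_fun K \<phi>"
    "\<exists>z\<in>K. z \<bullet> unit_dir \<phi> = support_fun K \<phi>"
    unfolding eq using z by auto
  show "support_fun K (\<phi> + 2 * pi) = support_fun K \<phi>" by (simp add: support_fun_def)
qed

lemma convex_closed_eq_support:
  assumes "compact K" "convex K" "K \<noteq> {}"
  shows "K = {x. \<forall>\<phi>. x \<bullet> unit_dir \<phi> \<le> support_fun K \<phi>}"
proof
  show "K \<subseteq> {x. \<forall>\<phi>. x \<bullet> unit_dir \<phi> \<le> support_fun K \<phi>}"
    using support_fun_properties(1)[OF assms(1,3)] by blast
  show "{x. \<forall>\<phi>. x \<bullet> unit_dir \<phi> \<le> support_fun K \<phi>} \<subseteq> K"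
  proof (rule ccontr)
    assume "\<not> {x. \<forall>\<phi>. x \<bullet> unit_dir \<phi> \<le> support_fun K \<phi>} \<subseteq> K"
    then obtain x where x: "\<And>\<phi>. x \<bullet> unit_dir \<phi> \<le> support_fun K \<phi>" "x \<notin> K" by blast
    obtain a b where ab: "a \<bullet> x < b" "\<And>y. y \<in> K \<Longrightarrow> b < a \<bullet> y"
      using separating_hyperplane_closed_point[OF assms(2) compact_imp_closed[OF assms(1)] x(2)] by blast
    obtain r \<phi> where r: "0 \<le> r" "- a = r *\<^sub>R unit_dir \<phi>" using polar_decomposition by metis
    obtain z where z: "z \<in> K" "z \<bullet> unit_dir \<phi> = support_fun K \<phi>"
      using support_fun_properties(2)[OF assms(1,3)] by blast
    have a: "a \<bullet> y = - (r * (y \<bullet> unit_dir \<phi>))" for y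
    proof -
      have "(- a) \<bullet> y = r * (y \<bullet> unit_dir \<phi>)" unfolding r by (simp add: inner_commute)
      then show ?thesis by simp
    qed
    have "r * (x \<bullet> unit_dir \<phi>) \<le> r * support_fun K \<phi>" using x(1) r(1) by (rule mult_left_mono)
    moreover have "a \<bullet> x < a \<bullet> z" using ab z(1) by force
    ultimately show False using a[of x] a[of z] z(2) by simp
  qed
qed

text \<open>If the width of \<open>K\<close> in some direction were zero, \<open>K\<close> would be the single contact point there, and the
boundary curve would have velocity zero. If one point were the contact point for two normals, the
velocity of the boundary curve there would be orthogonal to both; the normals would be opposite,
which the positive width excludes. Finally \<open>q\<close> is positive because the Steiner point is the mean
of the contact points: integration by parts gives \<open>\<integral> contact \<bullet> u(\<alpha>) = 2 \<pi> s \<bullet> u(\<alpha>)\<close>, and the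
integrand is at most \<open>p(\<alpha>)\<close>, strictly at \<open>\<phi> = \<alpha> + \<pi>\<close>.\<close>

lemma support_oval_of_C2_boundary:
  fixes K :: "(real^2) set"
  assumes K: "compact K" "convex K" and bd: "C2_boundary K" and sf: "C2_function (support_fun K)"
  defines "s \<equiv> steiner_point K" and "q \<equiv> steiner_support_fun K"
  obtains q' q'' where "support_oval K s q q' q''" "circ (\<lambda>x. q x * cos x) = 0" "circ (\<lambda>x. q x * sin x) = 0"
proof -
  define p where "p = support_fun K"
  obtain p' p'' where dp: "\<And>x. (p has_real_derivative p' x) (at x)"
      and dp': "\<And>x. (p' has_real_derivative p'' x) (at x)" and cp'': "continuous_on UNIV p''"
    using sf by (auto simp: C2_function_def C1_differentiable_on_def p_def has_real_derivative_iff_has_vector_derivative)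
  have cp: "continuous_on UNIV p" and cp': "continuous_on UNIV p'"
    using continuous_of_deriv dp dp' by blast+
  note [continuous_intros] = continuous_on_compose2[OF cp _ subset_UNIV]
    continuous_on_compose2[OF cp' _ subset_UNIV] continuous_on_compose2[OF cp'' _ subset_UNIV]
  obtain \<gamma> \<gamma>' where d\<gamma>: "\<And>t. (\<gamma> has_vector_derivative \<gamma>' t) (at t)" and \<gamma>'0: "\<And>t. \<gamma>' t \<noteq> 0"
      and range: "range \<gamma> = frontier K"
    using bd unfolding C2_boundary_def C2_function_def by (metis vector_derivative_at)
  have frK: "frontier K \<subseteq> K" using K(1) by (simp add: compact_imp_closed frontier_subset_closed)
  have ne: "K \<noteq> {}" using range frK by blast
  have le: "x \<bullet> unit_dir \<phi> \<le> p \<phi>" if "x \<in> K" for x \<phi>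
    unfolding p_def by (rule support_fun_properties(1)[OF K(1) ne that])
  have perp: "p (x + 2 * pi) = p x" for x
    unfolding p_def by (rule support_fun_properties(3)[OF K(1) ne])
  have perp': "p' (x + 2 * pi) = p' x" for x using periodic_deriv[OF dp perp] .
  define c where "c \<phi> = p \<phi> *\<^sub>R unit_dir \<phi> + p' \<phi> *\<^sub>R rot_dir \<phi>" for \<phi>
  have touch: "z = c \<phi>" if "z \<in> K" "z \<bullet> unit_dir \<phi> = p \<phi>" for z \<phi>
    unfolding c_def by (rule touching_point_of_derivative[OF dp le[OF that(1)] that(2)])
  have cK: "c \<phi> \<in> K" "c \<phi> \<bullet> unit_dir \<phi> = p \<phi>" for \<phi>
  proof -
    obtain z where z: "z \<in> K" "z \<bullet> unit_dir \<phi> = p \<phi>"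
      using support_fun_properties(2)[OF K(1) ne] by (auto simp: p_def)
    then have "z = c \<phi>" by (rule touch)
    then show "c \<phi> \<in> K" "c \<phi> \<bullet> unit_dir \<phi> = p \<phi>" using z by simp_all
  qed
  have u_pi: "unit_dir (\<phi> + pi) = - unit_dir \<phi>" for \<phi>
    by (simp add: vec_eq_iff forall_2)
  have width: "p \<phi> + p (\<phi> + pi) > 0" for \<phi>
  proof (rule ccontr)
    assume "\<not> p \<phi> + p (\<phi> + pi) > 0"
    then have "x = c \<phi>" if "x \<in> K" for x
      using le[OF that, of \<phi>] le[OF that, of "\<phi> + pi"] that unfolding u_pi
      by (intro touch) (auto simp del: unit_dir_nth)
    then have "\<gamma> t = c \<phi>" for t using range frK by blast
    then have "(\<gamma> has_vector_derivative 0) (at 0)"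
      by (metis (no_types, lifting) ext has_vector_derivative_const)
    then show False using d\<gamma>[of 0] \<gamma>'0[of 0] vector_derivative_unique_at by blast
  qed
  have c_inj: "unit_dir \<phi> = unit_dir \<psi>" if eq: "c \<phi> = c \<psi>" for \<phi> \<psi>
  proof -
    have "c \<phi> \<notin> interior K"
    proof
      assume "c \<phi> \<in> interior K"
      then obtain e where e: "e > 0" "cball (c \<phi>) e \<subseteq> K" using mem_interior_cball by blast
      have "c \<phi> + e *\<^sub>R unit_dir \<phi> \<in> K" using e by (intro subsetD[OF e(2)]) (simp add: dist_norm)
      from le[OF this, of \<phi>] show False using cK(2)[of \<phi>] e(1) by (simp add: inner_add_left)
    qed
    then have "c \<phi> \<in> range \<gamma>"
      unfolding range frontier_def using cK(1) closure_subset by blast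
    then obtain t where t: "\<gamma> t = c \<phi>" by auto
    have tang: "\<gamma>' t \<bullet> unit_dir \<xi> = 0" if "\<gamma> t = c \<xi>" for \<xi>
    proof -
      have "((\<lambda>x. \<gamma> x \<bullet> unit_dir \<xi>) has_real_derivative \<gamma>' t \<bullet> unit_dir \<xi>) (at t)"
        using bounded_linear.has_vector_derivative[OF bounded_linear_inner_left d\<gamma>]
        by (simp add: has_real_derivative_iff_has_vector_derivative)
      moreover have "\<gamma> x \<bullet> unit_dir \<xi> \<le> \<gamma> t \<bullet> unit_dir \<xi>" for x
      proof -
        have "\<gamma> x \<in> K" using range frK by blast
        then show ?thesis using le cK(2) that by simp
      qed
      ultimately show ?thesis using DERIV_local_max[of _ _ t 1] zero_less_one by blast
    qed
    have t1: "\<gamma>' t \<bullet> unit_dir \<phi> = 0" and t2: "\<gamma>' t \<bullet> unit_dir \<psi> = 0"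
      using tang t eq by simp_all
    have "\<gamma>' t \<bullet> rot_dir \<phi> \<noteq> 0" using eq_by_frame[of "\<gamma>' t" \<phi> 0] t1 \<gamma>'0[of t] by auto
    moreover have "\<gamma>' t \<bullet> unit_dir (\<phi> + (\<psi> - \<phi>)) = sin (\<psi> - \<phi>) * (\<gamma>' t \<bullet> rot_dir \<phi>)"
      unfolding unit_dir_add by (simp add: inner_add_right t1)
    ultimately have sin0: "sin (\<psi> - \<phi>) = 0" using t2 by simp
    have "unit_dir \<psi> = cos (\<psi> - \<phi>) *\<^sub>R unit_dir \<phi>"
      using unit_dir_add[of \<phi> "\<psi> - \<phi>"] sin0 by simp
    moreover have "cos (\<psi> - \<phi>) \<noteq> - 1"
    proof
      assume "cos (\<psi> - \<phi>) = - 1"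
      then have u: "unit_dir \<psi> = unit_dir (\<phi> + pi)" using calculation u_pi by simp
      then have "cos \<psi> = cos (\<phi> + pi)" "sin \<psi> = sin (\<phi> + pi)" by (metis unit_dir_nth)+
      then have "p \<psi> = p (\<phi> + pi)" by (simp only: p_def support_fun_def)
      then have "c \<phi> \<bullet> unit_dir (\<phi> + pi) = p (\<phi> + pi)" using cK(2)[of \<psi>] eq u by simp
      then show False using cK(2)[of \<phi>] width[of \<phi>] by (simp add: u_pi)
    qed
    moreover have "cos (\<psi> - \<phi>) = 1 \<or> cos (\<psi> - \<phi>) = - 1"
      using sin_zero_abs_cos_one[OF sin0] by linarith
    ultimately show ?thesis by simp
  qed
  have cu: "continuous_on UNIV unit_dir"
    using unit_dir_has_vector_derivative has_vector_derivative_continuous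
    by (blast intro: continuous_at_imp_continuous_on)
  have s12: "pi * s $ 1 = circ (\<lambda>x. p x * cos x)" "pi * s $ 2 = circ (\<lambda>x. p x * sin x)"
  proof -
    have i: "(\<lambda>\<phi>. p \<phi> *\<^sub>R unit_dir \<phi>) integrable_on {0..2 * pi}"
      by (intro integrable_continuous_real continuous_intros continuous_on_subset[OF cu]) auto
    have "s $ k = 1 / pi * circ (\<lambda>\<phi>. (p \<phi> *\<^sub>R unit_dir \<phi>) $ k)" for k
      unfolding s_def steiner_point_def p_def[symmetric] integral_component_eq_cart[OF i] by simp
    from this[of 1] this[of 2]
    show "pi * s $ 1 = circ (\<lambda>x. p x * cos x)" "pi * s $ 2 = circ (\<lambda>x. p x * sin x)" by simp_all
  qed
  have q_eq: "q \<phi> = p \<phi> - s \<bullet> unit_dir \<phi>" for \<phi>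
    by (simp add: q_def s_def p_def steiner_support_fun_def inner_unit_dir)
  have q_pos: "q \<alpha> > 0" for \<alpha>
  proof -
    define D where "D \<phi> = p \<alpha> - c \<phi> \<bullet> unit_dir \<alpha>" for \<phi>
    have c_in: "c \<phi> \<bullet> unit_dir \<alpha> = p \<phi> * cos (\<phi> - \<alpha>) - p' \<phi> * sin (\<phi> - \<alpha>)" for \<phi>
      by (simp add: c_def inner_real2 cos_diff sin_diff algebra_simps)
    have D0: "D \<phi> \<ge> 0" for \<phi> using le[OF cK(1)] by (simp add: D_def)
    have cD: "continuous_on UNIV D" unfolding D_def[abs_def] c_in by (intro continuous_intros)
    have perD: "D (\<phi> + 2 * pi) = D \<phi>" for \<phi>
    proof -
      have "\<phi> + 2 * pi - \<alpha> = (\<phi> - \<alpha>) + 2 * pi" by simp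
      then show ?thesis unfolding D_def c_in perp perp' by (simp only: sin_periodic cos_periodic)
    qed
    have "circ (\<lambda>x. p' x * sin (x - \<alpha>)) = - circ (\<lambda>x. p x * cos (x - \<alpha>))"
    proof (rule circ_by_parts)
      show "((\<lambda>x. sin (x - \<alpha>)) has_real_derivative cos (x - \<alpha>)) (at x)" for x
        by (auto intro!: derivative_eq_intros)
      show "sin (x + 2 * pi - \<alpha>) = sin (x - \<alpha>)" for x
        using sin_periodic[of "x - \<alpha>"] by (simp add: algebra_simps)
    qed (auto intro!: dp cp' perp continuous_intros)
    moreover have "circ (\<lambda>x. p x * cos (x - \<alpha>)) = pi * (s \<bullet> unit_dir \<alpha>)"
    proof -
      have "p x * cos (x - \<alpha>) = cos \<alpha> * (p x * cos x) + sin \<alpha> * (p x * sin x) + 0 * p x" for x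
        by (simp add: cos_diff algebra_simps)
      then have "circ (\<lambda>x. p x * cos (x - \<alpha>)) =
          cos \<alpha> * circ (\<lambda>x. p x * cos x) + sin \<alpha> * circ (\<lambda>x. p x * sin x) + 0 * circ p"
        by (simp only:) (rule circ_lin3; intro continuous_intros)
      then show ?thesis unfolding s12[symmetric] by (simp add: inner_unit_dir algebra_simps)
    qed
    moreover have "circ D = circ (\<lambda>x. p \<alpha> * 1 + (- 1) * (p x * cos (x - \<alpha>)) + 1 * (p' x * sin (x - \<alpha>)))"
    proof -
      have "D = (\<lambda>x. p \<alpha> * 1 + (- 1) * (p x * cos (x - \<alpha>)) + 1 * (p' x * sin (x - \<alpha>)))"
        by (rule ext) (simp add: D_def c_in)
      then show ?thesis by (simp only:)
    qed
    moreover have "\<dots> = p \<alpha> * circ (\<lambda>x. 1) + (- 1) * circ (\<lambda>x. p x * cos (x - \<alpha>)) + 1 * circ (\<lambda>x. p' x * sin (x - \<alpha>))"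
      by (rule circ_lin3; intro continuous_intros)
    ultimately have "circ D = 2 * pi * q \<alpha>" by (simp add: q_eq algebra_simps)
    moreover have "circ D \<ge> 0"
      by (rule has_integral_nonneg[OF circ_has_integral[OF cD]]) (rule D0)
    moreover have "circ D \<noteq> 0"
    proof
      assume "circ D = 0"
      then have "D (\<alpha> + pi) = 0" by (rule circ_eq_0_imp_0[OF cD D0 perD])
      then show False using cK(2)[of "\<alpha> + pi"] width[of \<alpha>] by (simp add: D_def u_pi)
    qed
    ultimately have "0 < 2 * pi * q \<alpha>" by linarith
    then show ?thesis by (simp add: zero_less_mult_iff)
  qed
  define q' where "q' \<phi> = p' \<phi> - s \<bullet> rot_dir \<phi>" for \<phi>
  define q'' where "q'' \<phi> = p'' \<phi> + s \<bullet> unit_dir \<phi>" for \<phi>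
  have contact: "s + q \<phi> *\<^sub>R unit_dir \<phi> + q' \<phi> *\<^sub>R rot_dir \<phi> = c \<phi>" for \<phi>
  proof -
    have "s + q \<phi> *\<^sub>R unit_dir \<phi> + q' \<phi> *\<^sub>R rot_dir \<phi> =
        s - ((s \<bullet> unit_dir \<phi>) *\<^sub>R unit_dir \<phi> + (s \<bullet> rot_dir \<phi>) *\<^sub>R rot_dir \<phi>) + c \<phi>"
      by (simp add: q_eq q'_def c_def algebra_simps)
    then show ?thesis using frame_decomp[of s \<phi>] by simp
  qed
  have "support_oval K s q q' q''"
  proof
    show "(q has_real_derivative q' x) (at x)" for x
      unfolding q_eq[abs_def] q'_def inner_unit_dir inner_rot_dir
      by (auto intro!: derivative_eq_intros dp simp: algebra_simps)
    show "(q' has_real_derivative q'' x) (at x)" for x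
      unfolding q'_def[abs_def] q''_def inner_unit_dir inner_rot_dir
      by (auto intro!: derivative_eq_intros dp' simp: algebra_simps)
    show "continuous_on UNIV q''"
      unfolding q''_def[abs_def] inner_unit_dir by (intro continuous_intros)
    show "q (x + 2 * pi) = q x" for x by (simp add: q_eq perp inner_unit_dir)
    show "q \<phi> > 0" for \<phi> by (rule q_pos)
    show "K = {x. \<forall>\<phi>. (x - s) \<bullet> unit_dir \<phi> \<le> q \<phi>}"
      using convex_closed_eq_support[OF K ne] by (simp add: q_eq inner_diff_left p_def)
    show "s + q \<phi> *\<^sub>R unit_dir \<phi> + q' \<phi> *\<^sub>R rot_dir \<phi> \<in> K" for \<phi>
      unfolding contact by (rule cK)
    show "unit_dir \<phi> = unit_dir \<psi>" if "s + q \<phi> *\<^sub>R unit_dir \<phi> + q' \<phi> *\<^sub>R rot_dir \<phi> =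
        s + q \<psi> *\<^sub>R unit_dir \<psi> + q' \<psi> *\<^sub>R rot_dir \<psi>" for \<phi> \<psi>
      using that unfolding contact by (rule c_inj)
  qed
  moreover have "circ (\<lambda>x. q x * cos x) = 0"
  proof -
    have "q x * cos x = 1 * (p x * cos x) + (- s $ 1) * (cos x * cos x) + (- s $ 2) * (cos x * sin x)" for x
      by (simp add: q_eq inner_unit_dir algebra_simps)
    then have "circ (\<lambda>x. q x * cos x) =
        1 * circ (\<lambda>x. p x * cos x) + (- s $ 1) * circ (\<lambda>x. cos x * cos x) + (- s $ 2) * circ (\<lambda>x. cos x * sin x)"
      by (simp only:) (rule circ_lin3; intro continuous_intros)
    then show ?thesis unfolding integral_unit_dir_squares s12[symmetric] by simp
  qed
  moreover have "circ (\<lambda>x. q x * sin x) = 0"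
  proof -
    have "q x * sin x = 1 * (p x * sin x) + (- s $ 1) * (cos x * sin x) + (- s $ 2) * (sin x * sin x)" for x
      by (simp add: q_eq inner_unit_dir algebra_simps)
    then have "circ (\<lambda>x. q x * sin x) =
        1 * circ (\<lambda>x. p x * sin x) + (- s $ 1) * circ (\<lambda>x. cos x * sin x) + (- s $ 2) * circ (\<lambda>x. sin x * sin x)"
      by (simp only:) (rule circ_lin3; intro continuous_intros)
    then show ?thesis unfolding integral_unit_dir_squares s12[symmetric] by simp
  qed
  ultimately show ?thesis by (rule that)
qed

section \<open>The inequality for the visual angle\<close>

theorem corollary5p1:
  fixes K :: "(real^2) set" and F A :: real
  assumes "compact K" and "convex K"
    and "C2_boundary K"
    and "C2_function (support_fun K)"
    and "F = measure lebesgue K"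
    and "A = pedal_area K"
  shows "(LINT P:-K|lebesgue. (visual_angle K P)\<^sup>2 - (sin (visual_angle K P))\<^sup>2)
           \<ge> (16 - pi\<^sup>2) * F + 32 / 3 * (A - F) \<and>
         ((LINT P:-K|lebesgue. (visual_angle K P)\<^sup>2 - (sin (visual_angle K P))\<^sup>2)
           = (16 - pi\<^sup>2) * F + 32 / 3 * (A - F)
         \<longleftrightarrow> circle_or_parallel_to_astroid K)"
proof -
  define s where "s = steiner_point K"
  define q where "q = steiner_support_fun K"
  obtain q' q'' where "support_oval K s q q' q''"
      and mean: "circ (\<lambda>x. q x * cos x) = 0" "circ (\<lambda>x. q x * sin x) = 0"
    using support_oval_of_C2_boundary[OF assms(1-4)] unfolding s_def q_def by metis
  then interpret support_oval K s q q' q'' by simp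
  define I where "I = (LINT P:-K|lebesgue. (visual_angle K P)\<^sup>2 - (sin (visual_angle K P))\<^sup>2)"
  define S where "S = integral {0..pi} (\<lambda>t. circ (\<lambda>x. q x * q (x + t)) * sin t)"
  define a where "a = circ (\<lambda>x. (q x)\<^sup>2)"
  define b where "b = circ (\<lambda>x. (q' x)\<^sup>2)"
  have parts: "circ (\<lambda>x. q x * q'' x) = - b"
    using circ_by_parts[OF dq dq' cq' cq'' per per'] by (simp add: b_def power2_eq_square)
  have I_eq: "I = 4 * S - pi\<^sup>2 * (a - b) / 2"
    unfolding I_def exterior_integral exterior_integral_by_parts
    using parts by (simp add: S_def R0_def R2_def a_def power2_eq_square)
  have F_eq: "F = (a - b) / 2"
  proof -
    have "circ (\<lambda>x. q x * (q x + q'' x)) = circ (\<lambda>x. q x * q x + q x * q'' x)"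
      by (simp add: distrib_left)
    also have "\<dots> = circ (\<lambda>x. q x * q x) + circ (\<lambda>x. q x * q'' x)"
      by (intro circ_add continuous_intros cq cq'')
    finally show ?thesis unfolding assms(5) area_K using parts by (simp add: a_def power2_eq_square)
  qed
  have A_eq: "A = a / 2"
    using pedal_area_eq unfolding assms(6) pedal_area_def pedal_curve_def[abs_def] s_def[symmetric] q_def[symmetric]
    by (simp add: a_def)
  have key: "I - ((16 - pi\<^sup>2) * F + 32 / 3 * (A - F)) = 4 * S + 8 / 3 * b - 8 * a"
    unfolding I_eq F_eq A_eq by (simp add: field_simps)
  note ineq = autocorrelation_inequality[OF dq dq' cq'' per mean, folded S_def, folded a_def b_def]
  have "(16 - pi\<^sup>2) * F + 32 / 3 * (A - F) \<le> I" using key ineq(1) by linarith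
  moreover have "I = (16 - pi\<^sup>2) * F + 32 / 3 * (A - F) \<longleftrightarrow> 2 * a = S + 2 / 3 * b"
    using key by linarith
  ultimately show ?thesis
    unfolding I_def[symmetric] circle_or_parallel_to_astroid_def q_def[symmetric] using ineq(2) by simp
qed

end
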